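(* Let $A=\mathcal{A}_\mu(R,\sigma,t)$ be a regular, $\mu$-consistent TGWA of rank $m$ with canonical generators $X_1^{\pm},\dots,X_m^{\pm}$, and let $B=\mathcal{A}_\nu(S,\rho,h)$ be a regular, $\nu$-consistent TGWA of rank $n$ with canonical generators $Y_1^{\pm},\dots,Y_n^{\pm}$, such that the $\sigma_j$ and $\rho_i$ can be extended to commuting automorphisms of $R\otimes S$ with $\rho_i(R\otimes1)\subset R\otimes1$ and $\sigma_j(1\otimes S)\subset1\otimes S$ for all $i,j$. Suppose that $\tau:B\otimes A\to A\otimes B$ is a graded twisting map such that $A\otimes_\tau B$ is a regular TGWA generated over $R\otimes S$ by the elements $X_j^{\pm}\otimes1$ ($j\in[m]$) and $1\otimes Y_i^{\pm}$ ($i\in[n]$) as canonical generators. Then: (1) the $\sigma_j$ and $\rho_i$ extend to commuting automorphisms of $R\otimes S$ (still denoted $\sigma_j,\rho_i$); and (2) there are elements $q_{ij}^{(\pm,\pm)}$ ($i\in[n]$, $j\in[m]$), which are central units of $R\otimes S$ fixed by all of the extensions $\sigma_1,\dots,\sigma_m,\rho_1,\dots,\rho_n$, such that $$\tau(sY_{\mathbf v}\otimes rX_{\mathbf u})=q_{(\mathbf v,\mathbf u)}\,\rho^{d(\mathbf v)}(r)X_{\mathbf u}\otimes\sigma^{-d(\mathbf u)}(s)Y_{\mathbf v}$$ for all $r\in R$, $s\in S$ and all finite sequences $\mathbf u$ in $\pm[m]$ and $\mathbf v$ in $\pm[n]$. Here the right-hand side is the product $q_{(\mathbf v,\mathbf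 u)}\cdot\rho^{d(\mathbf v)}(r\otimes1)\cdot(X_{\mathbf u}\otimes1)\cdot\sigma^{-d(\mathbf u)}(1\otimes s)\cdot(1\otimes Y_{\mathbf v})$ in $A\otimes_\tau B$.
   Context: $k$ is a field; algebras are unital $k$-algebras; $\otimes=\otimes_k$; $[n]=\{1,\dots,n\}$; $\pm[n]=\{\pm1,\dots,\pm n\}$; $Z(R)$ is the center of $R$; $\mathbf e_i$ is the $i$-th standard basis vector. A twisted generalized Weyl datum (TGWD) of rank $n$ is a triple $(R,\sigma,t)$ with $R$ an algebra, $\sigma=(\sigma_1,\dots,\sigma_n)$ commuting automorphisms of $R$, and $t=(t_1,\dots,t_n)\in Z(R)^n$. For $\mu=(\mu_{ij})\in M_n(k^\times)$, the twisted generalized Weyl construction (TGWC) $\mathcal{C}_\mu(R,\sigma,t)$ is the algebra generated over $R$ by $X_1^{\pm},\dots,X_n^{\pm}$ (the canonical generators) with relations $X_i^{\pm}r=\sigma_i^{\pm1}(r)X_i^{\pm}$, $X_i^-X_i^+=t_i$, $X_i^+X_i^-=\sigma_i(t_i)$ for $r\in R$, $i\in[n]$, and $X_i^+X_j^-=\mu_{ij}X_j^-X_i^+$ for $i\ne j$. It is $\mathbb Z^n$-graded by $\deg r=\mathbf 0$, $\deg X_i^{\pm}=\pm\mathbf e_i$. The twisted generalized Weyl algebra (TGWA) is $\mathcal{A}_\mu(R,\sigma,t)=\mathcal{C}_\mu(R,\sigma,t)/\mathcal J$, where $\mathcal J$ is the sum of all graded ideals $J$ with $J_{\mathbf 0}=\{0\}$.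 The datum is regular if every $t_i$ is a regular element (non-zero-divisor) of $R$, and $\mu$-consistent if the canonical map $R\to\mathcal{A}_\mu(R,\sigma,t)$ is injective; a TGWA is regular (resp. $\mu$-consistent) if its datum is. "Extending" $\sigma_j$ means an automorphism of $R\otimes S$ sending $r\otimes1$ to $\sigma_j(r)\otimes1$; similarly for $\rho_i$ and $1\otimes s$. Notation: for $u\in\pm[m]$, $X_u=X_{|u|}^{\mathfrak s(u)}$ where $\mathfrak s(u)$ is the sign of $u$; for $\mathbf u=(u_1,\dots,u_p)\in(\pm[m])^p$, $X_{\mathbf u}=X_{u_1}\cdots X_{u_p}$ and $d(\mathbf u)=\deg X_{\mathbf u}\in\mathbb Z^m$; similarly $Y_{\mathbf v}$ and $d(\mathbf v)\in\mathbb Z^n$ for $\mathbf v\in(\pm[n])^\ell$. For $\alpha\in\mathbb Z^m$, $\sigma^\alpha=\sigma_1^{\alpha_1}\cdots\sigma_m^{\alpha_m}$; similarly $\rho^\beta$. For $v\in\pm[n]$, $u\in\pm[m]$, $q_{v,u}=q_{|v|,|u|}^{(\mathfrak s(v),\mathfrak s(u))}$, and $q_{(\mathbf v,\mathbf u)}=\prod_{i,j}q_{v_i,u_j}$. A twisting map is a $k$-linear $\tau:B\otimes A\to A\otimes B$ with $\tau(b\otimes1)=1\otimes b$ and $\tau(1\otimes a)=a\otimes1$; it is graded if $\tau(B_\beta\otimes A_\alpha)\subset A_\alpha\otimes B_\beta$ for all $\alpha\in\mathbb Z^m,\beta\in\mathbb Z^n$. $A\otimes_\tau B$ denotes $A\otimes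 B$ with multiplication $(\mu_A\otimes\mu_B)\circ(\mathrm{id}_A\otimes\tau\otimes\mathrm{id}_B)$ ($\mu_A,\mu_B$ the multiplications of $A,B$); it is assumed associative (the twisted tensor product).
   Formalization: The conditions ρ_i(R⊗1)⊂R⊗1 and σ_j(1⊗S)⊂1⊗S are additionally required of the automorphisms of R⊗S belonging to the TGWA A⊗_τB itself; if merely some extensions satisfy them, the claim that the q's are fixed can fail. *)

theory Defs
  imports "HOL-Algebra.Algebra"
begin

section \<open>Algebras over a field\<close>

text \<open>The locale \<^locale>\<open>algebra\<close> of the library is restricted to commutative algebras.\<close>

definition k_algebra :: "'k ring \<Rightarrow> ('k, 'a) module \<Rightarrow> bool" where
  "k_algebra K A \<longleftrightarrow> field K \<and> ring A \<and> module K A \<and>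
     (\<forall>c \<in> carrier K. \<forall>x \<in> carrier A. \<forall>y \<in> carrier A.
        (c \<odot>\<^bsub>A\<^esub> x) \<otimes>\<^bsub>A\<^esub> y = c \<odot>\<^bsub>A\<^esub> (x \<otimes>\<^bsub>A\<^esub> y) \<and>
        x \<otimes>\<^bsub>A\<^esub> (c \<odot>\<^bsub>A\<^esub> y) = c \<odot>\<^bsub>A\<^esub> (x \<otimes>\<^bsub>A\<^esub> y))"

definition lin_map :: "'k ring \<Rightarrow> ('k, 'a) module \<Rightarrow> ('k, 'b) module \<Rightarrow> ('a \<Rightarrow> 'b) set" where
  "lin_map K M N = {f \<in> carrier M \<rightarrow> carrier N.
     (\<forall>x \<in> carrier M. \<forall>y \<in> carrier M. f (x \<oplus>\<^bsub>M\<^esub> y) = f x \<oplus>\<^bsub>N\<^esub> f y) \<and>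
     (\<forall>c \<in> carrier K. \<forall>x \<in> carrier M. f (c \<odot>\<^bsub>M\<^esub> x) = c \<odot>\<^bsub>N\<^esub> f x)}"

definition alg_iso :: "'k ring \<Rightarrow> ('k, 'a) module \<Rightarrow> ('k, 'b) module \<Rightarrow> ('a \<Rightarrow> 'b) set" where
  "alg_iso K A B = ring_iso A B \<inter> lin_map K A B"

definition center :: "('a, 'e) ring_scheme \<Rightarrow> 'a set" where
  "center R = {z \<in> carrier R. \<forall>x \<in> carrier R. z \<otimes>\<^bsub>R\<^esub> x = x \<otimes>\<^bsub>R\<^esub> z}"

definition regular_elem :: "('a, 'e) ring_scheme \<Rightarrow> 'a \<Rightarrow> bool" where
  "regular_elem R t \<longleftrightarrow> t \<in> carrier R \<and>
     (\<forall>x \<in> carrier R. (t \<otimes>\<^bsub>R\<^esub> x = \<zero>\<^bsub>R\<^esub> \<longrightarrow> x = \<zero>\<^bsub>R\<^esub>) \<and> (x \<otimes>\<^bsub>R\<^esub> t = \<zero>\<^bsub>R\<^esub> \<longrightarrow> x = \<zero>\<^bsub>R\<^esub>))"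

definition commute_on :: "'a set \<Rightarrow> ('a \<Rightarrow> 'a) \<Rightarrow> ('a \<Rightarrow> 'a) \<Rightarrow> bool" where
  "commute_on U f g \<longleftrightarrow> (\<forall>x \<in> U. f (g x) = g (f x))"

definition list_prod :: "('a, 'e) ring_scheme \<Rightarrow> 'a list \<Rightarrow> 'a" where
  "list_prod R xs = foldr (\<lambda>x y. x \<otimes>\<^bsub>R\<^esub> y) xs \<one>\<^bsub>R\<^esub>"

definition kspan :: "'k ring \<Rightarrow> ('k, 'a) module \<Rightarrow> 'a set \<Rightarrow> 'a set" where
  "kspan K M U = \<Inter>{N. submodule N K M \<and> U \<subseteq> N}"

text \<open>Quotient of a module by a submodule, and of an algebra by an ideal (an ideal of a unital
  algebra is a subspace). For mere modules the fields \<^const>\<open>monoid.mult\<close> and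
  \<^const>\<open>monoid.one\<close> are meaningless.\<close>

definition quot :: "('k, 'a) module \<Rightarrow> 'a set \<Rightarrow> ('k, 'a set) module" where
  "quot M N = \<lparr>carrier = a_rcosets\<^bsub>M\<^esub> N, monoid.mult = rcoset_mult M N,
     one = N +>\<^bsub>M\<^esub> \<one>\<^bsub>M\<^esub>, ring.zero = N, ring.add = set_add M,
     smult = (\<lambda>c U. \<Union>u\<in>U. N +>\<^bsub>M\<^esub> (c \<odot>\<^bsub>M\<^esub> u))\<rparr>"

text \<open>Free module on the set \<open>U\<close>: finitely supported functions.\<close>

definition free_module :: "'k ring \<Rightarrow> 'x set \<Rightarrow> ('k, 'x \<Rightarrow> 'k) module" where
  "free_module K U =
     \<lparr>carrier = {p. (\<forall>x. p x \<in> carrier K) \<and> {x. p x \<noteq> \<zero>\<^bsub>K\<^esub>} \<subseteq> U \<and> finite {x. p x \<noteq> \<zero>\<^bsub>K\<^esub>}},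
      monoid.mult = undefined, one = undefined,
      ring.zero = (\<lambda>_. \<zero>\<^bsub>K\<^esub>), ring.add = (\<lambda>p q x. p x \<oplus>\<^bsub>K\<^esub> q x),
      smult = (\<lambda>c p x. c \<otimes>\<^bsub>K\<^esub> p x)\<rparr>"

definition single :: "'k ring \<Rightarrow> 'x \<Rightarrow> 'x \<Rightarrow> 'k" where
  "single K x = (\<lambda>y. if y = x then \<one>\<^bsub>K\<^esub> else \<zero>\<^bsub>K\<^esub>)"

definition free_algebra :: "'k ring \<Rightarrow> 'g set \<Rightarrow> ('k, 'g list \<Rightarrow> 'k) module" where
  "free_algebra K G = (free_module K (lists G))
     \<lparr>monoid.mult := (\<lambda>p q ws. \<Oplus>\<^bsub>K\<^esub>i\<in>{..length ws}. p (take i ws) \<otimes>\<^bsub>K\<^esub> q (drop i ws)),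
      one := single K []\<rparr>"

section \<open>Tensor products\<close>

definition tensor_rels :: "'k ring \<Rightarrow> ('k, 'a) module \<Rightarrow> ('k, 'b) module \<Rightarrow> ('a \<times> 'b \<Rightarrow> 'k) set" where
  "tensor_rels K A B =
    (let F = free_module K (carrier A \<times> carrier B); e = (\<lambda>a b. single K (a, b)) in
      {e (a \<oplus>\<^bsub>A\<^esub> a') b \<ominus>\<^bsub>F\<^esub> (e a b \<oplus>\<^bsub>F\<^esub> e a' b) |a a' b.
          a \<in> carrier A \<and> a' \<in> carrier A \<and> b \<in> carrier B} \<union>
      {e a (b \<oplus>\<^bsub>B\<^esub> b') \<ominus>\<^bsub>F\<^esub> (e a b \<oplus>\<^bsub>F\<^esub> e a b') |a b b'.
          a \<in> carrier A \<and> b \<in> carrier B \<and> b' \<in> carrier B} \<union>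
      {e (c \<odot>\<^bsub>A\<^esub> a) b \<ominus>\<^bsub>F\<^esub> (c \<odot>\<^bsub>F\<^esub> e a b) |c a b.
          c \<in> carrier K \<and> a \<in> carrier A \<and> b \<in> carrier B} \<union>
      {e a (c \<odot>\<^bsub>B\<^esub> b) \<ominus>\<^bsub>F\<^esub> (c \<odot>\<^bsub>F\<^esub> e a b) |c a b.
          c \<in> carrier K \<and> a \<in> carrier A \<and> b \<in> carrier B})"

definition tensor_null :: "'k ring \<Rightarrow> ('k, 'a) module \<Rightarrow> ('k, 'b) module \<Rightarrow> ('a \<times> 'b \<Rightarrow> 'k) set" where
  "tensor_null K A B =
     kspan K (free_module K (carrier A \<times> carrier B)) (tensor_rels K A B)"

definition tensor_mod ::
  "'k ring \<Rightarrow> ('k, 'a) module \<Rightarrow> ('k, 'b) module \<Rightarrow> ('k, ('a \<times> 'b \<Rightarrow> 'k) set) module" where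
  "tensor_mod K A B = quot (free_module K (carrier A \<times> carrier B)) (tensor_null K A B)"

definition tens ::
  "'k ring \<Rightarrow> ('k, 'a) module \<Rightarrow> ('k, 'b) module \<Rightarrow> 'a \<Rightarrow> 'b \<Rightarrow> ('a \<times> 'b \<Rightarrow> 'k) set" where
  "tens K A B a b =
     tensor_null K A B +>\<^bsub>free_module K (carrier A \<times> carrier B)\<^esub> single K (a, b)"

text \<open>For bilinear \<open>f\<close> this is the linear map sending \<open>a \<otimes> b\<close> to \<open>f a b\<close>; the value does not
  depend on the representative chosen in the coset \<open>U\<close>.\<close>

definition tensor_lift ::
  "'k ring \<Rightarrow> ('k, 'c) module \<Rightarrow> ('a \<Rightarrow> 'b \<Rightarrow> 'c) \<Rightarrow> ('a \<times> 'b \<Rightarrow> 'k) set \<Rightarrow> 'c" where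
  "tensor_lift K M f U =
     (let p = (SOME p. p \<in> U) in
        \<Oplus>\<^bsub>M\<^esub>ab\<in>{ab. p ab \<noteq> \<zero>\<^bsub>K\<^esub>}. p ab \<odot>\<^bsub>M\<^esub> f (fst ab) (snd ab))"

definition tensor_alg ::
  "'k ring \<Rightarrow> ('k, 'a) module \<Rightarrow> ('k, 'b) module \<Rightarrow> ('k, ('a \<times> 'b \<Rightarrow> 'k) set) module" where
  "tensor_alg K A B = (let M = tensor_mod K A B in
     M\<lparr>monoid.mult := (\<lambda>x y.
          tensor_lift K M (\<lambda>a b.
            tensor_lift K M (\<lambda>a' b'. tens K A B (a \<otimes>\<^bsub>A\<^esub> a') (b \<otimes>\<^bsub>B\<^esub> b')) y) x),
       one := tens K A B \<one>\<^bsub>A\<^esub> \<one>\<^bsub>B\<^esub>\<rparr>)"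

text \<open>The product \<open>(\<mu>\<^sub>A \<otimes> \<mu>\<^sub>B) \<circ> (id \<otimes> \<tau> \<otimes> id)\<close>: with \<open>\<tau> (b \<otimes> a') = \<Sum> a'' \<otimes> b''\<close> it sends
  \<open>(a \<otimes> b, a' \<otimes> b')\<close> to \<open>\<Sum> a a'' \<otimes> b'' b'\<close>.\<close>

definition twisted_tensor ::
  "'k ring \<Rightarrow> ('k, 'a) module \<Rightarrow> ('k, 'b) module \<Rightarrow> (('b \<times> 'a \<Rightarrow> 'k) set \<Rightarrow> ('a \<times> 'b \<Rightarrow> 'k) set) \<Rightarrow>
   ('k, ('a \<times> 'b \<Rightarrow> 'k) set) module" where
  "twisted_tensor K A B \<tau> = (let M = tensor_mod K A B in
     M\<lparr>monoid.mult := (\<lambda>x y.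
          tensor_lift K M (\<lambda>a b.
            tensor_lift K M (\<lambda>a' b'.
              tensor_lift K M (\<lambda>a'' b''. tens K A B (a \<otimes>\<^bsub>A\<^esub> a'') (b'' \<otimes>\<^bsub>B\<^esub> b'))
                (\<tau> (tens K B A b a'))) y) x),
       one := tens K A B \<one>\<^bsub>A\<^esub> \<one>\<^bsub>B\<^esub>\<rparr>)"

definition twisting_map ::
  "'k ring \<Rightarrow> ('k, 'a) module \<Rightarrow> ('k, 'b) module \<Rightarrow>
   (('b \<times> 'a \<Rightarrow> 'k) set \<Rightarrow> ('a \<times> 'b \<Rightarrow> 'k) set) \<Rightarrow> bool" where
  "twisting_map K A B \<tau> \<longleftrightarrow>
     \<tau> \<in> lin_map K (tensor_mod K B A) (tensor_mod K A B) \<and>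
     (\<forall>b \<in> carrier B. \<tau> (tens K B A b \<one>\<^bsub>A\<^esub>) = tens K A B \<one>\<^bsub>A\<^esub> b) \<and>
     (\<forall>a \<in> carrier A. \<tau> (tens K B A \<one>\<^bsub>B\<^esub> a) = tens K A B a \<one>\<^bsub>B\<^esub>)"

text \<open>The image of \<open>U \<otimes> V\<close> in \<open>A \<otimes> B\<close>.\<close>

definition tensor_sub ::
  "'k ring \<Rightarrow> ('k, 'a) module \<Rightarrow> ('k, 'b) module \<Rightarrow> 'a set \<Rightarrow> 'b set \<Rightarrow> ('a \<times> 'b \<Rightarrow> 'k) set set" where
  "tensor_sub K A B U V = kspan K (tensor_mod K A B) {tens K A B u v |u v. u \<in> U \<and> v \<in> V}"

section \<open>Automorphisms and multi-indices\<close>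

definition alg_auto :: "'k ring \<Rightarrow> ('k, 'a) module \<Rightarrow> ('a \<Rightarrow> 'a) \<Rightarrow> bool" where
  "alg_auto K R f \<longleftrightarrow> f \<in> alg_iso K R R"

definition auto_zpow :: "('a, 'e) ring_scheme \<Rightarrow> ('a \<Rightarrow> 'a) \<Rightarrow> int \<Rightarrow> 'a \<Rightarrow> 'a" where
  "auto_zpow R f k = (if 0 \<le> k then f ^^ nat k else inv_into (carrier R) f ^^ nat (- k))"

primrec multi_pow ::
  "('a, 'e) ring_scheme \<Rightarrow> nat \<Rightarrow> (nat \<Rightarrow> 'a \<Rightarrow> 'a) \<Rightarrow> (nat \<Rightarrow> int) \<Rightarrow> 'a \<Rightarrow> 'a" where
  "multi_pow R 0 \<sigma> \<alpha> = id"
| "multi_pow R (Suc m) \<sigma> \<alpha> = multi_pow R m \<sigma> \<alpha> \<circ> auto_zpow R (\<sigma> (Suc m)) (\<alpha> (Suc m))"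

text \<open>\<open>pm m\<close> is \<open>{\<plusminus>1, \<dots>, \<plusminus>m}\<close>, and \<open>ZZ m\<close> is \<open>\<int>\<^sup>m\<close> with coordinates indexed by \<open>1, \<dots>, m\<close>.\<close>

definition pm :: "nat \<Rightarrow> int set" where
  "pm m = {u. u \<noteq> 0 \<and> \<bar>u\<bar> \<le> int m}"

definition ZZ :: "nat \<Rightarrow> (nat \<Rightarrow> int) set" where
  "ZZ m = {\<alpha>. \<forall>i. i \<notin> {1..m} \<longrightarrow> \<alpha> i = 0}"

definition signed_unit :: "int \<Rightarrow> nat \<Rightarrow> int" where
  "signed_unit u = (\<lambda>i. if i = nat \<bar>u\<bar> then sgn u else 0)"

definition seq_deg :: "int list \<Rightarrow> nat \<Rightarrow> int" where
  "seq_deg us = (\<lambda>i. \<Sum>u\<leftarrow>us. signed_unit u i)"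

definition signed_auto :: "('a, 'e) ring_scheme \<Rightarrow> (nat \<Rightarrow> 'a \<Rightarrow> 'a) \<Rightarrow> int \<Rightarrow> 'a \<Rightarrow> 'a" where
  "signed_auto R \<sigma> u = auto_zpow R (\<sigma> (nat \<bar>u\<bar>)) (sgn u)"

section \<open>Twisted generalized Weyl constructions and algebras\<close>

definition tgw_datum ::
  "'k ring \<Rightarrow> ('k, 'r) module \<Rightarrow> nat \<Rightarrow> (nat \<Rightarrow> 'r \<Rightarrow> 'r) \<Rightarrow> (nat \<Rightarrow> 'r) \<Rightarrow> bool" where
  "tgw_datum K R m \<sigma> t \<longleftrightarrow> k_algebra K R \<and>
     (\<forall>i \<in> {1..m}. alg_auto K R (\<sigma> i)) \<and>
     (\<forall>i \<in> {1..m}. \<forall>j \<in> {1..m}. commute_on (carrier R) (\<sigma> i) (\<sigma> j)) \<and>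
     (\<forall>i \<in> {1..m}. t i \<in> center R)"

definition unit_matrix :: "'k ring \<Rightarrow> nat \<Rightarrow> (nat \<Rightarrow> nat \<Rightarrow> 'k) \<Rightarrow> bool" where
  "unit_matrix K m \<mu> \<longleftrightarrow> (\<forall>i \<in> {1..m}. \<forall>j \<in> {1..m}. \<mu> i j \<in> carrier K - {\<zero>\<^bsub>K\<^esub>})"

definition regular_datum :: "('k, 'r) module \<Rightarrow> nat \<Rightarrow> (nat \<Rightarrow> 'r) \<Rightarrow> bool" where
  "regular_datum R m t \<longleftrightarrow> (\<forall>i \<in> {1..m}. regular_elem R (t i))"

text \<open>\<open>Gen i\<close> and \<open>Gen (- i)\<close>, for \<open>i > 0\<close>, stand for the generators \<open>X\<^sub>i\<^sup>+\<close> and \<open>X\<^sub>i\<^sup>-\<close>.\<close>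

datatype 'r tgw_gen = Coef 'r | Gen int

primrec gen_deg :: "'r tgw_gen \<Rightarrow> nat \<Rightarrow> int" where
  "gen_deg (Coef r) = (\<lambda>_. 0)"
| "gen_deg (Gen u) = signed_unit u"

definition word_deg :: "'r tgw_gen list \<Rightarrow> nat \<Rightarrow> int" where
  "word_deg ws = (\<lambda>i. \<Sum>g\<leftarrow>ws. gen_deg g i)"

definition tgw_gens :: "('k, 'r) module \<Rightarrow> nat \<Rightarrow> 'r tgw_gen set" where
  "tgw_gens R m = Coef ` carrier R \<union> Gen ` pm m"

abbreviation tgw_free ::
  "'k ring \<Rightarrow> ('k, 'r) module \<Rightarrow> nat \<Rightarrow> ('k, 'r tgw_gen list \<Rightarrow> 'k) module" where
  "tgw_free K R m \<equiv> free_algebra K (tgw_gens R m)"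

text \<open>The first four families make \<open>r \<mapsto> Coef r\<close> a homomorphism of \<open>k\<close>-algebras.\<close>

definition tgwc_rels ::
  "'k ring \<Rightarrow> ('k, 'r) module \<Rightarrow> nat \<Rightarrow> (nat \<Rightarrow> 'r \<Rightarrow> 'r) \<Rightarrow> (nat \<Rightarrow> 'r) \<Rightarrow> (nat \<Rightarrow> nat \<Rightarrow> 'k) \<Rightarrow>
   ('r tgw_gen list \<Rightarrow> 'k) set" where
  "tgwc_rels K R m \<sigma> t \<mu> =
    (let W = tgw_free K R m; w = single K in
      {w [Coef (r \<oplus>\<^bsub>R\<^esub> r')] \<ominus>\<^bsub>W\<^esub> (w [Coef r] \<oplus>\<^bsub>W\<^esub> w [Coef r']) |r r'.
          r \<in> carrier R \<and> r' \<in> carrier R} \<union>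
      {w [Coef (c \<odot>\<^bsub>R\<^esub> r)] \<ominus>\<^bsub>W\<^esub> (c \<odot>\<^bsub>W\<^esub> w [Coef r]) |c r.
          c \<in> carrier K \<and> r \<in> carrier R} \<union>
      {w [Coef (r \<otimes>\<^bsub>R\<^esub> r')] \<ominus>\<^bsub>W\<^esub> w [Coef r, Coef r'] |r r'.
          r \<in> carrier R \<and> r' \<in> carrier R} \<union>
      {w [Coef \<one>\<^bsub>R\<^esub>] \<ominus>\<^bsub>W\<^esub> \<one>\<^bsub>W\<^esub>} \<union>
      {w [Gen u, Coef r] \<ominus>\<^bsub>W\<^esub> w [Coef (signed_auto R \<sigma> u r), Gen u] |u r.
          u \<in> pm m \<and> r \<in> carrier R} \<union>
      {w [Gen (- int i), Gen (int i)] \<ominus>\<^bsub>W\<^esub> w [Coef (t i)] |i. i \<in> {1..m}} \<union>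
      {w [Gen (int i), Gen (- int i)] \<ominus>\<^bsub>W\<^esub> w [Coef (\<sigma> i (t i))] |i. i \<in> {1..m}} \<union>
      {w [Gen (int i), Gen (- int j)] \<ominus>\<^bsub>W\<^esub> (\<mu> i j \<odot>\<^bsub>W\<^esub> w [Gen (- int j), Gen (int i)]) |i j.
          i \<in> {1..m} \<and> j \<in> {1..m} \<and> i \<noteq> j})"

definition tgwc_null ::
  "'k ring \<Rightarrow> ('k, 'r) module \<Rightarrow> nat \<Rightarrow> (nat \<Rightarrow> 'r \<Rightarrow> 'r) \<Rightarrow> (nat \<Rightarrow> 'r) \<Rightarrow> (nat \<Rightarrow> nat \<Rightarrow> 'k) \<Rightarrow>
   ('r tgw_gen list \<Rightarrow> 'k) set" where
  "tgwc_null K R m \<sigma> t \<mu> = Idl\<^bsub>tgw_free K R m\<^esub> (tgwc_rels K R m \<sigma> t \<mu>)"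

definition tgwc ::
  "'k ring \<Rightarrow> ('k, 'r) module \<Rightarrow> nat \<Rightarrow> (nat \<Rightarrow> 'r \<Rightarrow> 'r) \<Rightarrow> (nat \<Rightarrow> 'r) \<Rightarrow> (nat \<Rightarrow> nat \<Rightarrow> 'k) \<Rightarrow>
   ('k, ('r tgw_gen list \<Rightarrow> 'k) set) module" where
  "tgwc K R m \<sigma> t \<mu> = quot (tgw_free K R m) (tgwc_null K R m \<sigma> t \<mu>)"

definition tgwc_word ::
  "'k ring \<Rightarrow> ('k, 'r) module \<Rightarrow> nat \<Rightarrow> (nat \<Rightarrow> 'r \<Rightarrow> 'r) \<Rightarrow> (nat \<Rightarrow> 'r) \<Rightarrow> (nat \<Rightarrow> nat \<Rightarrow> 'k) \<Rightarrow>
   'r tgw_gen list \<Rightarrow> ('r tgw_gen list \<Rightarrow> 'k) set" where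
  "tgwc_word K R m \<sigma> t \<mu> ws = tgwc_null K R m \<sigma> t \<mu> +>\<^bsub>tgw_free K R m\<^esub> single K ws"

definition tgwc_comp ::
  "'k ring \<Rightarrow> ('k, 'r) module \<Rightarrow> nat \<Rightarrow> (nat \<Rightarrow> 'r \<Rightarrow> 'r) \<Rightarrow> (nat \<Rightarrow> 'r) \<Rightarrow> (nat \<Rightarrow> nat \<Rightarrow> 'k) \<Rightarrow>
   (nat \<Rightarrow> int) \<Rightarrow> ('r tgw_gen list \<Rightarrow> 'k) set set" where
  "tgwc_comp K R m \<sigma> t \<mu> \<alpha> = kspan K (tgwc K R m \<sigma> t \<mu>)
     {tgwc_word K R m \<sigma> t \<mu> ws |ws. ws \<in> lists (tgw_gens R m) \<and> word_deg ws = \<alpha>}"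

definition tgwc_graded_ideal ::
  "'k ring \<Rightarrow> ('k, 'r) module \<Rightarrow> nat \<Rightarrow> (nat \<Rightarrow> 'r \<Rightarrow> 'r) \<Rightarrow> (nat \<Rightarrow> 'r) \<Rightarrow> (nat \<Rightarrow> nat \<Rightarrow> 'k) \<Rightarrow>
   ('r tgw_gen list \<Rightarrow> 'k) set set \<Rightarrow> bool" where
  "tgwc_graded_ideal K R m \<sigma> t \<mu> J \<longleftrightarrow> ideal J (tgwc K R m \<sigma> t \<mu>) \<and>
     J = kspan K (tgwc K R m \<sigma> t \<mu>) (\<Union>\<alpha> \<in> ZZ m. J \<inter> tgwc_comp K R m \<sigma> t \<mu> \<alpha>)"

text \<open>The sum of a family of ideals is the ideal generated by their union.\<close>

definition tgwa_null ::
  "'k ring \<Rightarrow> ('k, 'r) module \<Rightarrow> nat \<Rightarrow> (nat \<Rightarrow> 'r \<Rightarrow> 'r) \<Rightarrow> (nat \<Rightarrow> 'r) \<Rightarrow> (nat \<Rightarrow> nat \<Rightarrow> 'k) \<Rightarrow>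
   ('r tgw_gen list \<Rightarrow> 'k) set set" where
  "tgwa_null K R m \<sigma> t \<mu> = Idl\<^bsub>tgwc K R m \<sigma> t \<mu>\<^esub>
     (\<Union>{J. tgwc_graded_ideal K R m \<sigma> t \<mu> J \<and>
           J \<inter> tgwc_comp K R m \<sigma> t \<mu> (\<lambda>_. 0) = {\<zero>\<^bsub>tgwc K R m \<sigma> t \<mu>\<^esub>}})"

definition tgwa ::
  "'k ring \<Rightarrow> ('k, 'r) module \<Rightarrow> nat \<Rightarrow> (nat \<Rightarrow> 'r \<Rightarrow> 'r) \<Rightarrow> (nat \<Rightarrow> 'r) \<Rightarrow> (nat \<Rightarrow> nat \<Rightarrow> 'k) \<Rightarrow>
   ('k, ('r tgw_gen list \<Rightarrow> 'k) set set) module" where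
  "tgwa K R m \<sigma> t \<mu> = quot (tgwc K R m \<sigma> t \<mu>) (tgwa_null K R m \<sigma> t \<mu>)"

definition tgwa_proj ::
  "'k ring \<Rightarrow> ('k, 'r) module \<Rightarrow> nat \<Rightarrow> (nat \<Rightarrow> 'r \<Rightarrow> 'r) \<Rightarrow> (nat \<Rightarrow> 'r) \<Rightarrow> (nat \<Rightarrow> nat \<Rightarrow> 'k) \<Rightarrow>
   ('r tgw_gen list \<Rightarrow> 'k) set \<Rightarrow> ('r tgw_gen list \<Rightarrow> 'k) set set" where
  "tgwa_proj K R m \<sigma> t \<mu> x = tgwa_null K R m \<sigma> t \<mu> +>\<^bsub>tgwc K R m \<sigma> t \<mu>\<^esub> x"

definition tgwa_comp ::
  "'k ring \<Rightarrow> ('k, 'r) module \<Rightarrow> nat \<Rightarrow> (nat \<Rightarrow> 'r \<Rightarrow> 'r) \<Rightarrow> (nat \<Rightarrow> 'r) \<Rightarrow> (nat \<Rightarrow> nat \<Rightarrow> 'k) \<Rightarrow>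
   (nat \<Rightarrow> int) \<Rightarrow> ('r tgw_gen list \<Rightarrow> 'k) set set set" where
  "tgwa_comp K R m \<sigma> t \<mu> \<alpha> = tgwa_proj K R m \<sigma> t \<mu> ` tgwc_comp K R m \<sigma> t \<mu> \<alpha>"

definition tgwa_coef ::
  "'k ring \<Rightarrow> ('k, 'r) module \<Rightarrow> nat \<Rightarrow> (nat \<Rightarrow> 'r \<Rightarrow> 'r) \<Rightarrow> (nat \<Rightarrow> 'r) \<Rightarrow> (nat \<Rightarrow> nat \<Rightarrow> 'k) \<Rightarrow>
   'r \<Rightarrow> ('r tgw_gen list \<Rightarrow> 'k) set set" where
  "tgwa_coef K R m \<sigma> t \<mu> r = tgwa_proj K R m \<sigma> t \<mu> (tgwc_word K R m \<sigma> t \<mu> [Coef r])"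

definition tgwa_gen ::
  "'k ring \<Rightarrow> ('k, 'r) module \<Rightarrow> nat \<Rightarrow> (nat \<Rightarrow> 'r \<Rightarrow> 'r) \<Rightarrow> (nat \<Rightarrow> 'r) \<Rightarrow> (nat \<Rightarrow> nat \<Rightarrow> 'k) \<Rightarrow>
   int \<Rightarrow> ('r tgw_gen list \<Rightarrow> 'k) set set" where
  "tgwa_gen K R m \<sigma> t \<mu> u = tgwa_proj K R m \<sigma> t \<mu> (tgwc_word K R m \<sigma> t \<mu> [Gen u])"

definition consistent_datum ::
  "'k ring \<Rightarrow> ('k, 'r) module \<Rightarrow> nat \<Rightarrow> (nat \<Rightarrow> 'r \<Rightarrow> 'r) \<Rightarrow> (nat \<Rightarrow> 'r) \<Rightarrow> (nat \<Rightarrow> nat \<Rightarrow> 'k) \<Rightarrow> bool" where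
  "consistent_datum K R m \<sigma> t \<mu> \<longleftrightarrow> inj_on (tgwa_coef K R m \<sigma> t \<mu>) (carrier R)"

text \<open>\<open>C\<close> is (isomorphic to) the TGWA of the given datum, with structure map \<open>\<eta>\<close> from the base
  algebra and canonical generators \<open>Z u\<close>, where \<open>Z i\<close> and \<open>Z (- i)\<close> are \<open>X\<^sub>i\<^sup>+\<close> and \<open>X\<^sub>i\<^sup>-\<close>.\<close>

definition is_tgwa_over ::
  "'k ring \<Rightarrow> ('k, 'r) module \<Rightarrow> nat \<Rightarrow> (nat \<Rightarrow> 'r \<Rightarrow> 'r) \<Rightarrow> (nat \<Rightarrow> 'r) \<Rightarrow> (nat \<Rightarrow> nat \<Rightarrow> 'k) \<Rightarrow>
   ('k, 'c) module \<Rightarrow> ('r \<Rightarrow> 'c) \<Rightarrow> (int \<Rightarrow> 'c) \<Rightarrow> bool" where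
  "is_tgwa_over K R m \<sigma> t \<mu> C \<eta> Z \<longleftrightarrow>
     (\<exists>\<phi> \<in> alg_iso K (tgwa K R m \<sigma> t \<mu>) C.
        (\<forall>r \<in> carrier R. \<phi> (tgwa_coef K R m \<sigma> t \<mu> r) = \<eta> r) \<and>
        (\<forall>u \<in> pm m. \<phi> (tgwa_gen K R m \<sigma> t \<mu> u) = Z u))"

section \<open>Twisted tensor products of TGWAs\<close>

definition graded_twisting_map ::
  "'k ring \<Rightarrow> ('k, 'a) module \<Rightarrow> nat \<Rightarrow> ((nat \<Rightarrow> int) \<Rightarrow> 'a set) \<Rightarrow>
   ('k, 'b) module \<Rightarrow> nat \<Rightarrow> ((nat \<Rightarrow> int) \<Rightarrow> 'b set) \<Rightarrow>
   (('b \<times> 'a \<Rightarrow> 'k) set \<Rightarrow> ('a \<times> 'b \<Rightarrow> 'k) set) \<Rightarrow> bool" where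
  "graded_twisting_map K A m Acomp B n Bcomp \<tau> \<longleftrightarrow> twisting_map K A B \<tau> \<and>
     (\<forall>\<alpha> \<in> ZZ m. \<forall>\<beta> \<in> ZZ n.
        \<tau> ` tensor_sub K B A (Bcomp \<beta>) (Acomp \<alpha>) \<subseteq> tensor_sub K A B (Acomp \<alpha>) (Bcomp \<beta>))"

definition left_part :: "'k ring \<Rightarrow> ('k, 'r) module \<Rightarrow> ('k, 's) module \<Rightarrow> ('r \<times> 's \<Rightarrow> 'k) set set" where
  "left_part K R S = {tens K R S r \<one>\<^bsub>S\<^esub> |r. r \<in> carrier R}"

definition right_part :: "'k ring \<Rightarrow> ('k, 'r) module \<Rightarrow> ('k, 's) module \<Rightarrow> ('r \<times> 's \<Rightarrow> 'k) set set" where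
  "right_part K R S = {tens K R S \<one>\<^bsub>R\<^esub> s |s. s \<in> carrier S}"

definition commuting_extensions ::
  "'k ring \<Rightarrow> ('k, 'r) module \<Rightarrow> nat \<Rightarrow> (nat \<Rightarrow> 'r \<Rightarrow> 'r) \<Rightarrow>
   ('k, 's) module \<Rightarrow> nat \<Rightarrow> (nat \<Rightarrow> 's \<Rightarrow> 's) \<Rightarrow>
   (nat \<Rightarrow> ('r \<times> 's \<Rightarrow> 'k) set \<Rightarrow> ('r \<times> 's \<Rightarrow> 'k) set) \<Rightarrow>
   (nat \<Rightarrow> ('r \<times> 's \<Rightarrow> 'k) set \<Rightarrow> ('r \<times> 's \<Rightarrow> 'k) set) \<Rightarrow> bool" where
  "commuting_extensions K R m \<sigma> S n \<rho> \<sigma>' \<rho>' \<longleftrightarrow>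
    (let T = tensor_alg K R S in
      (\<forall>j \<in> {1..m}. alg_auto K T (\<sigma>' j) \<and>
         (\<forall>r \<in> carrier R. \<sigma>' j (tens K R S r \<one>\<^bsub>S\<^esub>) = tens K R S (\<sigma> j r) \<one>\<^bsub>S\<^esub>)) \<and>
      (\<forall>i \<in> {1..n}. alg_auto K T (\<rho>' i) \<and>
         (\<forall>s \<in> carrier S. \<rho>' i (tens K R S \<one>\<^bsub>R\<^esub> s) = tens K R S \<one>\<^bsub>R\<^esub> (\<rho> i s))) \<and>
      (\<forall>j \<in> {1..m}. \<forall>j' \<in> {1..m}. commute_on (carrier T) (\<sigma>' j) (\<sigma>' j')) \<and>
      (\<forall>i \<in> {1..n}. \<forall>i' \<in> {1..n}. commute_on (carrier T) (\<rho>' i) (\<rho>' i')) \<and>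
      (\<forall>j \<in> {1..m}. \<forall>i \<in> {1..n}. commute_on (carrier T) (\<sigma>' j) (\<rho>' i)))"

text \<open>Invariance of the two tensor factors: \<open>\<rho>'\<^sub>i (R \<otimes> 1) \<subseteq> R \<otimes> 1\<close> and \<open>\<sigma>'\<^sub>j (1 \<otimes> S) \<subseteq> 1 \<otimes> S\<close>.
  Extensions of \<open>\<sigma>\<close>, \<open>\<rho>\<close> to \<open>R \<otimes> S\<close> are not unique, so this is a property of a particular family of
  extensions; the relevant one consists of the automorphisms in the TGW datum of \<open>A \<otimes>\<^sub>\<tau> B\<close>.\<close>

definition factor_preserving ::
  "'k ring \<Rightarrow> ('k, 'r) module \<Rightarrow> nat \<Rightarrow> ('k, 's) module \<Rightarrow> nat \<Rightarrow>
   (nat \<Rightarrow> ('r \<times> 's \<Rightarrow> 'k) set \<Rightarrow> ('r \<times> 's \<Rightarrow> 'k) set) \<Rightarrow>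
   (nat \<Rightarrow> ('r \<times> 's \<Rightarrow> 'k) set \<Rightarrow> ('r \<times> 's \<Rightarrow> 'k) set) \<Rightarrow> bool" where
  "factor_preserving K R m S n \<sigma>' \<rho>' \<longleftrightarrow>
     (\<forall>i \<in> {1..n}. \<rho>' i ` left_part K R S \<subseteq> left_part K R S) \<and>
     (\<forall>j \<in> {1..m}. \<sigma>' j ` right_part K R S \<subseteq> right_part K R S)"

text \<open>The linear map \<open>R \<otimes> S \<rightarrow> A \<otimes> B\<close> sending \<open>r \<otimes> s\<close> to \<open>f r \<otimes> g s\<close>.\<close>

definition tensor_map ::
  "'k ring \<Rightarrow> ('k, 'a) module \<Rightarrow> ('k, 'b) module \<Rightarrow> ('r \<Rightarrow> 'a) \<Rightarrow> ('s \<Rightarrow> 'b) \<Rightarrow>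
   ('r \<times> 's \<Rightarrow> 'k) set \<Rightarrow> ('a \<times> 'b \<Rightarrow> 'k) set" where
  "tensor_map K A B f g = tensor_lift K (tensor_mod K A B) (\<lambda>r s. tens K A B (f r) (g s))"

text \<open>The generators \<open>X\<^sub>j\<^sup>\<plusminus> \<otimes> 1\<close> get the indices \<open>1, \<dots>, m\<close>, and the generators
  \<open>1 \<otimes> Y\<^sub>i\<^sup>\<plusminus>\<close> the indices \<open>m + 1, \<dots>, m + n\<close>.\<close>

definition joint_gens ::
  "'k ring \<Rightarrow> ('k, 'a) module \<Rightarrow> nat \<Rightarrow> (int \<Rightarrow> 'a) \<Rightarrow> ('k, 'b) module \<Rightarrow> (int \<Rightarrow> 'b) \<Rightarrow>
   int \<Rightarrow> ('a \<times> 'b \<Rightarrow> 'k) set" where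
  "joint_gens K A m X\<^sub>A B Y\<^sub>B u =
     (if \<bar>u\<bar> \<le> int m then tens K A B (X\<^sub>A u) \<one>\<^bsub>B\<^esub>
      else tens K A B \<one>\<^bsub>A\<^esub> (Y\<^sub>B (sgn u * (\<bar>u\<bar> - int m))))"

definition q_prod :: "('a, 'e) ring_scheme \<Rightarrow> (int \<Rightarrow> int \<Rightarrow> 'a) \<Rightarrow> int list \<Rightarrow> int list \<Rightarrow> 'a" where
  "q_prod T q vs us = list_prod T (concat (map (\<lambda>v. map (q v) us) vs))"

end

theory Submission
  imports Defs
begin

text \<open>Write \<open>X\<^sub>u\<close> and \<open>Y\<^sub>v\<close> for the generators \<open>X\<^sub>u \<otimes> 1\<close> and \<open>1 \<otimes> Y\<^sub>v\<close> of \<open>C = A \<otimes>\<^sub>\<tau> B\<close>, \<open>\<eta>\<close> for the structure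
  map \<open>R \<otimes> S \<rightarrow> C\<close>, and \<open>\<pi>\<^sub>u\<close> for the automorphism with \<open>X\<^sub>u \<eta>(x) = \<eta>(\<pi>\<^sub>u x) X\<^sub>u\<close>; likewise \<open>\<pi>\<^sub>v\<close>. The
  twisting map is part of the multiplication, \<open>(1 \<otimes> b)(a \<otimes> 1) = \<tau>(b \<otimes> a)\<close>, so the formula for \<open>\<tau>\<close>
  says how \<open>s Y\<^sub>v\<^sub>s\<close> moves past \<open>r X\<^sub>u\<^sub>s\<close> in \<open>C\<close>, for words \<open>us\<close> and \<open>vs\<close>.

  Two facts allow cancellation. The map \<open>\<eta>\<close> is injective, being the tensor product of two injective
  linear maps over a field (\<open>tensor_map_inj\<close>). And \<open>X\<^sub>u X\<^sub>-\<^sub>u = \<eta>(\<ell>\<^sub>u)\<close> with \<open>\<ell>\<^sub>u\<close> regular, so that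
  \<open>\<eta>(x) X\<^sub>u = \<eta>(y) X\<^sub>u\<close> forces \<open>x = y\<close> (\<open>eta_Z_cancel\<close>). Comparing \<open>X\<^sub>j r = \<sigma>\<^sub>j(r) X\<^sub>j\<close> in \<open>A\<close> with
  \<open>X\<^sub>j \<eta>(r \<otimes> 1) = \<eta>(\<pi>\<^sub>j(r \<otimes> 1)) X\<^sub>j\<close> in \<open>C\<close> then shows that \<open>\<pi>\<^sub>j\<close> extends \<open>\<sigma>\<^sub>j\<close>; in the same way \<open>\<pi>\<^sub>m\<^sub>+\<^sub>i\<close> extends
  \<open>\<rho>\<^sub>i\<close>. This gives part (1), with the automorphisms of the datum of \<open>C\<close> as extensions
  (\<open>pi_extensions\<close>).

  The core is that \<open>Y\<^sub>v X\<^sub>u = q X\<^sub>u Y\<^sub>v\<close> for a nonzero scalar \<open>q\<close> (\<open>scalar_exchange\<close>); a scalar is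
  central and fixed by every automorphism. If \<open>u\<close> and \<open>v\<close> have opposite signs, this is one of the
  defining relations of \<open>C\<close>. If the signs agree, use the grading: in a twisted generalized Weyl algebra, the
  component whose degree is a signed unit vector consists of the left multiples of one generator
  (\<open>word_of_unit_degree\<close>), hence \<open>Y\<^sub>v X\<^sub>u = \<eta>(p) X\<^sub>u Y\<^sub>v\<close> for some \<open>p\<close> in \<open>R \<otimes> S\<close>. Multiplying this on
  the right by \<open>X\<^sub>-\<^sub>u Y\<^sub>-\<^sub>v\<close> and by \<open>Y\<^sub>-\<^sub>v X\<^sub>-\<^sub>u\<close>, and commuting generators of opposite signs, yields
  \<open>\<pi>\<^sub>v(\<ell>\<^sub>u) = c p \<ell>\<^sub>u\<close> and \<open>d \<ell>\<^sub>v = p \<pi>\<^sub>u(\<ell>\<^sub>v)\<close> with nonzero scalars \<open>c\<close> and \<open>d\<close> (\<open>exchange\<close>).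
  For positive \<open>u\<close> and \<open>v\<close> all of \<open>\<ell>\<^sub>u, \<pi>\<^sub>v(\<ell>\<^sub>u)\<close> lie in \<open>R \<otimes> 1\<close> and \<open>\<ell>\<^sub>v, \<pi>\<^sub>u(\<ell>\<^sub>v)\<close> in \<open>1 \<otimes> S\<close>,
  because the automorphisms preserve the factors. Regularity then puts \<open>p\<close> into \<open>R \<otimes> 1\<close> and into
  \<open>1 \<otimes> S\<close> (\<open>left_part_divide\<close>, \<open>right_part_divide\<close>), and the intersection of these is \<open>k\<close>. For
  negative \<open>u\<close> and \<open>v\<close> the positive case shows that \<open>\<pi>\<^sub>u\<close> multiplies \<open>\<ell>\<^sub>v\<close> by a scalar, and the second
  equation above determines \<open>p\<close>.

  The formula for words follows by collecting the scalars (\<open>word_exchange\<close>) and moving the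
  coefficients \<open>r\<close> and \<open>s\<close> through the words (\<open>tau_formula\<close>).\<close>

section \<open>Linear maps, quotients and free modules\<close>

lemma (in abelian_group) eq_iff_minus_zero:
  assumes "x \<in> carrier G" "y \<in> carrier G"
  shows "x = y \<longleftrightarrow> x \<ominus> y = \<zero>"
  using assms add.inv_solve_right[of \<zero> x y] by (auto simp: minus_eq)

lemma (in module) smult_solve:
  assumes "field R" "c \<in> carrier R" "c \<noteq> \<zero>" "x \<in> carrier M" "c \<odot>\<^bsub>M\<^esub> x = y"
  shows "x = inv c \<odot>\<^bsub>M\<^esub> y" "inv c \<in> carrier R" "inv c \<noteq> \<zero>"
proof -
  interpret field R by fact
  have U: "c \<in> Units R" using assms field_Units by blast
  then show "inv c \<in> carrier R" "inv c \<noteq> \<zero>" using field_Units Units_inv_Units by blast+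
  show "x = inv c \<odot>\<^bsub>M\<^esub> y" using U assms by (simp add: smult_assoc1[symmetric] assms(5)[symmetric])
qed

lemma lin_mapD:
  assumes "f \<in> lin_map K M N"
  shows "\<And>x. x \<in> carrier M \<Longrightarrow> f x \<in> carrier N"
    and "\<And>x y. x \<in> carrier M \<Longrightarrow> y \<in> carrier M \<Longrightarrow> f (x \<oplus>\<^bsub>M\<^esub> y) = f x \<oplus>\<^bsub>N\<^esub> f y"
    and "\<And>c x. c \<in> carrier K \<Longrightarrow> x \<in> carrier M \<Longrightarrow> f (c \<odot>\<^bsub>M\<^esub> x) = c \<odot>\<^bsub>N\<^esub> f x"
  using assms by (auto simp: lin_map_def)

lemma lin_map_zero:
  assumes "f \<in> lin_map K M N" "module K M" "module K N"
  shows "f \<zero>\<^bsub>M\<^esub> = \<zero>\<^bsub>N\<^esub>"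
proof -
  interpret M: module K M by fact
  interpret N: module K N by fact
  have "f (\<zero>\<^bsub>K\<^esub> \<odot>\<^bsub>M\<^esub> \<zero>\<^bsub>M\<^esub>) = \<zero>\<^bsub>K\<^esub> \<odot>\<^bsub>N\<^esub> f \<zero>\<^bsub>M\<^esub>"
    using lin_mapD[OF assms(1)] by blast
  then show ?thesis using lin_mapD(1)[OF assms(1)] by simp
qed

lemma lin_map_minus:
  assumes "f \<in> lin_map K M N" "module K M" "module K N" "x \<in> carrier M" "y \<in> carrier M"
  shows "f (x \<ominus>\<^bsub>M\<^esub> y) = f x \<ominus>\<^bsub>N\<^esub> f y"
proof -
  interpret M: module K M by fact
  interpret N: module K N by fact
  have "f (x \<ominus>\<^bsub>M\<^esub> y) = f x \<oplus>\<^bsub>N\<^esub> f (\<ominus>\<^bsub>M\<^esub> y)"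
    using assms lin_mapD(2)[OF assms(1)] by (simp add: M.minus_eq)
  also have "\<ominus>\<^bsub>M\<^esub> y = (\<ominus>\<^bsub>K\<^esub> \<one>\<^bsub>K\<^esub>) \<odot>\<^bsub>M\<^esub> y" using assms by (simp add: M.smult_l_minus)
  also have "f \<dots> = \<ominus>\<^bsub>N\<^esub> f y"
    using assms lin_mapD(1,3)[OF assms(1)] by (simp add: N.smult_l_minus)
  finally show ?thesis by (simp add: N.minus_eq)
qed

lemma lin_map_comp:
  assumes "f \<in> lin_map K L M" "g \<in> lin_map K M N"
  shows "(\<lambda>x. g (f x)) \<in> lin_map K L N"
  using assms by (auto simp: lin_map_def Pi_iff)

lemma lin_map_kernel:
  assumes "f \<in> lin_map K M N" "module K M" "module K N"
  shows "submodule {x \<in> carrier M. f x = \<zero>\<^bsub>N\<^esub>} K M"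
proof -
  interpret M: module K M by fact
  interpret N: module K N by fact
  have "f (\<ominus>\<^bsub>M\<^esub> x) = \<zero>\<^bsub>N\<^esub>" if "x \<in> carrier M" "f x = \<zero>\<^bsub>N\<^esub>" for x
    using lin_map_minus[OF assms, of "\<zero>\<^bsub>M\<^esub>" x] lin_map_zero[OF assms] that
    by (simp add: M.minus_eq N.minus_eq)
  then show ?thesis
    using lin_mapD[OF assms(1)] lin_map_zero[OF assms]
    by (intro M.submoduleI) auto
qed

lemma lin_map_preimage:
  assumes "f \<in> lin_map K M N" "module K M" "module K N" "submodule H K N"
  shows "submodule {x \<in> carrier M. f x \<in> H} K M"
proof -
  interpret M: module K M by fact
  interpret N: module K N by fact
  interpret H: submodule H K N by fact
  have zero: "\<zero>\<^bsub>N\<^esub> \<in> H" using H.one_closed by simp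
  have neg: "f (\<ominus>\<^bsub>M\<^esub> x) \<in> H" if "x \<in> carrier M" "f x \<in> H" for x
    using lin_map_minus[OF assms(1-3), of "\<zero>\<^bsub>M\<^esub>" x] lin_map_zero[OF assms(1-3)] that
      N.submoduleE(3)[OF assms(4)] lin_mapD(1)[OF assms(1)]
    by (simp add: M.minus_eq N.minus_eq)
  show ?thesis
    using lin_mapD[OF assms(1)] lin_map_zero[OF assms(1-3)] zero neg N.submoduleE[OF assms(4)]
    by (intro M.submoduleI) auto
qed

lemma lin_map_image:
  assumes "f \<in> lin_map K M N" "module K M" "module K N"
  shows "submodule (f ` carrier M) K N"
proof -
  interpret M: module K M by fact
  interpret N: module K N by fact
  note fD = lin_mapD[OF assms(1)] and f0 = lin_map_zero[OF assms]
  show ?thesis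
  proof (rule N.submoduleI)
    show "f ` carrier M \<subseteq> carrier N" using fD(1) by blast
    show "\<zero>\<^bsub>N\<^esub> \<in> f ` carrier M" by (subst f0[symmetric]) (rule imageI[OF M.zero_closed])
    fix a assume "a \<in> f ` carrier M"
    then obtain x where x: "x \<in> carrier M" "a = f x" by blast
    have "f (\<zero>\<^bsub>M\<^esub> \<ominus>\<^bsub>M\<^esub> x) = \<ominus>\<^bsub>N\<^esub> a"
      using lin_map_minus[OF assms M.zero_closed x(1)] f0 fD(1)[OF x(1)] by (simp add: x(2) N.minus_eq)
    then show "\<ominus>\<^bsub>N\<^esub> a \<in> f ` carrier M" using imageI[OF M.minus_closed[OF M.zero_closed x(1)], of f] by simp
    show "c \<odot>\<^bsub>N\<^esub> a \<in> f ` carrier M" if "c \<in> carrier K" for c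
      using imageI[OF M.smult_closed[OF that x(1)], of f] by (simp only: fD(3)[OF that x(1)] x(2))
    fix b assume "b \<in> f ` carrier M"
    then obtain y where y: "y \<in> carrier M" "b = f y" by blast
    show "a \<oplus>\<^bsub>N\<^esub> b \<in> f ` carrier M"
      using imageI[OF M.add.m_closed[OF x(1) y(1)], of f] by (simp only: fD(2)[OF x(1) y(1)] x(2) y(2))
  qed
qed

lemma submodule_Inter:
  assumes "module K M" "\<And>N. N \<in> \<N> \<Longrightarrow> submodule N K M" "\<N> \<noteq> {}"
  shows "submodule (\<Inter>\<N>) K M"
proof -
  interpret M: module K M by fact
  have zero: "\<zero>\<^bsub>M\<^esub> \<in> N" if "N \<in> \<N>" for N
    using subgroup.one_closed[OF submodule.axioms(1)[OF assms(2)[OF that]]] by simp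
  show ?thesis
  proof (rule M.submoduleI)
    show "\<Inter>\<N> \<subseteq> carrier M" using M.submoduleE(1)[OF assms(2)] assms(3) by auto
  qed (auto intro: zero M.submoduleE(3-5)[OF assms(2)])
qed

lemma kspan_submodule:
  assumes "module K M" "U \<subseteq> carrier M"
  shows "submodule (kspan K M U) K M"
  unfolding kspan_def using assms module.carrier_is_submodule[OF assms(1)]
  by (intro submodule_Inter) auto

lemma kspan_base: "U \<subseteq> kspan K M U"
  by (auto simp: kspan_def)

lemma kspan_least: "submodule N K M \<Longrightarrow> U \<subseteq> N \<Longrightarrow> kspan K M U \<subseteq> N"
  by (auto simp: kspan_def)

text \<open>Axioms that are identities pass to images of surjective homomorphisms. This transports the
  structure to quotients, and also to an algebra that is known only through a bijection from a
  quotient.\<close>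

lemma module_image:
  assumes M: "module K M" and h: "h \<in> lin_map K M N" "h ` carrier M = carrier N" "h \<zero>\<^bsub>M\<^esub> = \<zero>\<^bsub>N\<^esub>"
  shows "module K N"
proof -
  interpret M: module K M by fact
  note hD = lin_mapD[OF h(1)]
  have ex: "\<exists>x. x \<in> carrier M \<and> y = h x" if "y \<in> carrier N" for y using h(2) that by auto
  note hD' = hD(2,3)[symmetric]
  show ?thesis
  proof (rule moduleI)
    show "cring K" ..
    show "abelian_group N"
    proof (rule abelian_groupI)
      fix x assume "x \<in> carrier N"
      then obtain x' where x': "x' \<in> carrier M" "x = h x'" using ex by blast
      have "h (\<ominus>\<^bsub>M\<^esub> x') \<oplus>\<^bsub>N\<^esub> x = \<zero>\<^bsub>N\<^esub>" using x' h(3) by (simp add: hD' M.l_neg)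
      then show "\<exists>y\<in>carrier N. y \<oplus>\<^bsub>N\<^esub> x = \<zero>\<^bsub>N\<^esub>" using x' hD(1) by blast
    qed (auto dest!: ex simp: hD' hD(1) h(3)[symmetric] M.a_ac)
  qed (auto dest!: ex simp: hD' hD(1) M.smult_l_distr M.smult_r_distr M.smult_assoc1)
qed

lemma k_algebraD:
  assumes "k_algebra K A"
  shows "field K" "cring K" "ring A" "module K A"
    and "\<And>c x y. c \<in> carrier K \<Longrightarrow> x \<in> carrier A \<Longrightarrow> y \<in> carrier A \<Longrightarrow>
           (c \<odot>\<^bsub>A\<^esub> x) \<otimes>\<^bsub>A\<^esub> y = c \<odot>\<^bsub>A\<^esub> (x \<otimes>\<^bsub>A\<^esub> y)"
    and "\<And>c x y. c \<in> carrier K \<Longrightarrow> x \<in> carrier A \<Longrightarrow> y \<in> carrier A \<Longrightarrow>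
           x \<otimes>\<^bsub>A\<^esub> (c \<odot>\<^bsub>A\<^esub> y) = c \<odot>\<^bsub>A\<^esub> (x \<otimes>\<^bsub>A\<^esub> y)"
  using assms unfolding k_algebra_def by (auto simp: fieldE)

lemma k_algebra_image:
  assumes A: "k_algebra K A" and h: "h \<in> lin_map K A B" "h \<in> ring_hom A B"
    and surj: "h ` carrier A = carrier B" and zero: "h \<zero>\<^bsub>A\<^esub> = \<zero>\<^bsub>B\<^esub>"
  shows "k_algebra K B"
proof -
  note AD = k_algebraD[OF A]
  interpret A: ring A by (rule AD)
  interpret M: module K A by (rule AD)
  have mB: "module K B" by (rule module_image[OF AD(4) h(1) surj zero])
  interpret B: module K B by (rule mB)
  have ex: "\<exists>x. x \<in> carrier A \<and> y = h x" if "y \<in> carrier B" for y using surj that by auto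
  note hD = lin_mapD[OF h(1)] ring_hom_mult[OF h(2)] ring_hom_one[OF h(2)]
  note hD' = hD(2,3,4)[symmetric] hD(5)[symmetric]
  have "ring B"
  proof (rule ringI)
    show "abelian_group B" ..
    show "Group.monoid B"
      by (rule monoidI) (auto dest!: ex simp: hD' hD(1) A.m_assoc)
  qed (auto dest!: ex simp: hD' hD(1) A.l_distr A.r_distr)
  then show ?thesis
    unfolding k_algebra_def using AD(1) mB
    by (auto dest!: ex simp: hD' hD(1) AD(5,6))
qed

text \<open>A ring ideal absorbs scalars because \<open>c x = (c 1) x\<close>.\<close>

lemma k_algebra_ideal_submodule:
  assumes "k_algebra K A" "ideal I A"
  shows "submodule I K A"
proof -
  note AD = k_algebraD[OF assms(1)]
  interpret ideal I A by fact
  interpret M: module K A by (rule AD)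
  have "c \<odot>\<^bsub>A\<^esub> x \<in> I" if "c \<in> carrier K" "x \<in> I" for c x
  proof -
    have "(c \<odot>\<^bsub>A\<^esub> \<one>\<^bsub>A\<^esub>) \<otimes>\<^bsub>A\<^esub> x = c \<odot>\<^bsub>A\<^esub> x"
      using that AD(5)[of c "\<one>\<^bsub>A\<^esub>" x] by simp
    then show ?thesis using I_l_closed[of x "c \<odot>\<^bsub>A\<^esub> \<one>\<^bsub>A\<^esub>"] that by simp
  qed
  then show ?thesis by (intro M.submoduleI) (auto simp: a_subset)
qed

lemma quot_simps:
  "carrier (quot M N) = a_rcosets\<^bsub>M\<^esub> N" "\<zero>\<^bsub>quot M N\<^esub> = N" "\<one>\<^bsub>quot M N\<^esub> = N +>\<^bsub>M\<^esub> \<one>\<^bsub>M\<^esub>"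
  "ring.add (quot M N) = set_add M" "monoid.mult (quot M N) = rcoset_mult M N"
  "smult (quot M N) = (\<lambda>c U. \<Union>u\<in>U. N +>\<^bsub>M\<^esub> (c \<odot>\<^bsub>M\<^esub> u))"
  by (simp_all add: quot_def)

lemma quot_carrier: "carrier (quot M N) = (\<lambda>x. N +>\<^bsub>M\<^esub> x) ` carrier M"
  by (auto simp: quot_simps A_RCOSETS_def')

lemma
  assumes M: "module K M" and N: "submodule N K M"
  shows quot_proj_linear: "(\<lambda>x. N +>\<^bsub>M\<^esub> x) \<in> lin_map K M (quot M N)"
    and quot_module: "module K (quot M N)"
    and quot_eq_iff: "\<And>x y. x \<in> carrier M \<Longrightarrow> y \<in> carrier M \<Longrightarrow>
           N +>\<^bsub>M\<^esub> x = N +>\<^bsub>M\<^esub> y \<longleftrightarrow> x \<ominus>\<^bsub>M\<^esub> y \<in> N"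
    and quot_rep: "\<And>x y. x \<in> carrier M \<Longrightarrow> y \<in> N +>\<^bsub>M\<^esub> x \<Longrightarrow> y \<in> carrier M \<and> N +>\<^bsub>M\<^esub> y = N +>\<^bsub>M\<^esub> x"
    and quot_self: "\<And>x. x \<in> carrier M \<Longrightarrow> x \<in> N +>\<^bsub>M\<^esub> x"
proof -
  interpret M: module K M by fact
  interpret N: submodule N K M by fact
  interpret S: abelian_subgroup N M
    by (intro abelian_subgroupI3 additive_subgroupI) (rule N.subgroup_axioms, rule M.abelian_group_axioms)
  show eq: "N +>\<^bsub>M\<^esub> x = N +>\<^bsub>M\<^esub> y \<longleftrightarrow> x \<ominus>\<^bsub>M\<^esub> y \<in> N"
    if "x \<in> carrier M" "y \<in> carrier M" for x y
    using that S.a_rcos_module[of y x] S.a_repr_independence' S.a_rcos_self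
    by (metis M.minus_eq)
  show rep: "y \<in> carrier M \<and> N +>\<^bsub>M\<^esub> y = N +>\<^bsub>M\<^esub> x" if "x \<in> carrier M" "y \<in> N +>\<^bsub>M\<^esub> x" for x y
    using that S.a_elemrcos_carrier S.a_repr_independence' by metis
  show self: "x \<in> N +>\<^bsub>M\<^esub> x" if "x \<in> carrier M" for x
    using S.a_rcos_self that by simp
  \<comment> \<open>The definition takes a union over the coset, but all of its members give the same coset.\<close>
  have smult: "N +>\<^bsub>M\<^esub> (c \<odot>\<^bsub>M\<^esub> x) = c \<odot>\<^bsub>quot M N\<^esub> (N +>\<^bsub>M\<^esub> x)"
    if "c \<in> carrier K" "x \<in> carrier M" for c x
  proof -
    have *: "N +>\<^bsub>M\<^esub> (c \<odot>\<^bsub>M\<^esub> y) = N +>\<^bsub>M\<^esub> (c \<odot>\<^bsub>M\<^esub> x)" if y: "y \<in> N +>\<^bsub>M\<^esub> x" for y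
    proof -
      have yM: "y \<in> carrier M" "y \<ominus>\<^bsub>M\<^esub> x \<in> N"
        using rep[OF \<open>x \<in> carrier M\<close> y] eq \<open>x \<in> carrier M\<close> by auto
      have "c \<odot>\<^bsub>M\<^esub> y \<ominus>\<^bsub>M\<^esub> c \<odot>\<^bsub>M\<^esub> x = c \<odot>\<^bsub>M\<^esub> (y \<ominus>\<^bsub>M\<^esub> x)"
        using yM that \<open>c \<in> carrier K\<close> \<open>x \<in> carrier M\<close> by (simp add: M.minus_eq M.smult_r_distr M.smult_r_minus)
      then show ?thesis using eq yM \<open>c \<in> carrier K\<close> \<open>x \<in> carrier M\<close> by simp
    qed
    have "(\<Union>u\<in>N +>\<^bsub>M\<^esub> x. N +>\<^bsub>M\<^esub> (c \<odot>\<^bsub>M\<^esub> u)) = (\<Union>u\<in>N +>\<^bsub>M\<^esub> x. N +>\<^bsub>M\<^esub> (c \<odot>\<^bsub>M\<^esub> x))"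
      by (rule SUP_cong[OF refl]) (rule *)
    also have "\<dots> = N +>\<^bsub>M\<^esub> (c \<odot>\<^bsub>M\<^esub> x)" using self[OF that(2)] by blast
    finally show ?thesis by (simp only: quot_simps(6))
  qed
  show lin: "(\<lambda>x. N +>\<^bsub>M\<^esub> x) \<in> lin_map K M (quot M N)"
    using smult by (auto simp: lin_map_def quot_carrier quot_simps(4) S.a_rcos_sum)
  show "module K (quot M N)"
    by (rule module_image[OF M lin])
      (auto simp: quot_carrier quot_simps(2) M.a_coset_add_zero[OF S.a_subset])
qed

lemma
  assumes A: "k_algebra K A" and I: "ideal I A"
  shows quot_proj_hom: "(\<lambda>x. I +>\<^bsub>A\<^esub> x) \<in> ring_hom A (quot A I)"
    and quot_algebra: "k_algebra K (quot A I)"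
proof -
  note AD = k_algebraD[OF A]
  interpret ideal I A by fact
  note sub = k_algebra_ideal_submodule[OF A I]
  show hom: "(\<lambda>x. I +>\<^bsub>A\<^esub> x) \<in> ring_hom A (quot A I)"
    by (rule ring_hom_memI) (auto simp: quot_carrier quot_simps(3-5) rcoset_mult_add a_rcos_sum)
  show "k_algebra K (quot A I)"
    by (rule k_algebra_image[OF A quot_proj_linear[OF AD(4) sub] hom])
      (auto simp: quot_carrier quot_simps(2) a_coset_add_zero[OF a_subset])
qed

subsection \<open>Free modules\<close>

definition supp :: "'k ring \<Rightarrow> ('x \<Rightarrow> 'k) \<Rightarrow> 'x set" where
  "supp K p = {x. p x \<noteq> \<zero>\<^bsub>K\<^esub>}"

lemma free_module_simps:
  "carrier (free_module K U) = {p. (\<forall>x. p x \<in> carrier K) \<and> supp K p \<subseteq> U \<and> finite (supp K p)}"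
  "\<zero>\<^bsub>free_module K U\<^esub> = (\<lambda>_. \<zero>\<^bsub>K\<^esub>)"
  "ring.add (free_module K U) = (\<lambda>p q x. p x \<oplus>\<^bsub>K\<^esub> q x)"
  "smult (free_module K U) = (\<lambda>c p x. c \<otimes>\<^bsub>K\<^esub> p x)"
  by (auto simp: free_module_def supp_def)

lemma
  assumes "cring K"
  shows supp_add: "supp K (\<lambda>x. p x \<oplus>\<^bsub>K\<^esub> q x) \<subseteq> supp K p \<union> supp K q"
    and supp_smult: "c \<in> carrier K \<Longrightarrow> supp K (\<lambda>x. c \<otimes>\<^bsub>K\<^esub> p x) \<subseteq> supp K p"
proof -
  interpret cring K by fact
  show "supp K (\<lambda>x. p x \<oplus>\<^bsub>K\<^esub> q x) \<subseteq> supp K p \<union> supp K q"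
    "c \<in> carrier K \<Longrightarrow> supp K (\<lambda>x. c \<otimes>\<^bsub>K\<^esub> p x) \<subseteq> supp K p"
    by (auto simp: supp_def)
qed

lemma free_module_module:
  assumes "cring K"
  shows "module K (free_module K U)"
proof -
  interpret cring K by fact
  note add = supp_add[OF assms] and sm = supp_smult[OF assms]
  show ?thesis
  proof (rule moduleI)
    show "abelian_group (free_module K U)"
    proof (rule abelian_groupI)
      fix p assume p: "p \<in> carrier (free_module K U)"
      have "supp K (\<lambda>x. \<ominus>\<^bsub>K\<^esub> p x) \<subseteq> supp K p"
        by (auto simp: supp_def)
      then have "(\<lambda>x. \<ominus>\<^bsub>K\<^esub> p x) \<in> carrier (free_module K U)"
        using p finite_subset unfolding free_module_simps by blast
      then show "\<exists>q\<in>carrier (free_module K U). q \<oplus>\<^bsub>free_module K U\<^esub> p = \<zero>\<^bsub>free_module K U\<^esub>"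
        using p by (intro bexI[of _ "\<lambda>x. \<ominus>\<^bsub>K\<^esub> p x"]) (auto simp: free_module_simps l_neg)
    next
      fix p q assume "p \<in> carrier (free_module K U)" "q \<in> carrier (free_module K U)"
      then show "p \<oplus>\<^bsub>free_module K U\<^esub> q \<in> carrier (free_module K U)"
        using add[of p q] by (auto simp: free_module_simps intro: finite_subset[OF add])
    qed (auto simp: free_module_simps supp_def a_ac)
  next
    fix c p assume "c \<in> carrier K" "p \<in> carrier (free_module K U)"
    then show "c \<odot>\<^bsub>free_module K U\<^esub> p \<in> carrier (free_module K U)"
      using sm[of c p] by (auto simp: free_module_simps intro: finite_subset[OF sm])
  qed (auto simp: free_module_simps l_distr r_distr m_assoc assms)
qed

lemma single_closed:
  "cring K \<Longrightarrow> x \<in> U \<Longrightarrow> single K x \<in> carrier (free_module K U)"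
  by (auto simp: free_module_simps supp_def single_def cring.cring_simprules)

lemma single_mult_simps:
  assumes "cring K" "c \<in> carrier K"
  shows "c \<odot>\<^bsub>free_module K U\<^esub> single K x = (\<lambda>y. if y = x then c else \<zero>\<^bsub>K\<^esub>)"
proof -
  interpret cring K by fact
  show ?thesis using assms(2) by (auto simp: free_module_simps single_def)
qed

lemma free_module_induct [consumes 2, case_names zero add single]:
  assumes "cring K" "p \<in> carrier (free_module K U)"
    and P_zero: "P \<zero>\<^bsub>free_module K U\<^esub>"
    and P_add: "\<And>p q. p \<in> carrier (free_module K U) \<Longrightarrow> q \<in> carrier (free_module K U) \<Longrightarrow>
                 P p \<Longrightarrow> P q \<Longrightarrow> P (p \<oplus>\<^bsub>free_module K U\<^esub> q)"
    and P_single: "\<And>c x. c \<in> carrier K \<Longrightarrow> x \<in> U \<Longrightarrow> P (c \<odot>\<^bsub>free_module K U\<^esub> single K x)"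
  shows "P p"
proof -
  interpret cring K by fact
  have "finite F \<Longrightarrow> F \<subseteq> U \<Longrightarrow> (\<And>p. p \<in> carrier (free_module K U) \<Longrightarrow> supp K p \<subseteq> F \<Longrightarrow> P p)" for F
  proof (induction F rule: finite_induct)
    case empty
    then have "p = \<zero>\<^bsub>free_module K U\<^esub>" by (auto simp: free_module_simps supp_def)
    then show ?case using P_zero by simp
  next
    case (insert x F)
    define q where "q = (\<lambda>y. if y = x then \<zero>\<^bsub>K\<^esub> else p y)"
    have "supp K q \<subseteq> supp K p - {x}" by (auto simp: q_def supp_def)
    then have q: "q \<in> carrier (free_module K U)" "supp K q \<subseteq> F"
      using insert.prems by (auto simp: free_module_simps q_def intro: finite_subset[of _ "supp K p"])
    have px: "p x \<in> carrier K" using insert.prems by (auto simp: free_module_simps)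
    have x: "x \<in> U" using insert.prems by auto
    interpret F: module K "free_module K U" by (rule free_module_module[OF assms(1)])
    have "p = q \<oplus>\<^bsub>free_module K U\<^esub> (p x \<odot>\<^bsub>free_module K U\<^esub> single K x)"
      using insert.prems px unfolding single_mult_simps[OF assms(1) px]
      by (auto simp: free_module_simps q_def)
    moreover have "P (q \<oplus>\<^bsub>free_module K U\<^esub> (p x \<odot>\<^bsub>free_module K U\<^esub> single K x))"
      using insert.prems(1) insert.IH[OF _ q] q px x single_closed[OF assms(1) x]
      by (intro P_add P_single F.smult_closed) auto
    ultimately show ?case by simp
  qed
  then show ?thesis using assms(2) by (auto simp: free_module_simps)
qed

text \<open>The universal property of the free module: \<open>free_lift\<close> is the linear extension of a map defined on
  the basis.\<close>

definition free_lift :: "'k ring \<Rightarrow> ('k, 'm) module \<Rightarrow> ('x \<Rightarrow> 'm) \<Rightarrow> ('x \<Rightarrow> 'k) \<Rightarrow> 'm" where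
  "free_lift K M f p = (\<Oplus>\<^bsub>M\<^esub>x\<in>supp K p. p x \<odot>\<^bsub>M\<^esub> f x)"

lemma
  assumes M: "module K M" and f: "\<And>x. x \<in> U \<Longrightarrow> f x \<in> carrier M"
  shows free_lift_linear: "free_lift K M f \<in> lin_map K (free_module K U) M"
    and free_lift_single: "\<And>x. x \<in> U \<Longrightarrow> free_lift K M f (single K x) = f x"
proof -
  interpret M: module K M by fact
  have K: "cring K" ..
  \<comment> \<open>Enlarging the index set by zero terms lets sums over different supports be compared.\<close>
  have ext: "free_lift K M f p = (\<Oplus>\<^bsub>M\<^esub>x\<in>F. p x \<odot>\<^bsub>M\<^esub> f x)"
    if "p \<in> carrier (free_module K U)" "finite F" "supp K p \<subseteq> F" "F \<subseteq> U" for p F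
    unfolding free_lift_def using that
    by (intro M.add.finprod_mono_neutral_cong_left) (auto simp: supp_def f free_module_simps)
  show "free_lift K M f \<in> lin_map K (free_module K U) M"
    unfolding lin_map_def
  proof (intro CollectI conjI ballI Pi_I)
    fix p assume p: "p \<in> carrier (free_module K U)"
    show "free_lift K M f p \<in> carrier M"
      unfolding free_lift_def using p f by (intro M.finsum_closed) (auto simp: free_module_simps)
    fix c assume c: "c \<in> carrier K"
    have "free_lift K M f (c \<odot>\<^bsub>free_module K U\<^esub> p) = (\<Oplus>\<^bsub>M\<^esub>x\<in>supp K p. c \<odot>\<^bsub>M\<^esub> (p x \<odot>\<^bsub>M\<^esub> f x))"
      using p c supp_smult[OF K c, of p] f
        module.smult_closed[OF free_module_module[OF K] c p]
      by (subst ext[of _ "supp K p"])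
        (auto simp: free_module_simps M.smult_assoc1 intro!: M.finsum_cong')
    also have "\<dots> = c \<odot>\<^bsub>M\<^esub> free_lift K M f p"
      unfolding free_lift_def using p c f
      by (intro M.finsum_smult_ldistr[symmetric]) (auto simp: free_module_simps)
    finally show "free_lift K M f (c \<odot>\<^bsub>free_module K U\<^esub> p) = c \<odot>\<^bsub>M\<^esub> free_lift K M f p" .
  next
    fix p q assume pq: "p \<in> carrier (free_module K U)" "q \<in> carrier (free_module K U)"
    define F where "F = supp K p \<union> supp K q"
    have F: "finite F" "F \<subseteq> U" using pq by (auto simp: F_def free_module_simps)
    have pqc: "p \<oplus>\<^bsub>free_module K U\<^esub> q \<in> carrier (free_module K U)"
      using pq abelian_groupE(1)[OF module.axioms(2)[OF free_module_module[OF K]]] by blast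
    have mem: "x \<in> F \<Longrightarrow> p x \<in> carrier K \<and> q x \<in> carrier K \<and> f x \<in> carrier M" for x
      using pq F f by (auto simp: free_module_simps)
    have "supp K (p \<oplus>\<^bsub>free_module K U\<^esub> q) \<subseteq> F"
      using supp_add[OF K, of p q] by (simp add: free_module_simps F_def)
    then have "free_lift K M f (p \<oplus>\<^bsub>free_module K U\<^esub> q)
        = (\<Oplus>\<^bsub>M\<^esub>x\<in>F. (p \<oplus>\<^bsub>free_module K U\<^esub> q) x \<odot>\<^bsub>M\<^esub> f x)"
      by (intro ext pqc F)
    also have "\<dots> = (\<Oplus>\<^bsub>M\<^esub>x\<in>F. p x \<odot>\<^bsub>M\<^esub> f x \<oplus>\<^bsub>M\<^esub> q x \<odot>\<^bsub>M\<^esub> f x)"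
      using mem by (intro M.finsum_cong') (auto simp: free_module_simps(3) M.smult_l_distr)
    also have "\<dots> = (\<Oplus>\<^bsub>M\<^esub>x\<in>F. p x \<odot>\<^bsub>M\<^esub> f x) \<oplus>\<^bsub>M\<^esub> (\<Oplus>\<^bsub>M\<^esub>x\<in>F. q x \<odot>\<^bsub>M\<^esub> f x)"
      using mem by (intro M.finsum_addf) auto
    also have "\<dots> = free_lift K M f p \<oplus>\<^bsub>M\<^esub> free_lift K M f q"
      using ext[OF pq(1) F(1) _ F(2)] ext[OF pq(2) F(1) _ F(2)] by (simp add: F_def)
    finally show "free_lift K M f (p \<oplus>\<^bsub>free_module K U\<^esub> q) = free_lift K M f p \<oplus>\<^bsub>M\<^esub> free_lift K M f q" .
  qed
  fix x assume x: "x \<in> U"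
  show "free_lift K M f (single K x) = f x"
    using x f single_closed[OF K x]
    by (subst ext[of _ "{x}"]) (auto simp: single_def supp_def)
qed

subsection \<open>The free algebra\<close>

text \<open>Associativity of convolution rearranges a sum over two cutting points \<open>j \<le> i\<close> of a word, where the
  second one is counted either from the start of the word or from \<open>j\<close>.\<close>

lemma (in abelian_monoid) finsum_triangle_swap:
  fixes g :: "nat \<Rightarrow> nat \<Rightarrow> 'a"
  assumes "\<And>i j. g i j \<in> carrier G"
  shows "(\<Oplus>i\<in>{..n}. \<Oplus>j\<in>{..i}. g j i) = (\<Oplus>j\<in>{..n}. \<Oplus>i\<in>{..n - j}. g j (i + j))"
proof (induction n)
  case (Suc n)
  have "(\<Oplus>j\<in>{..n}. \<Oplus>i\<in>{..Suc n - j}. g j (i + j))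
      = (\<Oplus>j\<in>{..n}. g j (Suc n) \<oplus> (\<Oplus>i\<in>{..n - j}. g j (i + j)))"
    using assms by (intro finsum_cong') (auto simp: Suc_diff_le)
  also have "\<dots> = (\<Oplus>j\<in>{..n}. g j (Suc n)) \<oplus> (\<Oplus>j\<in>{..n}. \<Oplus>i\<in>{..n - j}. g j (i + j))"
    using assms by (intro finsum_addf) auto
  finally show ?case
    using assms Suc by (simp add: a_ac)
qed (simp add: assms)

lemma free_algebra_simps:
  "carrier (free_algebra K G) = carrier (free_module K (lists G))"
  "\<zero>\<^bsub>free_algebra K G\<^esub> = \<zero>\<^bsub>free_module K (lists G)\<^esub>"
  "\<one>\<^bsub>free_algebra K G\<^esub> = single K []"
  "ring.add (free_algebra K G) = ring.add (free_module K (lists G))"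
  "smult (free_algebra K G) = smult (free_module K (lists G))"
  "monoid.mult (free_algebra K G) =
     (\<lambda>p q ws. \<Oplus>\<^bsub>K\<^esub>i\<in>{..length ws}. p (take i ws) \<otimes>\<^bsub>K\<^esub> q (drop i ws))"
  by (simp_all add: free_algebra_def)

lemma free_algebra_algebra:
  assumes K: "field K"
  shows "k_algebra K (free_algebra K G)"
proof -
  let ?W = "free_algebra K G"
  interpret field K by fact
  have cK: "cring K" ..
  have mW: "module K ?W"
    by (rule module_image[OF free_module_module[OF cK, of "lists G"], of id])
      (auto simp: lin_map_def free_algebra_simps)
  interpret M: module K ?W by (rule mW)
  have cl: "\<And>p x. p \<in> carrier ?W \<Longrightarrow> p x \<in> carrier K" by (auto simp: free_algebra_simps free_module_simps)
  note mul = free_algebra_simps(6)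
  have closed: "p \<otimes>\<^bsub>?W\<^esub> q \<in> carrier ?W" if pq: "p \<in> carrier ?W" "q \<in> carrier ?W" for p q
  proof -
    have "supp K (p \<otimes>\<^bsub>?W\<^esub> q) \<subseteq> (\<lambda>(u, v). u @ v) ` (supp K p \<times> supp K q)"
    proof
      fix ws assume "ws \<in> supp K (p \<otimes>\<^bsub>?W\<^esub> q)"
      then have "(\<Oplus>\<^bsub>K\<^esub>i\<in>{..length ws}. p (take i ws) \<otimes>\<^bsub>K\<^esub> q (drop i ws)) \<noteq> \<zero>\<^bsub>K\<^esub>"
        by (auto simp: supp_def mul)
      then obtain i where "p (take i ws) \<otimes>\<^bsub>K\<^esub> q (drop i ws) \<noteq> \<zero>\<^bsub>K\<^esub>"
        using add.finprod_one_eqI by meson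
      then have "take i ws \<in> supp K p" "drop i ws \<in> supp K q"
        using cl pq by (auto simp: supp_def)
      then show "ws \<in> (\<lambda>(u, v). u @ v) ` (supp K p \<times> supp K q)"
        by (auto intro!: image_eqI[of _ _ "(take i ws, drop i ws)"])
    qed
    moreover have "finite ((\<lambda>(u, v). u @ v) ` (supp K p \<times> supp K q))"
      "(\<lambda>(u, v). u @ v) ` (supp K p \<times> supp K q) \<subseteq> lists G"
      using pq by (auto simp: free_algebra_simps free_module_simps) blast+
    moreover have "(p \<otimes>\<^bsub>?W\<^esub> q) ws \<in> carrier K" for ws
      unfolding mul using cl pq by (intro finsum_closed) auto
    ultimately show ?thesis
      unfolding free_algebra_simps(1) free_module_simps(1) using finite_subset by blast
  qed
  have one: "\<one>\<^bsub>?W\<^esub> \<in> carrier ?W"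
    by (auto simp: free_algebra_simps intro!: single_closed[OF cK])
  have "ring ?W"
  proof (rule ringI)
    show "abelian_group ?W" ..
    show "Group.monoid ?W"
    proof (rule monoidI)
      fix p q r assume pqr: "p \<in> carrier ?W" "q \<in> carrier ?W" "r \<in> carrier ?W"
      note c = cl[OF pqr(1)] cl[OF pqr(2)] cl[OF pqr(3)]
      show "p \<otimes>\<^bsub>?W\<^esub> q \<otimes>\<^bsub>?W\<^esub> r = p \<otimes>\<^bsub>?W\<^esub> (q \<otimes>\<^bsub>?W\<^esub> r)"
      proof
        fix ws
        let ?g = "\<lambda>j i. p (take j ws) \<otimes>\<^bsub>K\<^esub> (q (drop j (take i ws)) \<otimes>\<^bsub>K\<^esub> r (drop i ws))"
        have "(p \<otimes>\<^bsub>?W\<^esub> q \<otimes>\<^bsub>?W\<^esub> r) ws = (\<Oplus>\<^bsub>K\<^esub>i\<in>{..length ws}. \<Oplus>\<^bsub>K\<^esub>j\<in>{..i}. ?g j i)"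
          unfolding mul using c
          by (intro finsum_cong')
            (auto simp: finsum_ldistr m_assoc min_def intro!: finsum_cong')
        also have "\<dots> = (\<Oplus>\<^bsub>K\<^esub>j\<in>{..length ws}. \<Oplus>\<^bsub>K\<^esub>i\<in>{..length ws - j}. ?g j (i + j))"
          using c by (intro finsum_triangle_swap) auto
        also have "\<dots> = (p \<otimes>\<^bsub>?W\<^esub> (q \<otimes>\<^bsub>?W\<^esub> r)) ws"
          unfolding mul using c
          by (intro finsum_cong')
            (auto simp: finsum_rdistr drop_take intro!: finsum_cong')
        finally show "(p \<otimes>\<^bsub>?W\<^esub> q \<otimes>\<^bsub>?W\<^esub> r) ws = (p \<otimes>\<^bsub>?W\<^esub> (q \<otimes>\<^bsub>?W\<^esub> r)) ws" .
      qed
    next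
      fix p assume p: "p \<in> carrier ?W"
      note c = cl[OF p]
      show "\<one>\<^bsub>?W\<^esub> \<otimes>\<^bsub>?W\<^esub> p = p"
      proof
        fix ws
        have "(\<one>\<^bsub>?W\<^esub> \<otimes>\<^bsub>?W\<^esub> p) ws = (\<Oplus>\<^bsub>K\<^esub>i\<in>{..length ws}. if 0 = i then p (drop i ws) else \<zero>\<^bsub>K\<^esub>)"
          unfolding mul free_algebra_simps(3) using c by (intro finsum_cong') (auto simp: single_def)
        then show "(\<one>\<^bsub>?W\<^esub> \<otimes>\<^bsub>?W\<^esub> p) ws = p ws"
          using c finsum_singleton[of 0 "{..length ws}" "\<lambda>i. p (drop i ws)"] by auto
      qed
      show "p \<otimes>\<^bsub>?W\<^esub> \<one>\<^bsub>?W\<^esub> = p"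
      proof
        fix ws
        have "(p \<otimes>\<^bsub>?W\<^esub> \<one>\<^bsub>?W\<^esub>) ws
            = (\<Oplus>\<^bsub>K\<^esub>i\<in>{..length ws}. if length ws = i then p (take i ws) else \<zero>\<^bsub>K\<^esub>)"
          unfolding mul free_algebra_simps(3) using c by (intro finsum_cong') (auto simp: single_def)
        then show "(p \<otimes>\<^bsub>?W\<^esub> \<one>\<^bsub>?W\<^esub>) ws = p ws"
          using c finsum_singleton[of "length ws" "{..length ws}" "\<lambda>i. p (take i ws)"] by auto
      qed
    qed (use closed one in auto)
  next
    fix p q r assume pqr: "p \<in> carrier ?W" "q \<in> carrier ?W" "r \<in> carrier ?W"
    note c = cl[OF pqr(1)] cl[OF pqr(2)] cl[OF pqr(3)]
    note add = free_algebra_simps(4) free_module_simps(3)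
    show "(p \<oplus>\<^bsub>?W\<^esub> q) \<otimes>\<^bsub>?W\<^esub> r = p \<otimes>\<^bsub>?W\<^esub> r \<oplus>\<^bsub>?W\<^esub> q \<otimes>\<^bsub>?W\<^esub> r"
      unfolding mul add using c
      by (intro ext, subst finsum_addf[symmetric]) (auto simp: l_distr intro!: finsum_cong')
    show "r \<otimes>\<^bsub>?W\<^esub> (p \<oplus>\<^bsub>?W\<^esub> q) = r \<otimes>\<^bsub>?W\<^esub> p \<oplus>\<^bsub>?W\<^esub> r \<otimes>\<^bsub>?W\<^esub> q"
      unfolding mul add using c
      by (intro ext, subst finsum_addf[symmetric]) (auto simp: r_distr intro!: finsum_cong')
  qed
  moreover have "(c \<odot>\<^bsub>?W\<^esub> p) \<otimes>\<^bsub>?W\<^esub> q = c \<odot>\<^bsub>?W\<^esub> (p \<otimes>\<^bsub>?W\<^esub> q)" "p \<otimes>\<^bsub>?W\<^esub> (c \<odot>\<^bsub>?W\<^esub> q) = c \<odot>\<^bsub>?W\<^esub> (p \<otimes>\<^bsub>?W\<^esub> q)"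
    if "c \<in> carrier K" "p \<in> carrier ?W" "q \<in> carrier ?W" for c p q
    unfolding mul free_algebra_simps(5) free_module_simps(4)
    using that(1) cl[OF that(2)] cl[OF that(3)]
    by (intro ext, subst finsum_rdistr; auto simp: m_ac intro!: finsum_cong')+
  ultimately show ?thesis
    unfolding k_algebra_def using K mW by auto
qed

lemma single_append:
  assumes "field K"
  shows "single K us \<otimes>\<^bsub>free_algebra K G\<^esub> single K vs = single K (us @ vs)"
proof
  interpret field K by fact
  fix ws
  have "(single K us \<otimes>\<^bsub>free_algebra K G\<^esub> single K vs) ws
      = (\<Oplus>\<^bsub>K\<^esub>i\<in>{..length ws}. if length us = i then single K (us @ vs) ws else \<zero>\<^bsub>K\<^esub>)"
    unfolding free_algebra_simps
  proof (intro finsum_cong')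
    fix i assume "i \<in> {..length ws}"
    then have "take i ws = us \<and> drop i ws = vs \<longleftrightarrow> length us = i \<and> ws = us @ vs"
      by auto
    then show "single K us (take i ws) \<otimes>\<^bsub>K\<^esub> single K vs (drop i ws) =
      (if length us = i then single K (us @ vs) ws else \<zero>\<^bsub>K\<^esub>)"
      by (auto simp: single_def)
  qed (auto simp: single_def)
  also have "\<dots> = single K (us @ vs) ws"
  proof (cases "length us \<le> length ws")
    case True
    then show ?thesis
      using finsum_singleton[of "length us" "{..length ws}" "\<lambda>i. single K (us @ vs) ws"]
      by (auto simp: single_def)
  next
    case False
    then have "(\<Oplus>\<^bsub>K\<^esub>i\<in>{..length ws}. if length us = i then single K (us @ vs) ws else \<zero>\<^bsub>K\<^esub>)
      = (\<Oplus>\<^bsub>K\<^esub>i\<in>{..length ws}. \<zero>\<^bsub>K\<^esub>)" by (intro finsum_cong') auto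
    then show ?thesis using False by (auto simp: single_def)
  qed
  finally show "(single K us \<otimes>\<^bsub>free_algebra K G\<^esub> single K vs) ws = single K (us @ vs) ws" .
qed

section \<open>Tensor products over a field\<close>

definition bilin :: "'k ring \<Rightarrow> ('k, 'a) module \<Rightarrow> ('k, 'b) module \<Rightarrow> ('k, 'm) module \<Rightarrow> ('a \<Rightarrow> 'b \<Rightarrow> 'm) \<Rightarrow> bool" where
  "bilin K A B M f \<longleftrightarrow> (\<forall>a \<in> carrier A. f a \<in> lin_map K B M) \<and> (\<forall>b \<in> carrier B. (\<lambda>a. f a b) \<in> lin_map K A M)"

lemma bilinD:
  assumes "bilin K A B M f"
  shows "\<And>a. a \<in> carrier A \<Longrightarrow> f a \<in> lin_map K B M" "\<And>b. b \<in> carrier B \<Longrightarrow> (\<lambda>a. f a b) \<in> lin_map K A M"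
  using assms by (auto simp: bilin_def)

lemma lin_map_add:
  assumes "module K N" "f \<in> lin_map K M N" "g \<in> lin_map K M N"
  shows "(\<lambda>x. f x \<oplus>\<^bsub>N\<^esub> g x) \<in> lin_map K M N"
proof -
  interpret N: module K N by fact
  show ?thesis
    using lin_mapD[OF assms(2)] lin_mapD[OF assms(3)]
    unfolding lin_map_def by (auto simp: N.a_ac N.smult_r_distr)
qed

lemma lin_map_cong:
  assumes "module K M" "f \<in> lin_map K M N" "\<And>x. x \<in> carrier M \<Longrightarrow> g x = f x"
  shows "g \<in> lin_map K M N"
proof -
  interpret M: module K M by fact
  show ?thesis using assms(2,3) unfolding lin_map_def by auto
qed

locale tensor_product =
  fixes K :: "'k ring" and A :: "('k, 'a) module" and B :: "('k, 'b) module"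
  assumes mod_left: "module K A" and mod_right: "module K B"
begin

sublocale A: module K A by (rule mod_left)
sublocale B: module K B by (rule mod_right)

abbreviation "F \<equiv> free_module K (carrier A \<times> carrier B)"
abbreviation "N \<equiv> tensor_null K A B"
abbreviation "T \<equiv> tensor_mod K A B"
abbreviation ten (infixl "\<otimes>\<otimes>" 75) where "a \<otimes>\<otimes> b \<equiv> tens K A B a b"

lemma K_cring: "cring K" ..

lemma F_module: "module K F"
  by (rule free_module_module[OF K_cring])

lemma rels_subset: "tensor_rels K A B \<subseteq> carrier F"
proof -
  interpret F: module K F by (rule F_module)
  note sc = single_closed[OF K_cring]
  show ?thesis
    unfolding tensor_rels_def Let_def
    by (intro Un_least subsetI; clarify intro!: F.minus_closed F.a_closed F.smult_closed sc SigmaI)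
      (auto intro!: F.minus_closed F.add.m_closed F.smult_closed sc)
qed

lemma null_submodule: "submodule N K F"
  unfolding tensor_null_def by (rule kspan_submodule[OF F_module rels_subset])

lemma T_module: "module K T"
  unfolding tensor_mod_def by (rule quot_module[OF F_module null_submodule])

sublocale T: module K T by (rule T_module)

lemma proj_linear: "(\<lambda>p. N +>\<^bsub>F\<^esub> p) \<in> lin_map K F T"
  unfolding tensor_mod_def by (rule quot_proj_linear[OF F_module null_submodule])

lemma T_carrier: "carrier T = (\<lambda>p. N +>\<^bsub>F\<^esub> p) ` carrier F"
  by (simp add: tensor_mod_def quot_carrier)

lemma tens_closed [simp]: "a \<in> carrier A \<Longrightarrow> b \<in> carrier B \<Longrightarrow> a \<otimes>\<otimes> b \<in> carrier T"
  unfolding tens_def by (intro lin_mapD(1)[OF proj_linear] single_closed[OF K_cring]) auto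

lemma tens_eqI:
  assumes "single K (a, b) \<ominus>\<^bsub>F\<^esub> p \<in> tensor_rels K A B" "a \<in> carrier A" "b \<in> carrier B" "p \<in> carrier F"
  shows "a \<otimes>\<otimes> b = N +>\<^bsub>F\<^esub> p"
  unfolding tens_def
  using assms quot_eq_iff[OF F_module null_submodule, of "single K (a, b)" p] kspan_base[of "tensor_rels K A B" K F]
    single_closed[OF K_cring, of "(a, b)" "carrier A \<times> carrier B"]
  unfolding tensor_null_def by blast

lemma
  assumes "a \<in> carrier A" "b \<in> carrier B"
  shows tens_add_left: "\<And>a'. a' \<in> carrier A \<Longrightarrow> (a \<oplus>\<^bsub>A\<^esub> a') \<otimes>\<otimes> b = a \<otimes>\<otimes> b \<oplus>\<^bsub>T\<^esub> a' \<otimes>\<otimes> b"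
    and tens_add_right: "\<And>b'. b' \<in> carrier B \<Longrightarrow> a \<otimes>\<otimes> (b \<oplus>\<^bsub>B\<^esub> b') = a \<otimes>\<otimes> b \<oplus>\<^bsub>T\<^esub> a \<otimes>\<otimes> b'"
    and tens_smult_left: "\<And>c. c \<in> carrier K \<Longrightarrow> (c \<odot>\<^bsub>A\<^esub> a) \<otimes>\<otimes> b = c \<odot>\<^bsub>T\<^esub> (a \<otimes>\<otimes> b)"
    and tens_smult_right: "\<And>c. c \<in> carrier K \<Longrightarrow> a \<otimes>\<otimes> (c \<odot>\<^bsub>B\<^esub> b) = c \<odot>\<^bsub>T\<^esub> (a \<otimes>\<otimes> b)"
proof -
  interpret F: module K F by (rule F_module)
  have sc: "single K (x, y) \<in> carrier F" if "x \<in> carrier A" "y \<in> carrier B" for x y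
    using that by (intro single_closed[OF K_cring]) auto
  note pr = lin_mapD[OF proj_linear]
  {
    fix a' assume a': "a' \<in> carrier A"
    have "(a \<oplus>\<^bsub>A\<^esub> a') \<otimes>\<otimes> b = N +>\<^bsub>F\<^esub> (single K (a, b) \<oplus>\<^bsub>F\<^esub> single K (a', b))"
      using assms a' sc by (intro tens_eqI) (unfold tensor_rels_def Let_def Un_iff mem_Collect_eq, blast, simp_all)
    then show "(a \<oplus>\<^bsub>A\<^esub> a') \<otimes>\<otimes> b = a \<otimes>\<otimes> b \<oplus>\<^bsub>T\<^esub> a' \<otimes>\<otimes> b"
      using pr(2) sc assms a' by (simp add: tens_def)
  next
    fix b' assume b': "b' \<in> carrier B"
    have "a \<otimes>\<otimes> (b \<oplus>\<^bsub>B\<^esub> b') = N +>\<^bsub>F\<^esub> (single K (a, b) \<oplus>\<^bsub>F\<^esub> single K (a, b'))"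
      using assms b' sc by (intro tens_eqI) (unfold tensor_rels_def Let_def Un_iff mem_Collect_eq, blast, simp_all)
    then show "a \<otimes>\<otimes> (b \<oplus>\<^bsub>B\<^esub> b') = a \<otimes>\<otimes> b \<oplus>\<^bsub>T\<^esub> a \<otimes>\<otimes> b'"
      using pr(2) sc assms b' by (simp add: tens_def)
  next
    fix c assume c: "c \<in> carrier K"
    have "(c \<odot>\<^bsub>A\<^esub> a) \<otimes>\<otimes> b = N +>\<^bsub>F\<^esub> (c \<odot>\<^bsub>F\<^esub> single K (a, b))"
      using assms c sc by (intro tens_eqI) (unfold tensor_rels_def Let_def Un_iff mem_Collect_eq, blast, simp_all)
    then show "(c \<odot>\<^bsub>A\<^esub> a) \<otimes>\<otimes> b = c \<odot>\<^bsub>T\<^esub> (a \<otimes>\<otimes> b)"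
      using pr(3) sc assms c by (simp add: tens_def)
    have "a \<otimes>\<otimes> (c \<odot>\<^bsub>B\<^esub> b) = N +>\<^bsub>F\<^esub> (c \<odot>\<^bsub>F\<^esub> single K (a, b))"
      using assms c sc by (intro tens_eqI) (unfold tensor_rels_def Let_def Un_iff mem_Collect_eq, blast, simp_all)
    then show "a \<otimes>\<otimes> (c \<odot>\<^bsub>B\<^esub> b) = c \<odot>\<^bsub>T\<^esub> (a \<otimes>\<otimes> b)"
      using pr(3) sc assms c by (simp add: tens_def)
  }
qed

lemma tens_bilin: "bilin K A B T (\<lambda>a b. a \<otimes>\<otimes> b)"
  unfolding bilin_def lin_map_def
  by (auto simp: tens_add_left tens_add_right tens_smult_left tens_smult_right)

lemma tens_zero:
  "b \<in> carrier B \<Longrightarrow> \<zero>\<^bsub>A\<^esub> \<otimes>\<otimes> b = \<zero>\<^bsub>T\<^esub>" "a \<in> carrier A \<Longrightarrow> a \<otimes>\<otimes> \<zero>\<^bsub>B\<^esub> = \<zero>\<^bsub>T\<^esub>"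
  using lin_map_zero[OF bilinD(2)[OF tens_bilin] mod_left T_module]
    lin_map_zero[OF bilinD(1)[OF tens_bilin] mod_right T_module] by auto

text \<open>Scalars can be absorbed into the first factor, so closure under sums is enough to reach every tensor
  from the pure ones.\<close>

lemma tensor_induct [consumes 1, case_names add tens]:
  assumes x: "x \<in> carrier T"
    and P_add: "\<And>x y. x \<in> carrier T \<Longrightarrow> y \<in> carrier T \<Longrightarrow> P x \<Longrightarrow> P y \<Longrightarrow> P (x \<oplus>\<^bsub>T\<^esub> y)"
    and P_tens: "\<And>a b. a \<in> carrier A \<Longrightarrow> b \<in> carrier B \<Longrightarrow> P (a \<otimes>\<otimes> b)"
  shows "P x"
proof -
  note pr = lin_mapD[OF proj_linear]
  obtain p where p: "p \<in> carrier F" "x = N +>\<^bsub>F\<^esub> p" using x T_carrier by auto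
  have "P (N +>\<^bsub>F\<^esub> p)"
    using K_cring p(1)
  proof (induction p rule: free_module_induct)
    case zero
    have "N +>\<^bsub>F\<^esub> \<zero>\<^bsub>F\<^esub> = \<zero>\<^bsub>A\<^esub> \<otimes>\<otimes> \<zero>\<^bsub>B\<^esub>"
      using lin_map_zero[OF proj_linear F_module T_module] tens_zero by simp
    then show ?case using P_tens by simp
  next
    case (add p q)
    then show ?case using P_add pr by simp
  next
    case (single c ab)
    then obtain a b where ab: "ab = (a, b)" "a \<in> carrier A" "b \<in> carrier B" by auto
    have "N +>\<^bsub>F\<^esub> (c \<odot>\<^bsub>F\<^esub> single K ab) = (c \<odot>\<^bsub>A\<^esub> a) \<otimes>\<otimes> b"
      using ab single pr(3) single_closed[OF K_cring, of ab "carrier A \<times> carrier B"]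
      by (simp add: tens_smult_left) (simp add: tens_def)
    then show ?case using P_tens ab single by simp
  qed
  then show ?thesis using p by simp
qed

lemma lin_map_tensor_eq:
  assumes "f \<in> lin_map K T M" "g \<in> lin_map K T M" "x \<in> carrier T"
    and "\<And>a b. a \<in> carrier A \<Longrightarrow> b \<in> carrier B \<Longrightarrow> f (a \<otimes>\<otimes> b) = g (a \<otimes>\<otimes> b)"
  shows "f x = g x"
  using assms(3) by (induction rule: tensor_induct) (simp_all add: lin_mapD[OF assms(1)] lin_mapD[OF assms(2)] assms(4))

lemma
  assumes M: "module K M" and f: "bilin K A B M f"
  shows tensor_lift_linear: "tensor_lift K M f \<in> lin_map K T M"
    and tensor_lift_tens: "\<And>a b. a \<in> carrier A \<Longrightarrow> b \<in> carrier B \<Longrightarrow> tensor_lift K M f (a \<otimes>\<otimes> b) = f a b"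
proof -
  let ?g = "\<lambda>ab. f (fst ab) (snd ab)"
  interpret F: module K F by (rule F_module)
  interpret M: module K M by fact
  have fl: "a \<in> carrier A \<Longrightarrow> b \<in> carrier B \<Longrightarrow> f a b \<in> carrier M" for a b
    using lin_mapD(1)[OF bilinD(1)[OF f]] .
  have lin: "free_lift K M ?g \<in> lin_map K F M"
    using fl by (intro free_lift_linear[OF M]) auto
  have sg: "free_lift K M ?g (single K (a, b)) = f a b" if "a \<in> carrier A" "b \<in> carrier B" for a b
    using free_lift_single[OF M, of "carrier A \<times> carrier B" ?g "(a, b)"] fl that by auto
  note L = lin_mapD[OF lin] lin_map_minus[OF lin F_module M]
  have sc: "single K (x, y) \<in> carrier F" if "x \<in> carrier A" "y \<in> carrier B" for x y
    using that by (intro single_closed[OF K_cring]) auto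
  note f1 = lin_mapD[OF bilinD(1)[OF f]] and f2 = lin_mapD[OF bilinD(2)[OF f]]
  \<comment> \<open>The linear extension kills the relations, so it is constant on cosets and the choice of a
    representative is harmless.\<close>
  have "N \<subseteq> {p \<in> carrier F. free_lift K M ?g p = \<zero>\<^bsub>M\<^esub>}"
    unfolding tensor_null_def
  proof (intro kspan_least lin_map_kernel[OF lin F_module M] subsetI CollectI conjI)
    fix p assume p: "p \<in> tensor_rels K A B"
    then show "p \<in> carrier F" using rels_subset by blast
    from p show "free_lift K M ?g p = \<zero>\<^bsub>M\<^esub>"
      unfolding tensor_rels_def Let_def
      by (auto simp: L(2-4) sc sg f1 f2 M.r_neg M.minus_eq)
  qed
  then have null: "free_lift K M ?g p = \<zero>\<^bsub>M\<^esub>" if "p \<in> N" for p using that by auto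
  have eq: "tensor_lift K M f (N +>\<^bsub>F\<^esub> p) = free_lift K M ?g p" if p: "p \<in> carrier F" for p
  proof -
    let ?q = "SOME q. q \<in> N +>\<^bsub>F\<^esub> p"
    have "?q \<in> N +>\<^bsub>F\<^esub> p"
      by (rule someI[of "\<lambda>q. q \<in> N +>\<^bsub>F\<^esub> p"]) (rule quot_self[OF F_module null_submodule p])
    note q = quot_rep[OF F_module null_submodule p this]
    then have "?q \<ominus>\<^bsub>F\<^esub> p \<in> N" using quot_eq_iff[OF F_module null_submodule] p by blast
    then have "free_lift K M ?g ?q \<ominus>\<^bsub>M\<^esub> free_lift K M ?g p = \<zero>\<^bsub>M\<^esub>"
      using L(4)[OF conjunct1[OF q] p] null by simp
    then have "free_lift K M ?g ?q = free_lift K M ?g p"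
      by (rule M.eq_iff_minus_zero[OF L(1)[OF conjunct1[OF q]] L(1)[OF p], THEN iffD2])
    then show ?thesis by (simp add: tensor_lift_def free_lift_def supp_def Let_def)
  qed
  note pr = lin_mapD(2,3)[OF proj_linear, symmetric]
  show "tensor_lift K M f \<in> lin_map K T M"
    unfolding lin_map_def T_carrier
  proof (intro CollectI conjI Pi_I ballI)
    fix x assume "x \<in> (\<lambda>p. N +>\<^bsub>F\<^esub> p) ` carrier F"
    then obtain p where p: "p \<in> carrier F" "x = N +>\<^bsub>F\<^esub> p" by blast
    show "tensor_lift K M f x \<in> carrier M" using p eq L(1) by simp
    fix c assume c: "c \<in> carrier K"
    have "tensor_lift K M f (c \<odot>\<^bsub>T\<^esub> x) = free_lift K M ?g (c \<odot>\<^bsub>F\<^esub> p)"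
      using eq[OF F.smult_closed[OF c p(1)]] by (simp only: p(2) pr(2)[OF c p(1)])
    then show "tensor_lift K M f (c \<odot>\<^bsub>T\<^esub> x) = c \<odot>\<^bsub>M\<^esub> tensor_lift K M f x"
      using L(3)[OF c p(1)] eq[OF p(1)] by (simp only: p(2))
  next
    fix x y assume "x \<in> (\<lambda>p. N +>\<^bsub>F\<^esub> p) ` carrier F" "y \<in> (\<lambda>p. N +>\<^bsub>F\<^esub> p) ` carrier F"
    then obtain p q where p: "p \<in> carrier F" "x = N +>\<^bsub>F\<^esub> p" and q: "q \<in> carrier F" "y = N +>\<^bsub>F\<^esub> q"
      by blast
    have "tensor_lift K M f (x \<oplus>\<^bsub>T\<^esub> y) = free_lift K M ?g (p \<oplus>\<^bsub>F\<^esub> q)"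
      using eq[OF F.add.m_closed[OF p(1) q(1)]] by (simp only: p(2) q(2) pr(1)[OF p(1) q(1)])
    then show "tensor_lift K M f (x \<oplus>\<^bsub>T\<^esub> y) = tensor_lift K M f x \<oplus>\<^bsub>M\<^esub> tensor_lift K M f y"
      using L(2)[OF p(1) q(1)] eq[OF p(1)] eq[OF q(1)] by (simp only: p(2) q(2))
  qed
  show "tensor_lift K M f (a \<otimes>\<otimes> b) = f a b" if "a \<in> carrier A" "b \<in> carrier B" for a b
    unfolding tens_def using that eq sc sg by simp
qed

text \<open>A lift depends linearly on any parameter on which its bilinear map depends linearly. The product of
  a twisted tensor product is a nest of three lifts, and this lemma is what makes the outer ones
  well defined.\<close>

lemma tensor_lift_param_linear:
  assumes Z: "module K Z" and M: "module K M"
    and f: "\<And>z. z \<in> carrier Z \<Longrightarrow> bilin K A B M (f z)"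
    and lin: "\<And>a b. a \<in> carrier A \<Longrightarrow> b \<in> carrier B \<Longrightarrow> (\<lambda>z. f z a b) \<in> lin_map K Z M"
    and x: "x \<in> carrier T"
  shows "(\<lambda>z. tensor_lift K M (f z) x) \<in> lin_map K Z M"
  using x
proof (induction rule: tensor_induct)
  case (add x y)
  then show ?case
    by (intro lin_map_cong[OF Z lin_map_add[OF M add(3,4)]])
      (simp add: lin_mapD[OF tensor_lift_linear[OF M f]])
next
  case (tens a b)
  then show ?case
    by (intro lin_map_cong[OF Z lin]) (auto simp: tensor_lift_tens[OF M f])
qed

lemma tensor_lift_id:
  assumes "x \<in> carrier T" "\<And>a b. a \<in> carrier A \<Longrightarrow> b \<in> carrier B \<Longrightarrow> f a b = a \<otimes>\<otimes> b"
  shows "tensor_lift K T f x = x"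
proof -
  have f: "bilin K A B T f"
    unfolding bilin_def using assms(2)
    by (auto intro!: lin_map_cong[OF mod_left bilinD(2)[OF tens_bilin]]
        lin_map_cong[OF mod_right bilinD(1)[OF tens_bilin]])
  have "(\<lambda>x. x) \<in> lin_map K T T" by (auto simp: lin_map_def)
  with tensor_lift_linear[OF T_module f] show ?thesis
    by (rule lin_map_tensor_eq[OF _ _ assms(1)]) (simp add: tensor_lift_tens[OF T_module f] assms(2))
qed

end

subsection \<open>Functoriality and injectivity\<close>

lemma
  assumes R: "module K R" and S: "module K S" and A: "module K A" and B: "module K B"
    and f: "f \<in> lin_map K R A" and g: "g \<in> lin_map K S B"
  shows tensor_map_linear: "tensor_map K A B f g \<in> lin_map K (tensor_mod K R S) (tensor_mod K A B)"
    and tensor_map_tens: "\<And>r s. r \<in> carrier R \<Longrightarrow> s \<in> carrier S \<Longrightarrow>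
          tensor_map K A B f g (tens K R S r s) = tens K A B (f r) (g s)"
proof -
  interpret RS: tensor_product K R S by (rule tensor_product.intro[OF R S])
  interpret AB: tensor_product K A B by (rule tensor_product.intro[OF A B])
  have bil: "bilin K R S (tensor_mod K A B) (\<lambda>r s. tens K A B (f r) (g s))"
    unfolding bilin_def
    using lin_map_comp[OF f bilinD(2)[OF AB.tens_bilin]] lin_map_comp[OF g bilinD(1)[OF AB.tens_bilin]]
      lin_mapD(1)[OF f] lin_mapD(1)[OF g] by auto
  show "tensor_map K A B f g \<in> lin_map K (tensor_mod K R S) (tensor_mod K A B)"
    unfolding tensor_map_def by (rule RS.tensor_lift_linear[OF AB.T_module bil])
  show "tensor_map K A B f g (tens K R S r s) = tens K A B (f r) (g s)"
    if "r \<in> carrier R" "s \<in> carrier S" for r s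
    unfolding tensor_map_def using that by (rule RS.tensor_lift_tens[OF AB.T_module bil])
qed

text \<open>A submodule maximal among those that meet the image of \<open>f\<close> trivially is a complement of the image;
  Zorn's lemma provides one, and the projection along it inverts \<open>f\<close>.\<close>

lemma linear_left_inverse:
  assumes K: "field K" and R: "module K R" and A: "module K A"
    and f: "f \<in> lin_map K R A" and inj: "inj_on f (carrier R)"
  obtains p where "p \<in> lin_map K A R" "\<And>r. r \<in> carrier R \<Longrightarrow> p (f r) = r"
proof -
  interpret K: field K by fact
  interpret R: module K R by fact
  interpret A: module K A by fact
  note fD = lin_mapD[OF f] and f0 = lin_map_zero[OF f R A] and fm = lin_map_minus[OF f R A]
  define \<C> where "\<C> = {N. submodule N K A \<and> N \<inter> f ` carrier R \<subseteq> {\<zero>\<^bsub>A\<^esub>}}"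
  have "\<exists>U\<in>\<C>. \<forall>V\<in>\<C>. U \<subseteq> V \<longrightarrow> V = U"
  proof (rule subset_Zorn)
    fix c assume c: "subset.chain \<C> c"
    show "\<exists>U\<in>\<C>. \<forall>V\<in>c. V \<subseteq> U"
    proof (cases "c = {}")
      case True
      have "{\<zero>\<^bsub>A\<^esub>} \<in> \<C>" unfolding \<C>_def by (auto intro: A.submoduleI)
      then show ?thesis using True by blast
    next
      case False
      have cC: "\<And>N. N \<in> c \<Longrightarrow> submodule N K A" "\<And>N. N \<in> c \<Longrightarrow> N \<inter> f ` carrier R \<subseteq> {\<zero>\<^bsub>A\<^esub>}"
        and tot: "\<And>N N'. N \<in> c \<Longrightarrow> N' \<in> c \<Longrightarrow> N \<subseteq> N' \<or> N' \<subseteq> N"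
        using c unfolding subset_chain_def \<C>_def by auto
      have "submodule (\<Union>c) K A"
      proof (rule A.submoduleI)
        show "\<Union>c \<subseteq> carrier A" using A.submoduleE(1)[OF cC(1)] by blast
        show "\<zero>\<^bsub>A\<^esub> \<in> \<Union>c" using False subgroup.one_closed[OF submodule.axioms(1)[OF cC(1)]] by auto
        fix x y assume "x \<in> \<Union>c" "y \<in> \<Union>c"
        then obtain N N' where "N \<in> c" "x \<in> N" "N' \<in> c" "y \<in> N'" by blast
        with tot[of N N'] A.submoduleE(5)[OF cC(1)] show "x \<oplus>\<^bsub>A\<^esub> y \<in> \<Union>c" by blast
      qed (use A.submoduleE(3,4)[OF cC(1)] in blast)+
      moreover have "\<Union>c \<inter> f ` carrier R \<subseteq> {\<zero>\<^bsub>A\<^esub>}" using cC(2) by blast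
      ultimately show ?thesis unfolding \<C>_def by blast
    qed
  qed
  then obtain N where N: "submodule N K A" "N \<inter> f ` carrier R \<subseteq> {\<zero>\<^bsub>A\<^esub>}"
    and max: "\<And>V. submodule V K A \<Longrightarrow> V \<inter> f ` carrier R \<subseteq> {\<zero>\<^bsub>A\<^esub>} \<Longrightarrow> N \<subseteq> V \<Longrightarrow> V = N"
    unfolding \<C>_def by auto
  note ND = A.submoduleE[OF N(1)]
  have NA: "n \<in> N \<Longrightarrow> n \<in> carrier A" for n using ND(1) by blast
  have N0: "\<zero>\<^bsub>A\<^esub> \<in> N" using subgroup.one_closed[OF submodule.axioms(1)[OF N(1)]] by simp
  have decomp: "\<exists>r\<in>carrier R. \<exists>n\<in>N. x = f r \<oplus>\<^bsub>A\<^esub> n" if x: "x \<in> carrier A" for x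
  proof (rule ccontr)
    assume no: "\<not> ?thesis"
    \<comment> \<open>If \<open>x\<close> is not in the sum, then adding \<open>x\<close> to \<open>N\<close> contradicts maximality.\<close>
    let ?V = "{n \<oplus>\<^bsub>A\<^esub> c \<odot>\<^bsub>A\<^esub> x | n c. n \<in> N \<and> c \<in> carrier K}"
    have XI: "n \<in> N \<Longrightarrow> c \<in> carrier K \<Longrightarrow> y = n \<oplus>\<^bsub>A\<^esub> c \<odot>\<^bsub>A\<^esub> x \<Longrightarrow> y \<in> ?V" for n c y by blast
    have NX: "N \<subseteq> ?V"
      using NA x by (intro subsetI, rule_tac XI[of _ "\<zero>\<^bsub>K\<^esub>"]) auto
    have xX: "x \<in> ?V" using x N0 by (intro XI[of "\<zero>\<^bsub>A\<^esub>" "\<one>\<^bsub>K\<^esub>"]) auto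
    have xN: "x \<notin> N"
      using no x f0 R.zero_closed by (metis A.l_zero)
    have "submodule ?V K A"
    proof (rule A.submoduleI)
      show "?V \<subseteq> carrier A" using NA x by auto
      show "\<zero>\<^bsub>A\<^esub> \<in> ?V" using NX N0 by blast
      fix y assume "y \<in> ?V"
      then obtain n c where y: "n \<in> N" "c \<in> carrier K" "y = n \<oplus>\<^bsub>A\<^esub> c \<odot>\<^bsub>A\<^esub> x" by blast
      show "\<ominus>\<^bsub>A\<^esub> y \<in> ?V"
        using y x NA ND(3) by (intro XI[of "\<ominus>\<^bsub>A\<^esub> n" "\<ominus>\<^bsub>K\<^esub> c"]) (auto simp: A.smult_l_minus A.minus_add)
      show "d \<odot>\<^bsub>A\<^esub> y \<in> ?V" if "d \<in> carrier K" for d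
        using y x NA ND(4) that
        by (intro XI[of "d \<odot>\<^bsub>A\<^esub> n" "d \<otimes>\<^bsub>K\<^esub> c"]) (auto simp: A.smult_r_distr A.smult_assoc1)
      fix z assume "z \<in> ?V"
      then obtain n' c' where z: "n' \<in> N" "c' \<in> carrier K" "z = n' \<oplus>\<^bsub>A\<^esub> c' \<odot>\<^bsub>A\<^esub> x" by blast
      show "y \<oplus>\<^bsub>A\<^esub> z \<in> ?V"
        using y z x NA ND(5)
        by (intro XI[of "n \<oplus>\<^bsub>A\<^esub> n'" "c \<oplus>\<^bsub>K\<^esub> c'"]) (auto simp: A.smult_l_distr A.a_ac)
    qed
    then have "\<not> ?V \<inter> f ` carrier R \<subseteq> {\<zero>\<^bsub>A\<^esub>}" using max NX xX xN by blast
    then obtain y where y: "y \<in> ?V" "y \<in> f ` carrier R" "y \<noteq> \<zero>\<^bsub>A\<^esub>" by blast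
    from y(1) obtain n c where n: "n \<in> N" "c \<in> carrier K" "y = n \<oplus>\<^bsub>A\<^esub> c \<odot>\<^bsub>A\<^esub> x" by blast
    from y(2) obtain r where "r \<in> carrier R" "y = f r" by blast
    with n y(3) have nc: "n \<in> N" "c \<in> carrier K" "r \<in> carrier R"
      "f r = n \<oplus>\<^bsub>A\<^esub> c \<odot>\<^bsub>A\<^esub> x" "f r \<noteq> \<zero>\<^bsub>A\<^esub>" by simp_all
    have "c \<noteq> \<zero>\<^bsub>K\<^esub>"
    proof
      assume "c = \<zero>\<^bsub>K\<^esub>"
      then have "f r \<in> N" using nc NA x by simp
      then show False using nc N(2) by blast
    qed
    then have cU: "c \<in> Units K" using nc K.field_Units by blast
    let ?d = "inv\<^bsub>K\<^esub> c"
    have d: "?d \<in> carrier K" "?d \<otimes>\<^bsub>K\<^esub> c = \<one>\<^bsub>K\<^esub>" using cU by auto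
    have "f (?d \<odot>\<^bsub>R\<^esub> r) \<oplus>\<^bsub>A\<^esub> (\<ominus>\<^bsub>A\<^esub> (?d \<odot>\<^bsub>A\<^esub> n)) = ?d \<odot>\<^bsub>A\<^esub> (f r \<oplus>\<^bsub>A\<^esub> \<ominus>\<^bsub>A\<^esub> n)"
      using nc(1-3) d fD(1)[OF nc(3)] fD(3)[OF d(1) nc(3)] NA[OF nc(1)]
      by (simp add: A.smult_r_distr A.smult_r_minus)
    also have "f r \<oplus>\<^bsub>A\<^esub> \<ominus>\<^bsub>A\<^esub> n = c \<odot>\<^bsub>A\<^esub> x"
      unfolding nc(4) using nc(1,2) NA x by (simp add: A.a_ac A.r_neg A.r_neg1 A.r_neg2)
    also have "?d \<odot>\<^bsub>A\<^esub> (c \<odot>\<^bsub>A\<^esub> x) = x" using d nc x by (simp add: A.smult_assoc1[symmetric])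
    finally have "x = f (?d \<odot>\<^bsub>R\<^esub> r) \<oplus>\<^bsub>A\<^esub> (\<ominus>\<^bsub>A\<^esub> (?d \<odot>\<^bsub>A\<^esub> n))" ..
    moreover have "?d \<odot>\<^bsub>R\<^esub> r \<in> carrier R" "\<ominus>\<^bsub>A\<^esub> (?d \<odot>\<^bsub>A\<^esub> n) \<in> N" using nc d ND by auto
    ultimately show False using no by blast
  qed
  have uniq: "r = r'" if "r \<in> carrier R" "r' \<in> carrier R" "n \<in> N" "n' \<in> N" "f r \<oplus>\<^bsub>A\<^esub> n = f r' \<oplus>\<^bsub>A\<^esub> n'" for r r' n n'
  proof -
    have "f (r \<ominus>\<^bsub>R\<^esub> r') = (f r \<oplus>\<^bsub>A\<^esub> n) \<oplus>\<^bsub>A\<^esub> \<ominus>\<^bsub>A\<^esub> n \<oplus>\<^bsub>A\<^esub> \<ominus>\<^bsub>A\<^esub> f r'"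
      using that(1-4) fm fD NA by (simp add: A.a_assoc A.minus_eq A.r_neg)
    also have "\<dots> = n' \<oplus>\<^bsub>A\<^esub> \<ominus>\<^bsub>A\<^esub> n"
      unfolding that(5) using that(1-4) fD(1) NA
      by (simp add: A.a_assoc, subst A.a_lcomm) (simp_all add: A.a_comm[of "f r'"] A.a_assoc A.l_neg)
    also have "\<dots> \<in> N" using that ND by simp
    finally have "f (r \<ominus>\<^bsub>R\<^esub> r') = \<zero>\<^bsub>A\<^esub>" using N(2) that by blast
    then have "f r = f r'" using fm[OF that(1,2)] A.eq_iff_minus_zero[OF fD(1)[OF that(1)] fD(1)[OF that(2)]] by simp
    then show ?thesis using inj that by (auto dest: inj_onD)
  qed
  define p where "p = (\<lambda>x. THE r. r \<in> carrier R \<and> (\<exists>n\<in>N. x = f r \<oplus>\<^bsub>A\<^esub> n))"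
  have pI: "p x = r" if "r \<in> carrier R" "n \<in> N" "x = f r \<oplus>\<^bsub>A\<^esub> n" for x r n
    unfolding p_def
  proof (rule the_equality)
    show "r \<in> carrier R \<and> (\<exists>n\<in>N. x = f r \<oplus>\<^bsub>A\<^esub> n)" using that by blast
    fix r' assume "r' \<in> carrier R \<and> (\<exists>n\<in>N. x = f r' \<oplus>\<^bsub>A\<^esub> n)"
    then obtain n' where "r' \<in> carrier R" "n' \<in> N" "x = f r' \<oplus>\<^bsub>A\<^esub> n'" by blast
    then show "r' = r" using uniq[of r' r n' n] that by simp
  qed
  show thesis
  proof (rule that[of p])
    show "p (f r) = r" if "r \<in> carrier R" for r
      using pI[of r "\<zero>\<^bsub>A\<^esub>"] that N0 fD by simp
    show "p \<in> lin_map K A R"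
      unfolding lin_map_def
    proof (intro CollectI conjI ballI Pi_I)
      fix x assume "x \<in> carrier A"
      then obtain r n where x: "r \<in> carrier R" "n \<in> N" "x = f r \<oplus>\<^bsub>A\<^esub> n" using decomp by blast
      show "p x \<in> carrier R" using pI[OF x] x by simp
      fix c assume c: "c \<in> carrier K"
      have "p (c \<odot>\<^bsub>A\<^esub> x) = c \<odot>\<^bsub>R\<^esub> r"
        using x c fD NA ND by (intro pI[of _ "c \<odot>\<^bsub>A\<^esub> n"]) (auto simp: A.smult_r_distr)
      then show "p (c \<odot>\<^bsub>A\<^esub> x) = c \<odot>\<^bsub>R\<^esub> p x" using pI[OF x] by simp
    next
      fix x y assume "x \<in> carrier A" "y \<in> carrier A"
      then obtain r n r' n' where x: "r \<in> carrier R" "n \<in> N" "x = f r \<oplus>\<^bsub>A\<^esub> n"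
        and y: "r' \<in> carrier R" "n' \<in> N" "y = f r' \<oplus>\<^bsub>A\<^esub> n'" using decomp by meson
      have "p (x \<oplus>\<^bsub>A\<^esub> y) = r \<oplus>\<^bsub>R\<^esub> r'"
        using x y fD NA ND by (intro pI[of _ "n \<oplus>\<^bsub>A\<^esub> n'"]) (auto simp: A.a_ac)
      then show "p (x \<oplus>\<^bsub>A\<^esub> y) = p x \<oplus>\<^bsub>R\<^esub> p y" using pI[OF x] pI[OF y] by simp
    qed
  qed
qed

text \<open>The tensor product of two left inverses is a left inverse of the tensor product.\<close>

lemma tensor_map_inj:
  assumes K: "field K" and mods: "module K R" "module K S" "module K A" "module K B"
    and f: "f \<in> lin_map K R A" "inj_on f (carrier R)" and g: "g \<in> lin_map K S B" "inj_on g (carrier S)"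
  shows "inj_on (tensor_map K A B f g) (carrier (tensor_mod K R S))"
proof -
  obtain p where p: "p \<in> lin_map K A R" "\<And>r. r \<in> carrier R \<Longrightarrow> p (f r) = r"
    using linear_left_inverse[OF K mods(1,3) f] by blast
  obtain p' where p': "p' \<in> lin_map K B S" "\<And>r. r \<in> carrier S \<Longrightarrow> p' (g r) = r"
    using linear_left_inverse[OF K mods(2,4) g] by blast
  interpret RS: tensor_product K R S by (rule tensor_product.intro[OF mods(1,2)])
  note fg = tensor_map_linear[OF mods f(1) g(1)] tensor_map_tens[OF mods f(1) g(1)]
  note pp = tensor_map_linear[OF mods(3,4,1,2) p(1) p'(1)] tensor_map_tens[OF mods(3,4,1,2) p(1) p'(1)]
  have "tensor_map K R S p p' (tensor_map K A B f g x) = x" if "x \<in> carrier (tensor_mod K R S)" for x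
    using that
  proof (induction rule: RS.tensor_induct)
    case (add x y)
    then show ?case using lin_mapD[OF fg(1)] lin_mapD[OF pp(1)] by simp
  next
    case (tens a b)
    then show ?case using fg(2) pp(2) p p' lin_mapD(1)[OF f(1)] lin_mapD(1)[OF g(1)] by simp
  qed
  then show ?thesis by (rule inj_on_inverseI)
qed

section \<open>Powers of commuting automorphisms\<close>

lemma
  assumes f: "bij_betw f U U"
  shows bij_apply: "\<And>x. x \<in> U \<Longrightarrow> f x \<in> U"
    and inv_into_apply: "\<And>x. x \<in> U \<Longrightarrow> inv_into U f x \<in> U"
    and inv_into_cancel: "\<And>x. x \<in> U \<Longrightarrow> f (inv_into U f x) = x" "\<And>x. x \<in> U \<Longrightarrow> inv_into U f (f x) = x"
  using f by (auto simp: bij_betw_def inv_into_into f_inv_into_f)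

lemma commute_on_inv_into:
  assumes f: "bij_betw f U U" and g: "\<And>x. x \<in> U \<Longrightarrow> g x \<in> U" and c: "commute_on U f g"
  shows "commute_on U (inv_into U f) g"
  unfolding commute_on_def
proof
  fix x assume x: "x \<in> U"
  note fi = inv_into_apply[OF f] inv_into_cancel[OF f]
  have "f (g (inv_into U f x)) = g x"
    using c x fi unfolding commute_on_def by simp
  then show "inv_into U f (g x) = g (inv_into U f x)"
    using fi(3)[of "g (inv_into U f x)"] x fi g by simp
qed

lemma commute_on_sym: "commute_on U f g \<Longrightarrow> commute_on U g f"
  by (auto simp: commute_on_def)

lemma funpow_closed:
  assumes "\<And>x. x \<in> U \<Longrightarrow> f x \<in> U" "x \<in> U"
  shows "(f ^^ k) x \<in> U"
  by (induction k) (simp_all add: assms)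

lemma commute_on_funpow:
  assumes "\<And>x. x \<in> U \<Longrightarrow> f x \<in> U" "commute_on U f g"
  shows "commute_on U (f ^^ k) g"
proof (induction k)
  case (Suc k)
  then show ?case using assms funpow_closed[of U f] by (simp add: commute_on_def)
qed (simp add: commute_on_def)

lemma auto_zpow_closed:
  assumes "bij_betw f (carrier T) (carrier T)" "x \<in> carrier T"
  shows "auto_zpow T f k x \<in> carrier T"
  unfolding auto_zpow_def using assms
  by (auto intro!: funpow_closed bij_apply[OF assms(1)] inv_into_apply[OF assms(1)])

lemma commute_on_auto_zpow:
  assumes "bij_betw f (carrier T) (carrier T)" "\<And>x. x \<in> carrier T \<Longrightarrow> g x \<in> carrier T" "commute_on (carrier T) f g"
  shows "commute_on (carrier T) (auto_zpow T f k) g"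
  unfolding auto_zpow_def
  using commute_on_funpow[OF bij_apply[OF assms(1)] assms(3)]
    commute_on_funpow[OF inv_into_apply[OF assms(1)] commute_on_inv_into[OF assms]] by auto

lemma auto_zpow_one: "auto_zpow T f 1 = f"
  by (simp add: auto_zpow_def)

lemma auto_zpow_minus_one: "auto_zpow T f (-1) = inv_into (carrier T) f"
  by (simp add: auto_zpow_def)

text \<open>Integer powers of a bijection behave additively on the carrier. Steps of size one suffice, since
  multi-exponents are built up letter by letter from words.\<close>

lemma auto_zpow_step:
  assumes f: "bij_betw f (carrier T) (carrier T)" and x: "x \<in> carrier T" and e: "e = 1 \<or> e = -1"
  shows "auto_zpow T f (k + e) x = auto_zpow T f e (auto_zpow T f k x)"
proof -
  let ?g = "inv_into (carrier T) f"
  have up: "auto_zpow T f (k + 1) x = f (auto_zpow T f k x)" for k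
  proof (cases "0 \<le> k")
    case True
    then have "nat (k + 1) = Suc (nat k)" by simp
    then show ?thesis using True by (simp add: auto_zpow_def)
  next
    case False
    then have s: "nat (- k) = Suc (nat (- (k + 1)))" by simp
    have "f (auto_zpow T f k x) = (?g ^^ nat (- (k + 1))) x"
      using False x
      by (simp add: auto_zpow_def s funpow_closed inv_into_cancel[OF f] inv_into_apply[OF f] del: nat_minus_as_int)
    then show ?thesis using False by (auto simp: auto_zpow_def)
  qed
  have "auto_zpow T f (k - 1) x = ?g (auto_zpow T f k x)"
    using up[of "k - 1"] inv_into_cancel(2)[OF f auto_zpow_closed[OF f x, of "k - 1"]] by simp
  then show ?thesis using up e by (auto simp: auto_zpow_one auto_zpow_minus_one)
qed

lemma multi_pow_cong:
  "(\<And>i. i \<in> {1..m} \<Longrightarrow> \<alpha> i = \<beta> i) \<Longrightarrow> multi_pow T m f \<alpha> = multi_pow T m f \<beta>"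
  by (induction m) auto

locale commuting_bijections =
  fixes T :: "('a, 'e) ring_scheme" and m :: nat and f :: "nat \<Rightarrow> 'a \<Rightarrow> 'a"
  assumes bij: "\<And>i. i \<in> {1..m} \<Longrightarrow> bij_betw (f i) (carrier T) (carrier T)"
    and comm: "\<And>i j. i \<in> {1..m} \<Longrightarrow> j \<in> {1..m} \<Longrightarrow> commute_on (carrier T) (f i) (f j)"
begin

lemma pm_index: "u \<in> pm m \<Longrightarrow> nat \<bar>u\<bar> \<in> {1..m}"
  by (auto simp: pm_def)

lemma pm_sgn: "u \<in> pm m \<Longrightarrow> sgn u = 1 \<or> sgn u = -1"
  by (auto simp: pm_def sgn_if)

lemma pm_uminus: "u \<in> pm m \<Longrightarrow> - u \<in> pm m"
  by (auto simp: pm_def)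

lemma signed_auto_closed: "u \<in> pm m \<Longrightarrow> x \<in> carrier T \<Longrightarrow> signed_auto T f u x \<in> carrier T"
  unfolding signed_auto_def by (intro auto_zpow_closed bij pm_index)

lemma signed_auto_uminus:
  assumes "u \<in> pm m" "x \<in> carrier T"
  shows "signed_auto T f u (signed_auto T f (- u) x) = x"
  using pm_sgn[OF assms(1)] bij[OF pm_index[OF assms(1)]] assms(2)
  by (auto simp: signed_auto_def sgn_minus auto_zpow_one auto_zpow_minus_one inv_into_cancel)

lemma multi_pow_closed: "k \<le> m \<Longrightarrow> x \<in> carrier T \<Longrightarrow> multi_pow T k f \<alpha> x \<in> carrier T"
proof (induction k arbitrary: x)
  case (Suc k)
  then show ?case using auto_zpow_closed[OF bij, of "Suc k" x "\<alpha> (Suc k)"] by simp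
qed simp

lemma commute_signed_auto: "i \<in> {1..m} \<Longrightarrow> u \<in> pm m \<Longrightarrow> commute_on (carrier T) (f i) (signed_auto T f u)"
  unfolding signed_auto_def
  by (intro commute_on_sym[OF commute_on_auto_zpow] bij pm_index comm bij_apply[OF bij]) auto

lemma commute_multi_pow:
  assumes "u \<in> pm m" "k \<le> m"
  shows "commute_on (carrier T) (multi_pow T k f \<alpha>) (signed_auto T f u)"
  using assms(2)
proof (induction k)
  case (Suc k)
  have c: "commute_on (carrier T) (auto_zpow T (f (Suc k)) (\<alpha> (Suc k))) (signed_auto T f u)"
    using Suc.prems assms by (intro commute_on_auto_zpow bij commute_signed_auto signed_auto_closed) auto
  have "auto_zpow T (f (Suc k)) (\<alpha> (Suc k)) x \<in> carrier T" if "x \<in> carrier T" for x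
    using Suc.prems that by (intro auto_zpow_closed bij) auto
  then show ?case using c Suc by (simp add: commute_on_def)
qed (simp add: commute_on_def)

text \<open>Adding a signed unit vector to the exponent changes a single factor of the product, and commutativity
  brings that factor to the front.\<close>

lemma multi_pow_step:
  assumes "u \<in> pm m" "nat \<bar>u\<bar> \<le> k" "k \<le> m" "x \<in> carrier T"
  shows "multi_pow T k f (\<lambda>i. \<alpha> i + signed_unit u i) x = signed_auto T f u (multi_pow T k f \<alpha> x)"
  using assms(2-4)
proof (induction k arbitrary: x)
  case 0
  then show ?case using assms(1) by (simp add: pm_def)
next
  case (Suc k)
  let ?y = "auto_zpow T (f (Suc k)) (\<alpha> (Suc k)) x"
  have y: "?y \<in> carrier T" using Suc.prems by (intro auto_zpow_closed bij) auto
  show ?case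
  proof (cases "nat \<bar>u\<bar> \<le> k")
    case True
    then show ?thesis using Suc.IH[OF True _ y] Suc.prems by (simp add: signed_unit_def)
  next
    case False
    then have k: "nat \<bar>u\<bar> = Suc k" using Suc.prems by simp
    have "multi_pow T k f (\<lambda>i. \<alpha> i + signed_unit u i) = multi_pow T k f \<alpha>"
      using k by (intro multi_pow_cong) (simp add: signed_unit_def)
    moreover have "auto_zpow T (f (Suc k)) (\<alpha> (Suc k) + signed_unit u (Suc k)) x = signed_auto T f u ?y"
      using auto_zpow_step[OF bij[OF pm_index[OF assms(1)]] Suc.prems(3) pm_sgn[OF assms(1)]] k
      by (simp add: signed_auto_def signed_unit_def)
    ultimately show ?thesis
      using commute_multi_pow[OF assms(1), of k \<alpha>] y Suc.prems by (simp add: commute_on_def)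
  qed
qed

lemma multi_pow_step':
  assumes "u \<in> pm m" "x \<in> carrier T"
  shows "multi_pow T m f (\<lambda>i. \<alpha> i + signed_unit u i) x = multi_pow T m f \<alpha> (signed_auto T f u x)"
  using multi_pow_step[OF assms(1) _ le_refl assms(2)] commute_multi_pow[OF assms(1) le_refl, of \<alpha>]
    pm_index[OF assms(1)] assms(2)
  by (simp add: commute_on_def)

lemma multi_pow_invariant:
  assumes U: "\<And>i x. i \<in> {1..m} \<Longrightarrow> x \<in> U \<Longrightarrow> f i x \<in> U"
    "\<And>i x. i \<in> {1..m} \<Longrightarrow> x \<in> U \<Longrightarrow> inv_into (carrier T) (f i) x \<in> U"
    and x: "k \<le> m" "x \<in> U"
  shows "multi_pow T k f \<alpha> x \<in> U"
  using x
proof (induction k arbitrary: x)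
  case (Suc k)
  then have k: "Suc k \<in> {1..m}" by simp
  have "auto_zpow T (f (Suc k)) (\<alpha> (Suc k)) x \<in> U"
    unfolding auto_zpow_def using funpow_closed[of U, OF U(1)[OF k] Suc.prems(2)]
      funpow_closed[of U, OF U(2)[OF k] Suc.prems(2)] by simp
  then show ?case using Suc by simp
qed simp

lemma multi_pow_zero: "multi_pow T k f (\<lambda>_. 0) x = x"
  by (induction k arbitrary: x) (auto simp: auto_zpow_def)

end

lemma seq_deg_Nil: "seq_deg [] = (\<lambda>_. 0)"
  by (simp add: seq_deg_def)

lemma seq_deg_Cons: "seq_deg (u # us) = (\<lambda>i. seq_deg us i + signed_unit u i)"
  by (simp add: seq_deg_def fun_eq_iff)

lemma seq_deg_append: "seq_deg (us @ vs) = (\<lambda>i. seq_deg us i + seq_deg vs i)"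
  by (simp add: seq_deg_def fun_eq_iff)

lemma signed_unit_uminus: "signed_unit (- u) = (\<lambda>i. - signed_unit u i)"
  by (auto simp: signed_unit_def sgn_minus)

section \<open>Algebras with the relations of a twisted generalized Weyl construction\<close>

lemma list_prod_Nil: "list_prod T [] = \<one>\<^bsub>T\<^esub>"
  and list_prod_Cons: "list_prod T (x # xs) = x \<otimes>\<^bsub>T\<^esub> list_prod T xs"
  by (simp_all add: list_prod_def)

lemmas list_prod_simps = list_prod_Nil list_prod_Cons

lemma (in ring) list_prod_append:
  "set xs \<subseteq> carrier R \<Longrightarrow> set ys \<subseteq> carrier R \<Longrightarrow>
    list_prod R xs \<in> carrier R \<and> list_prod R (xs @ ys) = list_prod R xs \<otimes> list_prod R ys"
proof (induction xs)
  case Nil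
  have "list_prod R ys \<in> carrier R" using Nil.prems by (induction ys) (auto simp: list_prod_Nil list_prod_Cons)
  then show ?case by (simp add: list_prod_Nil)
next
  case (Cons x xs)
  have "list_prod R ys \<in> carrier R" using Cons.prems(2) by (induction ys) (auto simp: list_prod_Nil list_prod_Cons)
  then show ?case using Cons by (simp add: list_prod_Cons m_assoc)
qed

lemma alg_autoD:
  assumes "alg_auto K T f"
  shows "f \<in> ring_hom T T" "bij_betw f (carrier T) (carrier T)" "f \<in> lin_map K T T"
  using assms by (auto simp: alg_auto_def alg_iso_def ring_iso_def)

text \<open>A representation: an algebra \<open>C\<close> with a homomorphism \<open>\<eta>\<close> from the base algebra and elements \<open>Z u\<close>
  that satisfy the relations of the construction. The same facts are needed for a twisted generalized
  Weyl algebra itself, for the twisted tensor product with all of its generators, and for the twisted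
  tensor product with the generators of only one factor.\<close>

locale tgw_rep =
  fixes K :: "'k ring" and T :: "('k, 't) module" and m f w \<mu>
    and C :: "('k, 'c) module" and \<eta> :: "'t \<Rightarrow> 'c" and Z :: "int \<Rightarrow> 'c"
  assumes datum: "tgw_datum K T m f w" and mu: "unit_matrix K m \<mu>"
    and C_algebra: "k_algebra K C"
    and eta_hom: "\<eta> \<in> ring_hom T C" and eta_lin: "\<eta> \<in> lin_map K T C"
    and Z_closed [simp]: "\<And>u. u \<in> pm m \<Longrightarrow> Z u \<in> carrier C"
    and Z_coef: "\<And>u r. u \<in> pm m \<Longrightarrow> r \<in> carrier T \<Longrightarrow> Z u \<otimes>\<^bsub>C\<^esub> \<eta> r = \<eta> (signed_auto T f u r) \<otimes>\<^bsub>C\<^esub> Z u"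
    and Z_minus_plus: "\<And>i. i \<in> {1..m} \<Longrightarrow> Z (- int i) \<otimes>\<^bsub>C\<^esub> Z (int i) = \<eta> (w i)"
    and Z_plus_minus: "\<And>i. i \<in> {1..m} \<Longrightarrow> Z (int i) \<otimes>\<^bsub>C\<^esub> Z (- int i) = \<eta> (f i (w i))"
    and Z_cross: "\<And>i j. i \<in> {1..m} \<Longrightarrow> j \<in> {1..m} \<Longrightarrow> i \<noteq> j \<Longrightarrow>
           Z (int i) \<otimes>\<^bsub>C\<^esub> Z (- int j) = \<mu> i j \<odot>\<^bsub>C\<^esub> (Z (- int j) \<otimes>\<^bsub>C\<^esub> Z (int i))"
begin

sublocale K: field K using k_algebraD(1)[OF C_algebra] .
sublocale C: ring C using k_algebraD(3)[OF C_algebra] .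
sublocale CM: module K C using k_algebraD(4)[OF C_algebra] .

lemma T_algebra: "k_algebra K T" using datum by (simp add: tgw_datum_def)

sublocale T: ring T using k_algebraD(3)[OF T_algebra] .
sublocale TM: module K T using k_algebraD(4)[OF T_algebra] .

lemma auto: "i \<in> {1..m} \<Longrightarrow> alg_auto K T (f i)" using datum by (simp add: tgw_datum_def)

sublocale commuting_bijections T m f
  using datum alg_autoD(2)[OF auto] by unfold_locales (auto simp: tgw_datum_def)

lemmas C_smult = k_algebraD(5,6)[OF C_algebra]

lemma eta_closed [simp]: "r \<in> carrier T \<Longrightarrow> \<eta> r \<in> carrier C"
  using ring_hom_closed[OF eta_hom] .

lemma eta_mult: "r \<in> carrier T \<Longrightarrow> s \<in> carrier T \<Longrightarrow> \<eta> (r \<otimes>\<^bsub>T\<^esub> s) = \<eta> r \<otimes>\<^bsub>C\<^esub> \<eta> s"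
  using ring_hom_mult[OF eta_hom] .

lemma eta_one: "\<eta> \<one>\<^bsub>T\<^esub> = \<one>\<^bsub>C\<^esub>"
  using ring_hom_one[OF eta_hom] .

lemma eta_scalar: "c \<in> carrier K \<Longrightarrow> x \<in> carrier C \<Longrightarrow> \<eta> (c \<odot>\<^bsub>T\<^esub> \<one>\<^bsub>T\<^esub>) \<otimes>\<^bsub>C\<^esub> x = c \<odot>\<^bsub>C\<^esub> x"
  using lin_mapD(3)[OF eta_lin, of c "\<one>\<^bsub>T\<^esub>"] C_smult(1)[of c "\<one>\<^bsub>C\<^esub>" x] by (simp add: eta_one)

lemma pm_nat: "u \<in> pm m \<Longrightarrow> 0 < u \<Longrightarrow> nat u \<in> {1..m}" "u \<in> pm m \<Longrightarrow> u < 0 \<Longrightarrow> nat (- u) \<in> {1..m}"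
  by (auto simp: pm_def)

lemma pm_nonzero: "u \<in> pm m \<Longrightarrow> \<not> 0 < u \<Longrightarrow> u < 0"
  by (auto simp: pm_def)

text \<open>The element \<open>loop u\<close> of the base algebra represents the product \<open>Z u Z (- u)\<close>.\<close>

definition loop :: "int \<Rightarrow> 't" where
  "loop u = (if 0 < u then f (nat u) (w (nat u)) else w (nat (- u)))"

lemma w_closed: "i \<in> {1..m} \<Longrightarrow> w i \<in> carrier T"
  using datum by (auto simp: tgw_datum_def center_def)

lemma loop_closed [simp]: "u \<in> pm m \<Longrightarrow> loop u \<in> carrier T"
  using w_closed[OF pm_index, of u] bij_apply[OF bij[OF pm_index] w_closed[OF pm_index], of u u]
  by (cases "0 < u") (simp_all add: loop_def)

lemma Z_loop: "u \<in> pm m \<Longrightarrow> Z u \<otimes>\<^bsub>C\<^esub> Z (- u) = \<eta> (loop u)"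
  using Z_plus_minus[of "nat u"] Z_minus_plus[of "nat (- u)"] pm_nat[of u] pm_nonzero[of u]
  by (cases "0 < u") (simp_all add: loop_def)

text \<open>The relations commute generators of opposite signs and different indices, in either order, because
  the structure constants are invertible.\<close>

lemma Z_swap:
  assumes "u \<in> pm m" "v \<in> pm m" "sgn v = - sgn u" "v \<noteq> - u"
  obtains c where "c \<in> carrier K" "c \<noteq> \<zero>\<^bsub>K\<^esub>" "Z u \<otimes>\<^bsub>C\<^esub> Z v = c \<odot>\<^bsub>C\<^esub> (Z v \<otimes>\<^bsub>C\<^esub> Z u)"
proof (cases "0 < u")
  case True
  then have s: "0 < u" "v < 0" using assms by (auto simp: pm_def sgn_if split: if_splits)
  note i = pm_nat(1)[OF assms(1) s(1)] pm_nat(2)[OF assms(2) s(2)]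
  have "nat u \<noteq> nat (- v)" using s assms(4) by auto
  then show thesis
    using Z_cross[OF i] s mu i that[of "\<mu> (nat u) (nat (- v))"]
    by (simp add: unit_matrix_def)
next
  case False
  then have s: "u < 0" "0 < v" using assms by (auto simp: pm_def sgn_if split: if_splits)
  note i = pm_nat(1)[OF assms(2) s(2)] pm_nat(2)[OF assms(1) s(1)]
  let ?c = "\<mu> (nat v) (nat (- u))"
  have c: "?c \<in> carrier K" "?c \<noteq> \<zero>\<^bsub>K\<^esub>"
    using i mu by (simp_all add: unit_matrix_def)
  have "nat v \<noteq> nat (- u)" using s assms(4) by auto
  then have eq: "Z v \<otimes>\<^bsub>C\<^esub> Z u = ?c \<odot>\<^bsub>C\<^esub> (Z u \<otimes>\<^bsub>C\<^esub> Z v)"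
    using Z_cross[OF i] s by simp
  have U: "?c \<in> Units K" using c K.field_Units by blast
  have "inv\<^bsub>K\<^esub> ?c \<noteq> \<zero>\<^bsub>K\<^esub>" using U K.Units_inv_Units K.field_Units by blast
  moreover have "Z u \<otimes>\<^bsub>C\<^esub> Z v = inv\<^bsub>K\<^esub> ?c \<odot>\<^bsub>C\<^esub> (Z v \<otimes>\<^bsub>C\<^esub> Z u)"
    using U c assms unfolding eq by (simp add: CM.smult_assoc1[symmetric])
  ultimately show thesis using that U by blast
qed

subsection \<open>Components of degree a signed unit vector\<close>

abbreviation "Zs us \<equiv> list_prod C (map Z us)"

lemma list_prod_closed: "set xs \<subseteq> carrier C \<Longrightarrow> list_prod C xs \<in> carrier C"
  by (induction xs) (auto simp: list_prod_simps)

lemma Zs_closed [simp]: "set us \<subseteq> pm m \<Longrightarrow> Zs us \<in> carrier C"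
  by (intro list_prod_closed) auto

lemma Zs_append: "set us \<subseteq> pm m \<Longrightarrow> set vs \<subseteq> pm m \<Longrightarrow> Zs (us @ vs) = Zs us \<otimes>\<^bsub>C\<^esub> Zs vs"
  by (induction us) (auto simp: list_prod_simps C.m_assoc)

text \<open>The word \<open>us\<close> reduces to \<open>vs\<close> if their products agree up to a coefficient on the left. Coefficients
  move through generators, so reductions may be applied inside longer words.\<close>

definition red :: "int list \<Rightarrow> int list \<Rightarrow> bool" where
  "red us vs \<longleftrightarrow> set us \<subseteq> pm m \<and> set vs \<subseteq> pm m \<and> (\<exists>r \<in> carrier T. Zs us = \<eta> r \<otimes>\<^bsub>C\<^esub> Zs vs)"

lemma red_refl: "set us \<subseteq> pm m \<Longrightarrow> red us us"
  unfolding red_def by (auto intro!: bexI[of _ "\<one>\<^bsub>T\<^esub>"] simp: eta_one)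

lemma red_trans [trans]:
  assumes "red us vs" "red vs ws" shows "red us ws"
proof -
  obtain r s where rs: "r \<in> carrier T" "s \<in> carrier T" "Zs us = \<eta> r \<otimes>\<^bsub>C\<^esub> Zs vs" "Zs vs = \<eta> s \<otimes>\<^bsub>C\<^esub> Zs ws"
    "set us \<subseteq> pm m" "set ws \<subseteq> pm m"
    using assms by (auto simp: red_def)
  then have "Zs us = \<eta> (r \<otimes>\<^bsub>T\<^esub> s) \<otimes>\<^bsub>C\<^esub> Zs ws" by (simp add: eta_mult C.m_assoc)
  then show ?thesis using rs unfolding red_def by (auto intro: T.m_closed)
qed

lemma red_Cons:
  assumes "red us vs" "u \<in> pm m" shows "red (u # us) (u # vs)"
proof -
  obtain r where r: "r \<in> carrier T" "Zs us = \<eta> r \<otimes>\<^bsub>C\<^esub> Zs vs" "set us \<subseteq> pm m" "set vs \<subseteq> pm m"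
    using assms by (auto simp: red_def)
  note sc = signed_auto_closed[OF assms(2) r(1)]
  have "Zs (u # us) = (Z u \<otimes>\<^bsub>C\<^esub> \<eta> r) \<otimes>\<^bsub>C\<^esub> Zs vs"
    using r assms by (simp add: list_prod_simps C.m_assoc)
  also have "\<dots> = \<eta> (signed_auto T f u r) \<otimes>\<^bsub>C\<^esub> Zs (u # vs)"
    using r assms sc by (simp add: list_prod_simps C.m_assoc Z_coef)
  finally show ?thesis using r assms sc unfolding red_def by auto
qed

lemma red_append:
  assumes "red us vs" "set ws \<subseteq> pm m" "set xs \<subseteq> pm m" shows "red (ws @ us @ xs) (ws @ vs @ xs)"
proof -
  obtain r where r: "r \<in> carrier T" "Zs us = \<eta> r \<otimes>\<^bsub>C\<^esub> Zs vs" "set us \<subseteq> pm m" "set vs \<subseteq> pm m"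
    using assms by (auto simp: red_def)
  then have "red (us @ xs) (vs @ xs)"
    unfolding red_def using assms by (auto simp: Zs_append C.m_assoc simp del: map_append intro!: bexI[of _ r])
  with assms(2) show ?thesis by (induction ws) (auto intro: red_Cons)
qed

lemma red_swap:
  assumes "u \<in> pm m" "v \<in> pm m" "sgn v = - sgn u" "v \<noteq> - u"
  shows "red [u, v] [v, u]"
proof -
  obtain c where "c \<in> carrier K" "Z u \<otimes>\<^bsub>C\<^esub> Z v = c \<odot>\<^bsub>C\<^esub> (Z v \<otimes>\<^bsub>C\<^esub> Z u)" using Z_swap[OF assms] by metis
  then show ?thesis
    unfolding red_def using assms
    by (auto simp: list_prod_simps eta_scalar intro!: bexI[of _ "c \<odot>\<^bsub>T\<^esub> \<one>\<^bsub>T\<^esub>"])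
qed

lemma red_cancel: "u \<in> pm m \<Longrightarrow> red [u, - u] []"
  unfolding red_def using pm_uminus[of u] by (auto simp: list_prod_simps Z_loop intro!: bexI[of _ "loop u"])

text \<open>A letter passes through letters of the opposite sign until it meets its own inverse letter
  \<open>- u\<close>; there the pair collapses to a coefficient (\<open>red_meet\<close>). Letters of equal sign need not
  commute, so only such moves are available.\<close>

lemma red_pass:
  assumes "u \<in> pm m" "set us \<subseteq> pm m" "\<forall>v\<in>set us. sgn v = - sgn u" "- u \<notin> set us"
  shows "red (u # us) (us @ [u])"
  using assms
proof (induction us)
  case Nil
  then show ?case by (simp add: red_refl)
next
  case (Cons v us)
  have "red ([] @ [u, v] @ us) ([] @ [v, u] @ us)"
    using Cons.prems by (intro red_append red_swap) auto
  moreover have "red (v # u # us) (v # us @ [u])"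
    using Cons by (intro red_Cons Cons.IH) auto
  ultimately show ?case using red_trans by force
qed

lemma red_meet:
  assumes "u \<in> pm m" "set us \<subseteq> pm m" "\<forall>v\<in>set us. sgn v = - sgn u" "- u \<in> set us"
  obtains us' where "red (u # us) us'" "set us' \<subseteq> set us" "seq_deg us' = seq_deg (u # us)"
proof -
  obtain xs ys where us: "us = xs @ - u # ys" "- u \<notin> set xs" using split_list_first[OF assms(4)] by auto
  have "red ([] @ (u # xs) @ - u # ys) ([] @ (xs @ [u]) @ - u # ys)"
    using assms us by (intro red_append red_pass) auto
  also have "red ([] @ (xs @ [u]) @ - u # ys) (xs @ ys)"
    using red_append[OF red_cancel[OF assms(1)], of xs ys] assms us by simp
  finally have "red (u # us) (xs @ ys)" using us by simp
  then show thesis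
    using us by (intro that[of "xs @ ys"]) (auto simp: seq_deg_append seq_deg_Cons signed_unit_uminus fun_eq_iff)
qed

text \<open>Every word reduces to one in which all letters of one sign precede all letters of the other sign.
  The sign \<open>s\<close> that comes last is a parameter: \<open>red_sorted_unit\<close> needs it to be the sign of the
  degree.\<close>

lemma red_sort:
  assumes "set us \<subseteq> pm m" "s = 1 \<or> s = -1"
  shows "\<exists>ns ps. red us (ns @ ps) \<and> (\<forall>v\<in>set ns. sgn v = - s) \<and> (\<forall>v\<in>set ps. sgn v = s) \<and>
           seq_deg (ns @ ps) = seq_deg us"
  using assms(1)
proof (induction us)
  case Nil
  then show ?case by (auto intro!: exI[of _ "[]"] red_refl)
next
  case (Cons u us)
  then obtain ns ps where IH: "red us (ns @ ps)" "\<forall>v\<in>set ns. sgn v = - s" "\<forall>v\<in>set ps. sgn v = s"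
    "seq_deg (ns @ ps) = seq_deg us" by auto
  have u: "u \<in> pm m" using Cons by simp
  have l: "set ns \<subseteq> pm m" "set ps \<subseteq> pm m" using IH(1) by (auto simp: red_def)
  note r = red_Cons[OF IH(1) u]
  note deg = IH(4)[unfolded seq_deg_append]
  consider "sgn u = - s" | "sgn u = s" "- u \<notin> set ns" | "sgn u = s" "- u \<in> set ns"
    using pm_sgn[OF u] assms(2) by auto
  then show ?case
  proof cases
    case 1
    then show ?thesis using r IH deg
      by (intro exI[of _ "u # ns"] exI[of _ ps]) (auto simp: seq_deg_Cons seq_deg_append)
  next
    case 2
    have "red ([] @ (u # ns) @ ps) ([] @ (ns @ [u]) @ ps)"
      using 2 u l IH by (intro red_append red_pass) auto
    then have "red (u # us) (ns @ (u # ps))" using red_trans[OF r] by simp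
    then show ?thesis using 2 IH deg
      by (intro exI[of _ ns] exI[of _ "u # ps"])
        (auto simp: seq_deg_Cons seq_deg_append fun_eq_iff algebra_simps)
  next
    case 3
    obtain ns' where ns': "red (u # ns) ns'" "set ns' \<subseteq> set ns" "seq_deg ns' = seq_deg (u # ns)"
      using red_meet[OF u l(1)] 3 IH by auto
    have "red ([] @ (u # ns) @ ps) ([] @ ns' @ ps)" by (intro red_append ns' l) auto
    then have "red (u # us) (ns' @ ps)" using red_trans[OF r] by simp
    then show ?thesis using IH deg ns'
      by (intro exI[of _ ns'] exI[of _ ps]) (auto simp: seq_deg_Cons seq_deg_append fun_eq_iff)
  qed
qed

lemma seq_deg_same_sign:
  assumes "\<forall>v\<in>set us. sgn v = s" "s = 1 \<or> s = -1"
  shows "0 \<le> s * seq_deg us i" "v \<in> set us \<Longrightarrow> 1 \<le> s * seq_deg us (nat \<bar>v\<bar>)"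
    "seq_deg us i \<noteq> 0 \<Longrightarrow> \<exists>v\<in>set us. nat \<bar>v\<bar> = i"
proof -
  have *: "\<forall>v\<in>set us. sgn v = s \<Longrightarrow> 0 \<le> s * seq_deg us i" for us i
    using assms(2) by (induction us) (auto simp: seq_deg_Cons seq_deg_Nil signed_unit_def algebra_simps)
  from * assms show "0 \<le> s * seq_deg us i" by simp
  show "1 \<le> s * seq_deg us (nat \<bar>v\<bar>)" if "v \<in> set us"
    using assms(1) that
  proof (induction us)
    case (Cons u us)
    then show ?case
      using *[of us "nat \<bar>v\<bar>"] assms(2) by (auto simp: seq_deg_Cons signed_unit_def algebra_simps)
  qed simp
  show "\<exists>v\<in>set us. nat \<bar>v\<bar> = i" if "seq_deg us i \<noteq> 0"
    using that by (induction us) (auto simp: seq_deg_Cons seq_deg_Nil signed_unit_def split: if_splits)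
qed

text \<open>If the degree of a sorted word is a unit vector of the sign that comes last, then every letter \<open>x\<close>
  of the first part has its inverse in the second part, by counting degrees at \<open>\<bar>x\<bar>\<close>. So the last letter
  of the first part can be moved to the right and cancelled, and repeating this leaves one letter.\<close>

lemma red_sorted_unit:
  assumes "set ns \<subseteq> pm m" "set ps \<subseteq> pm m" "u \<in> pm m"
    "\<forall>v\<in>set ns. sgn v = - sgn u" "\<forall>v\<in>set ps. sgn v = sgn u" "seq_deg (ns @ ps) = signed_unit u"
  shows "red (ns @ ps) [u]"
  using assms(1,2,4-6)
proof (induction ns arbitrary: ps rule: rev_induct)
  case Nil
  note s = pm_sgn[OF assms(3)]
  have u1: "signed_unit u (nat \<bar>v\<bar>) = (if nat \<bar>v\<bar> = nat \<bar>u\<bar> then sgn u else 0)" for v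
    by (simp add: signed_unit_def)
  have abs_eq: "v = u" if "nat \<bar>v\<bar> = nat \<bar>u\<bar>" "sgn v = sgn u" for v
    using that by (auto simp: sgn_if split: if_splits)
  have "seq_deg ps (nat \<bar>u\<bar>) \<noteq> 0" using Nil u1[of u] s by auto
  then obtain y ys where ps: "ps = y # ys" by (cases ps) (auto simp: seq_deg_Nil)
  have "1 \<le> sgn u * seq_deg ps (nat \<bar>y\<bar>)"
    using seq_deg_same_sign(2)[of ps "sgn u" y] Nil s ps by auto
  then have "nat \<bar>y\<bar> = nat \<bar>u\<bar>" using Nil u1[of y] by (auto split: if_splits)
  moreover have "sgn y = sgn u" using Nil.prems(4) ps by simp
  ultimately have y: "y = u" by (rule abs_eq)
  have "(\<lambda>i. seq_deg ys i + signed_unit u i) = signed_unit u"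
    using Nil.prems(5) by (simp add: ps y seq_deg_Cons)
  then have ys0: "seq_deg ys i = 0" for i by (simp add: fun_eq_iff)
  have "ys = []"
  proof (rule ccontr)
    assume "ys \<noteq> []"
    then obtain z where "z \<in> set ys" by (meson list.set_sel(1))
    then show False using seq_deg_same_sign(2)[of ys "sgn u" z] Nil.prems(4) s ps ys0 by simp
  qed
  then show ?case using ps y assms(3) by (auto intro: red_refl)
next
  case (snoc x ns)
  note s = pm_sgn[OF assms(3)]
  have x: "x \<in> pm m" "sgn x = - sgn u" using snoc by auto
  have "1 \<le> - sgn u * seq_deg (ns @ [x]) (nat \<bar>x\<bar>)"
    using snoc.prems(3) s by (intro seq_deg_same_sign(2)) auto
  moreover have "seq_deg (ns @ [x]) (nat \<bar>x\<bar>) + seq_deg ps (nat \<bar>x\<bar>) = signed_unit u (nat \<bar>x\<bar>)"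
    using fun_cong[OF snoc.prems(5), of "nat \<bar>x\<bar>"] by (simp only: seq_deg_append)
  moreover have "0 \<le> sgn u * signed_unit u (nat \<bar>x\<bar>)" using s by (auto simp: signed_unit_def)
  ultimately have "seq_deg ps (nat \<bar>x\<bar>) \<noteq> 0" using s by (elim disjE) simp_all
  then obtain v where v: "v \<in> set ps" "nat \<bar>v\<bar> = nat \<bar>x\<bar>"
    using seq_deg_same_sign(3)[OF snoc.prems(4) s] by blast
  have "sgn v = sgn u" using v snoc.prems(4) by simp
  with v(2) x(2) have "v = - x" by (auto simp: sgn_if split: if_splits)
  with v have "- x \<in> set ps" by simp
  then obtain ps' where ps': "red (x # ps) ps'" "set ps' \<subseteq> set ps" "seq_deg ps' = seq_deg (x # ps)"
    using red_meet[OF x(1), of ps] snoc.prems x(2) by auto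
  have ns: "set ns \<subseteq> pm m" using snoc.prems by simp
  have "red (ns @ (x # ps) @ []) (ns @ ps' @ [])" by (intro red_append ps' ns) simp
  moreover have "red (ns @ ps') [u]"
  proof (rule snoc.IH)
    have "seq_deg (ns @ ps') = seq_deg ((ns @ [x]) @ ps)"
      by (simp add: seq_deg_append ps'(3) seq_deg_Cons seq_deg_Nil algebra_simps)
    then show "seq_deg (ns @ ps') = signed_unit u" using snoc.prems(5) by simp
  qed (use snoc.prems ps'(2) in auto)
  ultimately show ?case using red_trans by simp
qed

primrec letter :: "'t tgw_gen \<Rightarrow> 'c" where
  "letter (Coef r) = \<eta> r"
| "letter (Gen u) = Z u"

lemma word_eq_coef_mult:
  assumes "ws \<in> lists (tgw_gens T m)"
  shows "\<exists>r \<in> carrier T. \<exists>us. set us \<subseteq> pm m \<and> list_prod C (map letter ws) = \<eta> r \<otimes>\<^bsub>C\<^esub> Zs us \<and> seq_deg us = word_deg ws"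
  using assms
proof (induction rule: lists.induct)
  case Nil
  then show ?case
    by (auto simp: list_prod_simps eta_one word_deg_def seq_deg_def intro!: bexI[of _ "\<one>\<^bsub>T\<^esub>"] exI[of _ "[]"])
next
  case (Cons g ws)
  from Cons.IH obtain r us where IH: "r \<in> carrier T" "set us \<subseteq> pm m"
    "list_prod C (map letter ws) = \<eta> r \<otimes>\<^bsub>C\<^esub> Zs us" "seq_deg us = word_deg ws" by auto
  show ?case
  proof (cases g)
    case (Coef r')
    then have r': "r' \<in> carrier T" using Cons.hyps by (auto simp: tgw_gens_def)
    then show ?thesis using IH Coef
      by (auto simp: list_prod_simps eta_mult C.m_assoc word_deg_def intro!: bexI[of _ "r' \<otimes>\<^bsub>T\<^esub> r"] exI[of _ us])
  next
    case (Gen u)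
    then have u: "u \<in> pm m" using Cons.hyps by (auto simp: tgw_gens_def)
    note sc = signed_auto_closed[OF u IH(1)]
    have "Z u \<otimes>\<^bsub>C\<^esub> (\<eta> r \<otimes>\<^bsub>C\<^esub> Zs us) = (Z u \<otimes>\<^bsub>C\<^esub> \<eta> r) \<otimes>\<^bsub>C\<^esub> Zs us" using IH u by (simp add: C.m_assoc)
    also have "\<dots> = \<eta> (signed_auto T f u r) \<otimes>\<^bsub>C\<^esub> Zs (u # us)"
      using IH u sc by (simp add: Z_coef C.m_assoc list_prod_simps)
    finally show ?thesis using IH Gen u sc
      by (auto simp: list_prod_simps word_deg_def seq_deg_Cons fun_eq_iff intro!: bexI[of _ "signed_auto T f u r"] exI[of _ "u # us"])
  qed
qed

text \<open>Whatever cancels in a word leaves only coefficients behind, so a homogeneous component whose degree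
  is a signed unit vector is no larger than the set of multiples of one generator.\<close>

lemma word_of_unit_degree:
  assumes "ws \<in> lists (tgw_gens T m)" "u \<in> pm m" "word_deg ws = signed_unit u"
  shows "\<exists>r \<in> carrier T. list_prod C (map letter ws) = \<eta> r \<otimes>\<^bsub>C\<^esub> Z u"
proof -
  obtain r us where us: "r \<in> carrier T" "set us \<subseteq> pm m"
    "list_prod C (map letter ws) = \<eta> r \<otimes>\<^bsub>C\<^esub> Zs us" "seq_deg us = signed_unit u"
    using word_eq_coef_mult[OF assms(1)] assms(3) by auto
  obtain ns ps where nsps: "red us (ns @ ps)" "\<forall>v\<in>set ns. sgn v = - sgn u" "\<forall>v\<in>set ps. sgn v = sgn u"
    "seq_deg (ns @ ps) = seq_deg us"
    using red_sort[OF us(2) pm_sgn[OF assms(2)]] by blast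
  have "red (ns @ ps) [u]"
    using nsps us assms(2) by (intro red_sorted_unit) (auto simp: red_def)
  then have "red us [u]" using nsps(1) red_trans by blast
  then obtain r' where "r' \<in> carrier T" "Zs us = \<eta> r' \<otimes>\<^bsub>C\<^esub> Z u"
    using assms(2) by (auto simp: red_def list_prod_simps)
  then show ?thesis using us assms(2)
    by (auto simp: eta_mult C.m_assoc intro!: bexI[of _ "r \<otimes>\<^bsub>T\<^esub> r'"])
qed

subsection \<open>Moving coefficients through words\<close>

lemma Zs_coef:
  assumes "set us \<subseteq> pm m" "x \<in> carrier T"
  shows "Zs us \<otimes>\<^bsub>C\<^esub> \<eta> x = \<eta> (multi_pow T m f (seq_deg us) x) \<otimes>\<^bsub>C\<^esub> Zs us"
  using assms
proof (induction us)
  case Nil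
  then show ?case by (simp add: list_prod_simps seq_deg_Nil multi_pow_zero)
next
  case (Cons u us)
  let ?y = "multi_pow T m f (seq_deg us) x"
  have y: "?y \<in> carrier T" using Cons.prems by (simp add: multi_pow_closed)
  have u: "u \<in> pm m" "set us \<subseteq> pm m" using Cons.prems by auto
  have "multi_pow T m f (seq_deg (u # us)) x = signed_auto T f u ?y"
    unfolding seq_deg_Cons using u Cons.prems pm_index[of u] by (intro multi_pow_step) auto
  moreover have "Zs (u # us) \<otimes>\<^bsub>C\<^esub> \<eta> x = (Z u \<otimes>\<^bsub>C\<^esub> \<eta> ?y) \<otimes>\<^bsub>C\<^esub> Zs us"
    using Cons u y by (simp add: list_prod_simps C.m_assoc)
  ultimately show ?case
    using u y signed_auto_closed[OF u(1) y] by (simp add: list_prod_simps C.m_assoc Z_coef)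
qed

lemma Zs_coef_inverse:
  assumes "set us \<subseteq> pm m" "x \<in> carrier T"
  shows "Zs us \<otimes>\<^bsub>C\<^esub> \<eta> (multi_pow T m f (\<lambda>j. - seq_deg us j) x) = \<eta> x \<otimes>\<^bsub>C\<^esub> Zs us"
  using assms
proof (induction us arbitrary: x)
  case Nil
  then show ?case by (simp add: list_prod_simps seq_deg_Nil multi_pow_zero)
next
  case (Cons u us)
  let ?y = "signed_auto T f (- u) x"
  have u: "u \<in> pm m" "set us \<subseteq> pm m" using Cons.prems by auto
  have y: "?y \<in> carrier T" using Cons.prems u pm_uminus by (intro signed_auto_closed) auto
  have "(\<lambda>j. - seq_deg (u # us) j) = (\<lambda>j. - seq_deg us j + signed_unit (- u) j)"
    by (simp add: seq_deg_Cons signed_unit_uminus)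
  then have "multi_pow T m f (\<lambda>j. - seq_deg (u # us) j) x = multi_pow T m f (\<lambda>j. - seq_deg us j) ?y"
    using multi_pow_step'[OF pm_uminus[OF u(1)] Cons.prems(2), of "\<lambda>j. - seq_deg us j"] by (simp only:)
  then have "Zs (u # us) \<otimes>\<^bsub>C\<^esub> \<eta> (multi_pow T m f (\<lambda>j. - seq_deg (u # us) j) x)
      = Z u \<otimes>\<^bsub>C\<^esub> (\<eta> ?y \<otimes>\<^bsub>C\<^esub> Zs us)"
    using Cons.IH[OF u(2) y] u y by (simp add: list_prod_simps C.m_assoc multi_pow_closed)
  also have "\<dots> = (Z u \<otimes>\<^bsub>C\<^esub> \<eta> ?y) \<otimes>\<^bsub>C\<^esub> Zs us" using u y by (simp add: C.m_assoc)
  also have "\<dots> = \<eta> x \<otimes>\<^bsub>C\<^esub> Zs (u # us)"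
    using u y Cons.prems by (simp add: Z_coef signed_auto_uminus list_prod_simps C.m_assoc)
  finally show ?case .
qed

end

section \<open>Twisted generalized Weyl algebras\<close>

lemma tgw_rep_image:
  assumes rep: "tgw_rep K T m f w \<mu> A \<eta> Z"
    and \<phi>: "\<phi> \<in> ring_hom A C" "\<phi> \<in> lin_map K A C" "\<phi> ` carrier A = carrier C" "\<phi> \<zero>\<^bsub>A\<^esub> = \<zero>\<^bsub>C\<^esub>"
    and \<eta>': "\<And>r. r \<in> carrier T \<Longrightarrow> \<phi> (\<eta> r) = \<eta>' r" and Z': "\<And>u. u \<in> pm m \<Longrightarrow> \<phi> (Z u) = Z' u"
  shows "tgw_rep K T m f w \<mu> C \<eta>' Z'"
proof -
  interpret tgw_rep K T m f w \<mu> A \<eta> Z by (rule rep)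
  note \<phi>D = ring_hom_closed[OF \<phi>(1)] ring_hom_mult[OF \<phi>(1)] ring_hom_add[OF \<phi>(1)] ring_hom_one[OF \<phi>(1)]
    lin_mapD(3)[OF \<phi>(2)]
  note sym = \<eta>'[symmetric] Z'[symmetric] \<phi>D(2-5)[symmetric] eta_mult[symmetric]
  show ?thesis
  proof
    show "k_algebra K C" by (rule k_algebra_image[OF C_algebra \<phi>(2,1,3,4)])
    show "\<eta>' \<in> ring_hom T C"
      by (rule ring_hom_memI) (simp_all add: sym \<phi>D(1) eta_one ring_hom_add[OF eta_hom])
    show "\<eta>' \<in> lin_map K T C"
      unfolding lin_map_def by (auto simp: sym \<phi>D(1) lin_mapD(2,3)[OF eta_lin])
    fix u assume u: "u \<in> pm m"
    then show "Z' u \<in> carrier C" by (simp add: sym \<phi>D(1))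
    fix r assume r: "r \<in> carrier T"
    show "Z' u \<otimes>\<^bsub>C\<^esub> \<eta>' r = \<eta>' (signed_auto T f u r) \<otimes>\<^bsub>C\<^esub> Z' u"
      using u r signed_auto_closed[OF u r] by (simp add: sym Z_coef)
  next
    fix i assume i: "i \<in> {1..m}"
    then have pm: "int i \<in> pm m" "- int i \<in> pm m" by (auto simp: pm_def)
    show "Z' (- int i) \<otimes>\<^bsub>C\<^esub> Z' (int i) = \<eta>' (w i)"
      using pm i w_closed[OF i] by (simp add: sym Z_minus_plus)
    show "Z' (int i) \<otimes>\<^bsub>C\<^esub> Z' (- int i) = \<eta>' (f i (w i))"
      using pm i w_closed[OF i] bij_apply[OF bij[OF i]] by (simp add: sym Z_plus_minus)
    fix j assume j: "j \<in> {1..m}" "i \<noteq> j"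
    then have pm': "int j \<in> pm m" "- int j \<in> pm m" by (auto simp: pm_def)
    have "\<mu> i j \<in> carrier K" using mu i j by (simp add: unit_matrix_def)
    then show "Z' (int i) \<otimes>\<^bsub>C\<^esub> Z' (- int j) = \<mu> i j \<odot>\<^bsub>C\<^esub> (Z' (- int j) \<otimes>\<^bsub>C\<^esub> Z' (int i))"
      using pm pm' Z_cross[OF i j] by (simp add: sym)
  qed (rule datum, rule mu)
qed

locale tgw =
  fixes K :: "'k ring" and T :: "('k, 't) module" and m f w \<mu>
  assumes tgw_dat: "tgw_datum K T m f w" and tgw_mu: "unit_matrix K m \<mu>"
begin

abbreviation "W \<equiv> tgw_free K T m"
abbreviation "CC \<equiv> tgwc K T m f w \<mu>"
abbreviation "AA \<equiv> tgwa K T m f w \<mu>"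

lemma T_alg: "k_algebra K T" using tgw_dat by (simp add: tgw_datum_def)

lemma K_field: "field K" using k_algebraD(1)[OF T_alg] .

lemma K_cring: "cring K" using k_algebraD(2)[OF T_alg] .

lemma W_algebra: "k_algebra K W" by (rule free_algebra_algebra[OF K_field])

sublocale W: ring W using k_algebraD(3)[OF W_algebra] .
sublocale WM: module K W using k_algebraD(4)[OF W_algebra] .
sublocale T: ring T using k_algebraD(3)[OF T_alg] .
sublocale TM: module K T using k_algebraD(4)[OF T_alg] .

lemma f_auto: "i \<in> {1..m} \<Longrightarrow> alg_auto K T (f i)"
  using tgw_dat by (simp add: tgw_datum_def)

sublocale commuting_bijections T m f
  using tgw_dat alg_autoD(2)[OF f_auto] by unfold_locales (auto simp: tgw_datum_def)

lemma word_closed [simp]: "ws \<in> lists (tgw_gens T m) \<Longrightarrow> single K ws \<in> carrier W"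
  using single_closed[OF K_cring] by (simp only: free_algebra_simps(1))

lemma Coef_gen [simp]: "Coef r \<in> tgw_gens T m \<longleftrightarrow> r \<in> carrier T"
  and Gen_gen [simp]: "Gen u \<in> tgw_gens T m \<longleftrightarrow> u \<in> pm m"
  by (auto simp: tgw_gens_def)

lemma int_pm [simp]: "i \<in> {1..m} \<Longrightarrow> int i \<in> pm m" "i \<in> {1..m} \<Longrightarrow> - int i \<in> pm m"
  by (auto simp: pm_def)

lemma w_closed': "i \<in> {1..m} \<Longrightarrow> w i \<in> carrier T"
  using tgw_dat by (auto simp: tgw_datum_def center_def)

lemma mu_closed: "i \<in> {1..m} \<Longrightarrow> j \<in> {1..m} \<Longrightarrow> \<mu> i j \<in> carrier K"
  using tgw_mu by (simp add: unit_matrix_def)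

lemma tgwc_rels_subset: "tgwc_rels K T m f w \<mu> \<subseteq> carrier W"
proof
  fix x assume "x \<in> tgwc_rels K T m f w \<mu>"
  then show "x \<in> carrier W"
    unfolding tgwc_rels_def Let_def Un_iff mem_Collect_eq singleton_iff
    by (elim disjE exE conjE; hypsubst;
        intro W.minus_closed W.add.m_closed WM.smult_closed W.one_closed word_closed lists.intros)
      (simp_all add: mu_closed w_closed' signed_auto_closed bij_apply[OF bij] del: atLeastAtMost_iff)
qed

lemma tgwc_null_ideal: "ideal (tgwc_null K T m f w \<mu>) W"
  unfolding tgwc_null_def by (rule W.genideal_ideal[OF tgwc_rels_subset])

lemma CC_algebra: "k_algebra K CC"
  unfolding tgwc_def by (rule quot_algebra[OF W_algebra tgwc_null_ideal])

sublocale CC: ring CC using k_algebraD(3)[OF CC_algebra] .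

lemma tgwa_null_ideal: "ideal (tgwa_null K T m f w \<mu>) CC"
proof -
  have "J \<subseteq> carrier CC" if "tgwc_graded_ideal K T m f w \<mu> J" for J
    using that additive_subgroup.a_subset[OF ideal.axioms(1)] unfolding tgwc_graded_ideal_def by blast
  then show ?thesis
    unfolding tgwa_null_def by (intro CC.genideal_ideal) blast
qed

lemma AA_algebra: "k_algebra K AA"
  unfolding tgwa_def by (rule quot_algebra[OF CC_algebra tgwa_null_ideal])

sublocale AA: ring AA using k_algebraD(3)[OF AA_algebra] .
sublocale AM: module K AA using k_algebraD(4)[OF AA_algebra] .

abbreviation "pC p \<equiv> tgwc_null K T m f w \<mu> +>\<^bsub>W\<^esub> p"
abbreviation "pA \<equiv> tgwa_proj K T m f w \<mu>"

lemma pC_hom: "pC \<in> ring_hom W CC" "pC \<in> lin_map K W CC"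
  unfolding tgwc_def
  using quot_proj_hom[OF W_algebra tgwc_null_ideal]
    quot_proj_linear[OF k_algebraD(4)[OF W_algebra] k_algebra_ideal_submodule[OF W_algebra tgwc_null_ideal]] .

lemma pA_hom: "pA \<in> ring_hom CC AA" "pA \<in> lin_map K CC AA"
  unfolding tgwa_def tgwa_proj_def[abs_def]
  using quot_proj_hom[OF CC_algebra tgwa_null_ideal]
    quot_proj_linear[OF k_algebraD(4)[OF CC_algebra] k_algebra_ideal_submodule[OF CC_algebra tgwa_null_ideal]] .

definition free_proj where "free_proj p = pA (pC p)"

lemma free_proj_hom: "free_proj \<in> ring_hom W AA" and free_proj_lin: "free_proj \<in> lin_map K W AA"
  using ring_hom_trans[OF pC_hom(1) pA_hom(1)] lin_map_comp[OF pC_hom(2) pA_hom(2)]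
  by (simp_all add: free_proj_def[abs_def] comp_def)

lemma free_proj_rel:
  assumes "p \<ominus>\<^bsub>W\<^esub> q \<in> tgwc_rels K T m f w \<mu>" "p \<in> carrier W" "q \<in> carrier W"
  shows "free_proj p = free_proj q"
proof -
  have "p \<ominus>\<^bsub>W\<^esub> q \<in> tgwc_null K T m f w \<mu>"
    using assms(1) W.genideal_self[OF tgwc_rels_subset] unfolding tgwc_null_def by blast
  then have "pC p = pC q"
    using quot_eq_iff[OF k_algebraD(4)[OF W_algebra] k_algebra_ideal_submodule[OF W_algebra tgwc_null_ideal]] assms
    by simp
  then show ?thesis by (simp add: free_proj_def)
qed

lemma free_proj_append:
  "us \<in> lists (tgw_gens T m) \<Longrightarrow> vs \<in> lists (tgw_gens T m) \<Longrightarrow>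
    free_proj (single K us) \<otimes>\<^bsub>AA\<^esub> free_proj (single K vs) = free_proj (single K (us @ vs))"
  using ring_hom_mult[OF free_proj_hom, of "single K us" "single K vs"] single_append[OF K_field, of "tgw_gens T m" us vs]
  by simp

lemma coef_P: "tgwa_coef K T m f w \<mu> r = free_proj (single K [Coef r])"
  and gen_P: "tgwa_gen K T m f w \<mu> u = free_proj (single K [Gen u])"
  by (simp_all add: free_proj_def tgwa_coef_def tgwa_gen_def tgwc_word_def)

lemma tgwa_rep: "tgw_rep K T m f w \<mu> AA (tgwa_coef K T m f w \<mu>) (tgwa_gen K T m f w \<mu>)"
proof -
  note PD = lin_mapD[OF free_proj_lin]
  note app = free_proj_append[of "[_]" "[_]", simplified]
  have word1: "single K [x] \<in> carrier W" if "x \<in> tgw_gens T m" for x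
    using that by (auto intro!: word_closed)
  have word2: "single K [x, y] \<in> carrier W" if "x \<in> tgw_gens T m" "y \<in> tgw_gens T m" for x y
    using that by (auto intro!: word_closed)
  note rels = tgwc_rels_def Let_def Un_iff mem_Collect_eq
  show ?thesis
  proof
    show "tgwa_coef K T m f w \<mu> \<in> ring_hom T AA"
    proof (rule ring_hom_memI)
      fix r s assume rs: "r \<in> carrier T" "s \<in> carrier T"
      then show "tgwa_coef K T m f w \<mu> r \<in> carrier AA" unfolding coef_P by (intro PD(1) word1) simp_all
      have "free_proj (single K [Coef (r \<otimes>\<^bsub>T\<^esub> s)]) = free_proj (single K [Coef r, Coef s])"
        using rs by (intro free_proj_rel word1 word2) (unfold rels, blast, simp_all)
      then show "tgwa_coef K T m f w \<mu> (r \<otimes>\<^bsub>T\<^esub> s) = tgwa_coef K T m f w \<mu> r \<otimes>\<^bsub>AA\<^esub> tgwa_coef K T m f w \<mu> s"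
        using rs by (simp add: coef_P app)
      have "free_proj (single K [Coef (r \<oplus>\<^bsub>T\<^esub> s)]) = free_proj (single K [Coef r] \<oplus>\<^bsub>W\<^esub> single K [Coef s])"
        using rs by (intro free_proj_rel W.add.m_closed word1) (unfold rels, blast, simp_all)
      then show "tgwa_coef K T m f w \<mu> (r \<oplus>\<^bsub>T\<^esub> s) = tgwa_coef K T m f w \<mu> r \<oplus>\<^bsub>AA\<^esub> tgwa_coef K T m f w \<mu> s"
        using rs PD(2)[of "single K [Coef r]" "single K [Coef s]"] by (simp add: coef_P word1)
    next
      have "free_proj (single K [Coef \<one>\<^bsub>T\<^esub>]) = free_proj \<one>\<^bsub>W\<^esub>"
        by (intro free_proj_rel W.one_closed word1) (unfold rels, blast, simp_all)
      then show "tgwa_coef K T m f w \<mu> \<one>\<^bsub>T\<^esub> = \<one>\<^bsub>AA\<^esub>" using ring_hom_one[OF free_proj_hom] by (simp add: coef_P)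
    qed
    then have h: "tgwa_coef K T m f w \<mu> \<in> ring_hom T AA" .
    have "tgwa_coef K T m f w \<mu> (c \<odot>\<^bsub>T\<^esub> r) = c \<odot>\<^bsub>AA\<^esub> tgwa_coef K T m f w \<mu> r"
      if cr: "c \<in> carrier K" "r \<in> carrier T" for c r
    proof -
      have "free_proj (single K [Coef (c \<odot>\<^bsub>T\<^esub> r)]) = free_proj (c \<odot>\<^bsub>W\<^esub> single K [Coef r])"
        using cr by (intro free_proj_rel WM.smult_closed word1) (unfold rels, blast, simp_all)
      then show ?thesis using cr PD(3)[of c "single K [Coef r]"] by (simp add: coef_P word1)
    qed
    then show "tgwa_coef K T m f w \<mu> \<in> lin_map K T AA"
      using ring_hom_closed[OF h] ring_hom_add[OF h] unfolding lin_map_def by auto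
    fix u assume u: "u \<in> pm m"
    then show "tgwa_gen K T m f w \<mu> u \<in> carrier AA" unfolding gen_P by (intro PD(1) word1) simp_all
    fix r assume r: "r \<in> carrier T"
    note sc = signed_auto_closed[OF u r]
    have "free_proj (single K [Gen u, Coef r]) = free_proj (single K [Coef (signed_auto T f u r), Gen u])"
      using u r sc by (intro free_proj_rel word1 word2) (unfold rels, blast, simp_all)
    then show "tgwa_gen K T m f w \<mu> u \<otimes>\<^bsub>AA\<^esub> tgwa_coef K T m f w \<mu> r
        = tgwa_coef K T m f w \<mu> (signed_auto T f u r) \<otimes>\<^bsub>AA\<^esub> tgwa_gen K T m f w \<mu> u"
      using u r sc by (simp add: coef_P gen_P app)
  next
    fix i assume i: "i \<in> {1..m}"
    note pm = int_pm[OF i]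
    have fw: "f i (w i) \<in> carrier T" by (rule bij_apply[OF bij[OF i] w_closed'[OF i]])
    have "free_proj (single K [Gen (- int i), Gen (int i)]) = free_proj (single K [Coef (w i)])"
      using i pm w_closed'[OF i] by (intro free_proj_rel word1 word2) (unfold rels, blast, simp_all)
    then show "tgwa_gen K T m f w \<mu> (- int i) \<otimes>\<^bsub>AA\<^esub> tgwa_gen K T m f w \<mu> (int i) = tgwa_coef K T m f w \<mu> (w i)"
      using pm by (simp add: coef_P gen_P app)
    have "free_proj (single K [Gen (int i), Gen (- int i)]) = free_proj (single K [Coef (f i (w i))])"
      using i pm fw by (intro free_proj_rel word1 word2) (unfold rels, blast, simp_all)
    then show "tgwa_gen K T m f w \<mu> (int i) \<otimes>\<^bsub>AA\<^esub> tgwa_gen K T m f w \<mu> (- int i) = tgwa_coef K T m f w \<mu> (f i (w i))"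
      using pm by (simp add: coef_P gen_P app)
    fix j assume j: "j \<in> {1..m}" "i \<noteq> j"
    note pm' = int_pm[OF j(1)]
    have "free_proj (single K [Gen (int i), Gen (- int j)]) = free_proj (\<mu> i j \<odot>\<^bsub>W\<^esub> single K [Gen (- int j), Gen (int i)])"
      using i j pm pm' mu_closed[OF i j(1)] by (intro free_proj_rel WM.smult_closed word1 word2) (unfold rels, blast, simp_all)
    then show "tgwa_gen K T m f w \<mu> (int i) \<otimes>\<^bsub>AA\<^esub> tgwa_gen K T m f w \<mu> (- int j)
        = \<mu> i j \<odot>\<^bsub>AA\<^esub> (tgwa_gen K T m f w \<mu> (- int j) \<otimes>\<^bsub>AA\<^esub> tgwa_gen K T m f w \<mu> (int i))"
      using pm pm' PD(3)[OF mu_closed[OF i j(1)] word2, of "Gen (- int j)" "Gen (int i)"]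
      by (simp add: gen_P app)
  qed (rule tgw_dat, rule tgw_mu, rule AA_algebra)
qed

sublocale rep: tgw_rep K T m f w \<mu> AA "tgwa_coef K T m f w \<mu>" "tgwa_gen K T m f w \<mu>"
  by (rule tgwa_rep)

lemma free_proj_word: "ws \<in> lists (tgw_gens T m) \<Longrightarrow> free_proj (single K ws) = list_prod AA (map rep.letter ws)"
proof (induction rule: lists.induct)
  case Nil
  then show ?case using ring_hom_one[OF free_proj_hom] by (simp add: free_algebra_simps(3) list_prod_simps)
next
  case (Cons g ws)
  have "free_proj (single K [g]) = rep.letter g" by (cases g) (simp_all add: coef_P gen_P)
  then show ?case using Cons free_proj_append[of "[g]" ws] by (simp add: list_prod_simps)
qed

text \<open>The multiples of a generator form a subspace that contains the images of all words of that degree,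
  so it contains their span.\<close>

lemma tgwa_unit_component:
  assumes u: "u \<in> pm m" and x: "x \<in> tgwa_comp K T m f w \<mu> (signed_unit u)"
  obtains r where "r \<in> carrier T" "x = tgwa_coef K T m f w \<mu> r \<otimes>\<^bsub>AA\<^esub> tgwa_gen K T m f w \<mu> u"
proof -
  let ?\<eta> = "tgwa_coef K T m f w \<mu>" and ?Z = "tgwa_gen K T m f w \<mu> u"
  let ?H = "(\<lambda>r. ?\<eta> r \<otimes>\<^bsub>AA\<^esub> ?Z) ` carrier T"
  have Z: "?Z \<in> carrier AA" using u by simp
  have lin: "(\<lambda>r. ?\<eta> r \<otimes>\<^bsub>AA\<^esub> ?Z) \<in> lin_map K T AA"
    using Z k_algebraD(5)[OF AA_algebra] lin_mapD(2,3)[OF rep.eta_lin]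
    unfolding lin_map_def by (auto simp: AA.l_distr)
  have H: "submodule ?H K AA"
    by (rule lin_map_image[OF lin k_algebraD(4)[OF T_alg] k_algebraD(4)[OF AA_algebra]])
  have "tgwc_comp K T m f w \<mu> (signed_unit u) \<subseteq> {y \<in> carrier CC. pA y \<in> ?H}"
    unfolding tgwc_comp_def
  proof (rule kspan_least[OF lin_map_preimage[OF pA_hom(2) k_algebraD(4)[OF CC_algebra] k_algebraD(4)[OF AA_algebra] H]])
    show "{tgwc_word K T m f w \<mu> ws |ws. ws \<in> lists (tgw_gens T m) \<and> word_deg ws = signed_unit u}
        \<subseteq> {y \<in> carrier CC. pA y \<in> ?H}"
    proof
      fix y assume "y \<in> {tgwc_word K T m f w \<mu> ws |ws. ws \<in> lists (tgw_gens T m) \<and> word_deg ws = signed_unit u}"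
      then obtain ws where ws: "ws \<in> lists (tgw_gens T m)" "word_deg ws = signed_unit u" "y = pC (single K ws)"
        unfolding tgwc_word_def by blast
      have "y \<in> carrier CC" unfolding ws(3) by (intro ring_hom_closed[OF pC_hom(1)] word_closed ws(1))
      moreover have "pA y = list_prod AA (map rep.letter ws)"
        using free_proj_word[OF ws(1)] by (simp add: free_proj_def ws(3))
      moreover obtain r where "r \<in> carrier T" "list_prod AA (map rep.letter ws) = ?\<eta> r \<otimes>\<^bsub>AA\<^esub> ?Z"
        using rep.word_of_unit_degree[OF ws(1) u ws(2)] by blast
      ultimately show "y \<in> {y \<in> carrier CC. pA y \<in> ?H}" by blast
    qed
  qed
  then show thesis using that x unfolding tgwa_comp_def by blast
qed

lemma gen_in_comp:
  assumes "u \<in> pm m"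
  shows "tgwa_gen K T m f w \<mu> u \<in> tgwa_comp K T m f w \<mu> (signed_unit u)"
proof -
  have "[Gen u] \<in> lists (tgw_gens T m)" "word_deg [Gen u] = signed_unit u"
    using assms by (auto simp: word_deg_def)
  then have "tgwc_word K T m f w \<mu> [Gen u] \<in> tgwc_comp K T m f w \<mu> (signed_unit u)"
    unfolding tgwc_comp_def by (intro subsetD[OF kspan_base]) blast
  then show ?thesis unfolding tgwa_comp_def tgwa_gen_def by (rule imageI)
qed

end

text \<open>The defining isomorphism carries the relations over to \<open>C\<close>. That \<open>C\<close> is a module has to be assumed:
  an isomorphism of records says nothing about the zero element of its target.\<close>

lemma is_tgwa_over_rep:
  assumes "tgw_datum K T m f w" "unit_matrix K m \<mu>" and C: "module K C"
    and over: "is_tgwa_over K T m f w \<mu> C \<eta> Z"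
  shows "tgw_rep K T m f w \<mu> C \<eta> Z"
proof -
  interpret tgw K T m f w \<mu> by unfold_locales fact+
  obtain \<phi> where \<phi>: "\<phi> \<in> alg_iso K AA C" "\<And>r. r \<in> carrier T \<Longrightarrow> \<phi> (tgwa_coef K T m f w \<mu> r) = \<eta> r"
    "\<And>u. u \<in> pm m \<Longrightarrow> \<phi> (tgwa_gen K T m f w \<mu> u) = Z u"
    using over unfolding is_tgwa_over_def by blast
  have h: "\<phi> \<in> ring_hom AA C" "\<phi> \<in> lin_map K AA C" "\<phi> ` carrier AA = carrier C"
    using \<phi>(1) by (auto simp: alg_iso_def ring_iso_def bij_betw_def)
  show ?thesis
    by (rule tgw_rep_image[OF tgwa_rep h lin_map_zero[OF h(2) k_algebraD(4)[OF AA_algebra] C]]) (fact \<phi>(2), fact \<phi>(3))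
qed

section \<open>Multiplication in tensor algebras and twisted tensor products\<close>

lemma alg_mult_linear:
  assumes "k_algebra K A" "a \<in> carrier A"
  shows "(\<lambda>x. a \<otimes>\<^bsub>A\<^esub> x) \<in> lin_map K A A" "(\<lambda>x. x \<otimes>\<^bsub>A\<^esub> a) \<in> lin_map K A A"
proof -
  interpret A: ring A using k_algebraD(3)[OF assms(1)] .
  show "(\<lambda>x. a \<otimes>\<^bsub>A\<^esub> x) \<in> lin_map K A A" "(\<lambda>x. x \<otimes>\<^bsub>A\<^esub> a) \<in> lin_map K A A"
    using assms(2) k_algebraD(5,6)[OF assms(1)] unfolding lin_map_def
    by (auto simp: A.l_distr A.r_distr)
qed

context tensor_product
begin

text \<open>Both the ordinary and the twisted product of tensors are nested lifts of a map \<open>G\<close> that is linear in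
  each of its four arguments.\<close>

lemma nested_tensor_lift:
  assumes a: "\<And>b a' b'. b \<in> carrier B \<Longrightarrow> a' \<in> carrier A \<Longrightarrow> b' \<in> carrier B \<Longrightarrow> (\<lambda>a. G a b a' b') \<in> lin_map K A T"
    and b: "\<And>a a' b'. a \<in> carrier A \<Longrightarrow> a' \<in> carrier A \<Longrightarrow> b' \<in> carrier B \<Longrightarrow> (\<lambda>b. G a b a' b') \<in> lin_map K B T"
    and a': "\<And>a b b'. a \<in> carrier A \<Longrightarrow> b \<in> carrier B \<Longrightarrow> b' \<in> carrier B \<Longrightarrow> (\<lambda>a'. G a b a' b') \<in> lin_map K A T"
    and b': "\<And>a b a'. a \<in> carrier A \<Longrightarrow> b \<in> carrier B \<Longrightarrow> a' \<in> carrier A \<Longrightarrow> (\<lambda>b'. G a b a' b') \<in> lin_map K B T"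
    and x: "a \<in> carrier A" "b \<in> carrier B" "a' \<in> carrier A" "b' \<in> carrier B"
  shows "tensor_lift K T (\<lambda>a b. tensor_lift K T (\<lambda>a' b'. G a b a' b') (a' \<otimes>\<otimes> b')) (a \<otimes>\<otimes> b) = G a b a' b'"
proof -
  have inner: "bilin K A B T (G a b)" if "a \<in> carrier A" "b \<in> carrier B" for a b
    unfolding bilin_def using a' b' that by simp
  have y: "a' \<otimes>\<otimes> b' \<in> carrier T" using x by simp
  have "bilin K A B T (\<lambda>a b. tensor_lift K T (G a b) (a' \<otimes>\<otimes> b'))"
    unfolding bilin_def
    by (auto intro!: tensor_lift_param_linear[OF mod_left T_module inner a y]
        tensor_lift_param_linear[OF mod_right T_module inner b y])
  from tensor_lift_tens[OF T_module this x(1,2)] tensor_lift_tens[OF T_module inner[OF x(1,2)] x(3,4)]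
  show ?thesis by simp
qed

end

locale tensor_algebras =
  fixes K :: "'k ring" and A :: "('k, 'a) module" and B :: "('k, 'b) module"
  assumes alg_left: "k_algebra K A" and alg_right: "k_algebra K B"
begin

sublocale tensor_product K A B
  by (rule tensor_product.intro) (rule k_algebraD(4)[OF alg_left], rule k_algebraD(4)[OF alg_right])

sublocale AR: ring A using k_algebraD(3)[OF alg_left] .
sublocale BR: ring B using k_algebraD(3)[OF alg_right] .

lemmas tens_lin = bilinD[OF tens_bilin]
lemmas mult_left_lin = alg_mult_linear[OF alg_left] and mult_right_lin = alg_mult_linear[OF alg_right]

abbreviation "R \<equiv> tensor_alg K A B"

lemma tensor_alg_simps: "carrier R = carrier T" "ring.add R = ring.add T" "\<zero>\<^bsub>R\<^esub> = \<zero>\<^bsub>T\<^esub>" "smult R = smult T"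
  "\<one>\<^bsub>R\<^esub> = \<one>\<^bsub>A\<^esub> \<otimes>\<otimes> \<one>\<^bsub>B\<^esub>"
  by (simp_all add: tensor_alg_def Let_def)

lemma tensor_alg_mult:
  assumes "a \<in> carrier A" "b \<in> carrier B" "a' \<in> carrier A" "b' \<in> carrier B"
  shows "(a \<otimes>\<otimes> b) \<otimes>\<^bsub>R\<^esub> (a' \<otimes>\<otimes> b') = (a \<otimes>\<^bsub>A\<^esub> a') \<otimes>\<otimes> (b \<otimes>\<^bsub>B\<^esub> b')"
proof -
  have "tensor_lift K T (\<lambda>a b. tensor_lift K T (\<lambda>a' b'. (a \<otimes>\<^bsub>A\<^esub> a') \<otimes>\<otimes> (b \<otimes>\<^bsub>B\<^esub> b')) (a' \<otimes>\<otimes> b')) (a \<otimes>\<otimes> b)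
      = (a \<otimes>\<^bsub>A\<^esub> a') \<otimes>\<otimes> (b \<otimes>\<^bsub>B\<^esub> b')"
    using assms
    by (intro nested_tensor_lift)
      (auto intro: lin_map_comp[OF mult_left_lin(1) tens_lin(2)] lin_map_comp[OF mult_left_lin(2) tens_lin(2)]
        lin_map_comp[OF mult_right_lin(1) tens_lin(1)] lin_map_comp[OF mult_right_lin(2) tens_lin(1)])
  then show ?thesis by (simp add: tensor_alg_def Let_def)
qed

end

locale twisted_product = tensor_algebras K A B
  for K :: "'k ring" and A :: "('k, 'a) module" and B :: "('k, 'b) module" +
  fixes \<tau> :: "('b \<times> 'a \<Rightarrow> 'k) set \<Rightarrow> ('a \<times> 'b \<Rightarrow> 'k) set"
  assumes twisting: "twisting_map K A B \<tau>"
begin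

sublocale opp: tensor_product K B A
  by (rule tensor_product.intro) (rule mod_right, rule mod_left)

abbreviation "C \<equiv> twisted_tensor K A B \<tau>"

lemma tau_lin: "\<tau> \<in> lin_map K opp.T T"
  and tau_one_right: "b \<in> carrier B \<Longrightarrow> \<tau> (tens K B A b \<one>\<^bsub>A\<^esub>) = \<one>\<^bsub>A\<^esub> \<otimes>\<otimes> b"
  and tau_one_left: "a \<in> carrier A \<Longrightarrow> \<tau> (tens K B A \<one>\<^bsub>B\<^esub> a) = a \<otimes>\<otimes> \<one>\<^bsub>B\<^esub>"
  using twisting by (auto simp: twisting_map_def)

lemma twisted_simps: "carrier C = carrier T" "ring.add C = ring.add T" "\<zero>\<^bsub>C\<^esub> = \<zero>\<^bsub>T\<^esub>" "smult C = smult T"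
  "\<one>\<^bsub>C\<^esub> = \<one>\<^bsub>A\<^esub> \<otimes>\<otimes> \<one>\<^bsub>B\<^esub>"
  by (simp_all add: twisted_tensor_def Let_def)

lemma twisted_lin: "lin_map K C M = lin_map K T M" "lin_map K M C = lin_map K M T"
  by (simp_all add: lin_map_def twisted_simps)

lemma twisted_module: "module K C"
  using module_image[OF T_module, of id C]
  by (simp add: twisted_lin twisted_simps) (simp add: lin_map_def)

lemma tau_closed: "a \<in> carrier A \<Longrightarrow> b \<in> carrier B \<Longrightarrow> \<tau> (tens K B A b a) \<in> carrier T"
  by (rule lin_mapD(1)[OF tau_lin opp.tens_closed])

lemma sandwich_bilin:
  assumes "a \<in> carrier A" "b' \<in> carrier B"
  shows "bilin K A B T (\<lambda>a'' b''. (a \<otimes>\<^bsub>A\<^esub> a'') \<otimes>\<otimes> (b'' \<otimes>\<^bsub>B\<^esub> b'))"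
  unfolding bilin_def using assms
  by (auto intro: lin_map_comp[OF mult_left_lin(1) tens_lin(2)] lin_map_comp[OF mult_right_lin(2) tens_lin(1)])

lemma twisted_mult:
  assumes "a \<in> carrier A" "b \<in> carrier B" "a' \<in> carrier A" "b' \<in> carrier B"
  shows "(a \<otimes>\<otimes> b) \<otimes>\<^bsub>C\<^esub> (a' \<otimes>\<otimes> b')
    = tensor_lift K T (\<lambda>a'' b''. (a \<otimes>\<^bsub>A\<^esub> a'') \<otimes>\<otimes> (b'' \<otimes>\<^bsub>B\<^esub> b')) (\<tau> (tens K B A b a'))"
proof -
  let ?G = "\<lambda>a b a' b'. tensor_lift K T (\<lambda>a'' b''. (a \<otimes>\<^bsub>A\<^esub> a'') \<otimes>\<otimes> (b'' \<otimes>\<^bsub>B\<^esub> b')) (\<tau> (tens K B A b a'))"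
  have "tensor_lift K T (\<lambda>a b. tensor_lift K T (\<lambda>a' b'. ?G a b a' b') (a' \<otimes>\<otimes> b')) (a \<otimes>\<otimes> b) = ?G a b a' b'"
  proof (rule nested_tensor_lift[OF _ _ _ _ assms])
    fix a b b' assume x: "a \<in> carrier A" "b \<in> carrier B" "b' \<in> carrier B"
    note lift = tensor_lift_linear[OF T_module sandwich_bilin[OF x(1,3)]]
    show "(\<lambda>a'. ?G a b a' b') \<in> lin_map K A T"
      by (rule lin_map_comp[OF lin_map_comp[OF bilinD(1)[OF opp.tens_bilin x(2)] tau_lin] lift])
    fix a' assume a': "a' \<in> carrier A"
    show "(\<lambda>b. ?G a b a' b') \<in> lin_map K B T"
      by (rule lin_map_comp[OF lin_map_comp[OF bilinD(2)[OF opp.tens_bilin a'] tau_lin] lift])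
    show "(\<lambda>a. ?G a b a' b') \<in> lin_map K A T"
      by (rule tensor_lift_param_linear[OF mod_left T_module sandwich_bilin[OF _ x(3)] _ tau_closed[OF a' x(2)]])
        (auto intro: lin_map_comp[OF mult_left_lin(2) tens_lin(2)] x)
    show "(\<lambda>b'. ?G a b a' b') \<in> lin_map K B T"
      by (rule tensor_lift_param_linear[OF mod_right T_module sandwich_bilin[OF x(1)] _ tau_closed[OF a' x(2)]])
        (auto intro: lin_map_comp[OF mult_right_lin(1) tens_lin(1)] x)
  qed
  then show ?thesis by (simp add: twisted_tensor_def Let_def)
qed

text \<open>Since \<open>\<tau>\<close> is the flip when one argument is the unit, multiplication by \<open>a \<otimes> 1\<close> on the left and by
  \<open>1 \<otimes> b\<close> on the right is the expected one, and \<open>\<tau>\<close> itself is the product in the remaining order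
  (\<open>twisted_mult_tau\<close>).\<close>

lemma twisted_mult_left:
  assumes "a \<in> carrier A" "a' \<in> carrier A" "b' \<in> carrier B"
  shows "(a \<otimes>\<otimes> \<one>\<^bsub>B\<^esub>) \<otimes>\<^bsub>C\<^esub> (a' \<otimes>\<otimes> b') = (a \<otimes>\<^bsub>A\<^esub> a') \<otimes>\<otimes> b'"
  using assms
  by (simp add: twisted_mult tau_one_left tensor_lift_tens[OF T_module sandwich_bilin])

lemma twisted_mult_right:
  assumes "a \<in> carrier A" "b \<in> carrier B" "b' \<in> carrier B"
  shows "(a \<otimes>\<otimes> b) \<otimes>\<^bsub>C\<^esub> (\<one>\<^bsub>A\<^esub> \<otimes>\<otimes> b') = a \<otimes>\<otimes> (b \<otimes>\<^bsub>B\<^esub> b')"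
  using assms
  by (simp add: twisted_mult tau_one_right tensor_lift_tens[OF T_module sandwich_bilin])

lemma twisted_mult_tau:
  assumes "a \<in> carrier A" "b \<in> carrier B"
  shows "(\<one>\<^bsub>A\<^esub> \<otimes>\<otimes> b) \<otimes>\<^bsub>C\<^esub> (a \<otimes>\<otimes> \<one>\<^bsub>B\<^esub>) = \<tau> (tens K B A b a)"
  using assms by (simp add: twisted_mult tensor_lift_id tau_closed)

end

section \<open>Commutation of two generators\<close>

lemma regular_elemD:
  assumes "regular_elem T a"
  shows "a \<in> carrier T" "\<And>x. x \<in> carrier T \<Longrightarrow> a \<otimes>\<^bsub>T\<^esub> x = \<zero>\<^bsub>T\<^esub> \<Longrightarrow> x = \<zero>\<^bsub>T\<^esub>"
    "\<And>x. x \<in> carrier T \<Longrightarrow> x \<otimes>\<^bsub>T\<^esub> a = \<zero>\<^bsub>T\<^esub> \<Longrightarrow> x = \<zero>\<^bsub>T\<^esub>"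
  using assms unfolding regular_elem_def by blast+

lemma regular_elem_cancel:
  assumes "ring T" "regular_elem T a" "x \<in> carrier T" "y \<in> carrier T" "x \<otimes>\<^bsub>T\<^esub> a = y \<otimes>\<^bsub>T\<^esub> a"
  shows "x = y"
proof -
  interpret ring T by fact
  have a: "a \<in> carrier T" using assms(2) by (simp add: regular_elem_def)
  have "(x \<ominus>\<^bsub>T\<^esub> y) \<otimes>\<^bsub>T\<^esub> a = \<zero>\<^bsub>T\<^esub>"
    using a assms by (simp add: minus_eq l_distr l_minus r_neg)
  then have "x \<ominus>\<^bsub>T\<^esub> y = \<zero>\<^bsub>T\<^esub>"
    by (rule regular_elemD(3)[OF assms(2) minus_closed[OF assms(3,4)]])
  then show ?thesis using eq_iff_minus_zero[OF assms(3,4)] by simp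
qed

lemma regular_elem_auto:
  assumes T: "ring T" and f: "f \<in> ring_hom T T" "bij_betw f (carrier T) (carrier T)" and a: "regular_elem T a"
  shows "regular_elem T (f a)"
  unfolding regular_elem_def
proof (intro conjI ballI impI)
  interpret T: ring T by fact
  have aT: "a \<in> carrier T" using regular_elemD(1)[OF a] .
  then show "f a \<in> carrier T" by (rule ring_hom_closed[OF f(1)])
  have f0: "f \<zero>\<^bsub>T\<^esub> = \<zero>\<^bsub>T\<^esub>" by (rule ring_hom_zero[OF f(1) T T])
  fix x assume x: "x \<in> carrier T"
  obtain y where y: "y \<in> carrier T" "x = f y" using x f(2) by (auto simp: bij_betw_def)
  have inj: "z = \<zero>\<^bsub>T\<^esub>" if "z \<in> carrier T" "f z = \<zero>\<^bsub>T\<^esub>" for z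
    using f(2) f0 that by (metis T.zero_closed bij_betw_imp_inj_on inj_onD)
  {
    assume "f a \<otimes>\<^bsub>T\<^esub> x = \<zero>\<^bsub>T\<^esub>"
    then have "f (a \<otimes>\<^bsub>T\<^esub> y) = \<zero>\<^bsub>T\<^esub>" using ring_hom_mult[OF f(1) aT y(1)] y by simp
    then have "a \<otimes>\<^bsub>T\<^esub> y = \<zero>\<^bsub>T\<^esub>" using inj aT y(1) by blast
    then show "x = \<zero>\<^bsub>T\<^esub>" using regular_elemD(2)[OF a y(1)] y(2) f0 by simp
  }
  {
    assume "x \<otimes>\<^bsub>T\<^esub> f a = \<zero>\<^bsub>T\<^esub>"
    then have "f (y \<otimes>\<^bsub>T\<^esub> a) = \<zero>\<^bsub>T\<^esub>" using ring_hom_mult[OF f(1) y(1) aT] y by simp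
    then have "y \<otimes>\<^bsub>T\<^esub> a = \<zero>\<^bsub>T\<^esub>" using inj aT y(1) by blast
    then show "x = \<zero>\<^bsub>T\<^esub>" using regular_elemD(3)[OF a y(1)] y(2) f0 by simp
  }
qed

context tgw_rep
begin

lemma loop_regular:
  assumes "regular_datum T m w" "u \<in> pm m"
  shows "regular_elem T (loop u)"
proof -
  have i: "nat \<bar>u\<bar> \<in> {1..m}" by (rule pm_index[OF assms(2)])
  have r: "regular_elem T (w (nat \<bar>u\<bar>))" using assms(1) i by (simp add: regular_datum_def)
  have "regular_elem T (f (nat \<bar>u\<bar>) (w (nat \<bar>u\<bar>)))"
    by (rule regular_elem_auto[OF T.ring_axioms alg_autoD(1,2)[OF auto[OF i]] r])
  then show ?thesis using r by (cases "0 < u") (simp_all add: loop_def)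
qed

lemma eta_Z_cancel:
  assumes "u \<in> pm m" "regular_datum T m w" "inj_on \<eta> (carrier T)" "x \<in> carrier T" "y \<in> carrier T"
    "\<eta> x \<otimes>\<^bsub>C\<^esub> Z u = \<eta> y \<otimes>\<^bsub>C\<^esub> Z u"
  shows "x = y"
proof -
  have "\<eta> z \<otimes>\<^bsub>C\<^esub> Z u \<otimes>\<^bsub>C\<^esub> Z (- u) = \<eta> (z \<otimes>\<^bsub>T\<^esub> loop u)" if "z \<in> carrier T" for z
    using that assms(1) pm_uminus[OF assms(1)] by (simp add: C.m_assoc Z_loop eta_mult)
  then have "\<eta> (x \<otimes>\<^bsub>T\<^esub> loop u) = \<eta> (y \<otimes>\<^bsub>T\<^esub> loop u)" using assms(4-6) by metis
  then have "x \<otimes>\<^bsub>T\<^esub> loop u = y \<otimes>\<^bsub>T\<^esub> loop u"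
    by (rule inj_onD[OF assms(3)]) (simp_all add: assms)
  then show ?thesis by (rule regular_elem_cancel[OF T.ring_axioms loop_regular[OF assms(2,1)] assms(4,5)])
qed

lemma loop_uminus:
  assumes "u \<in> pm m" "0 < u" shows "loop u = f (nat u) (loop (- u))"
  using assms by (simp add: loop_def)

text \<open>Let \<open>Z v Z u = \<eta> p Z u Z v\<close>. Multiplied on the right by \<open>Z (- u) Z (- v)\<close>, both sides become
  coefficients after \<open>Z v\<close> and \<open>Z (- u)\<close> are interchanged, which costs the scalar \<open>c\<close>; cancelling
  \<open>loop v\<close> gives the first equation. The second one comes from \<open>Z (- v) Z (- u)\<close> in the same way.\<close>

lemma exchange:
  assumes uv: "u \<in> pm m" "v \<in> pm m" "sgn v = sgn u" "v \<noteq> u"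
    and reg: "regular_datum T m w" and inj: "inj_on \<eta> (carrier T)"
    and p: "p \<in> carrier T" "Z v \<otimes>\<^bsub>C\<^esub> Z u = \<eta> p \<otimes>\<^bsub>C\<^esub> (Z u \<otimes>\<^bsub>C\<^esub> Z v)"
  obtains c d where "c \<in> carrier K" "c \<noteq> \<zero>\<^bsub>K\<^esub>" "d \<in> carrier K" "d \<noteq> \<zero>\<^bsub>K\<^esub>"
    "signed_auto T f v (loop u) = c \<odot>\<^bsub>T\<^esub> (p \<otimes>\<^bsub>T\<^esub> loop u)"
    "d \<odot>\<^bsub>T\<^esub> loop v = p \<otimes>\<^bsub>T\<^esub> signed_auto T f u (loop v)"
proof -
  note nuv = pm_uminus[OF uv(1)] pm_uminus[OF uv(2)]
  note T_smult = k_algebraD(5,6)[OF T_algebra]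
  obtain c where c: "c \<in> carrier K" "c \<noteq> \<zero>\<^bsub>K\<^esub>" "Z v \<otimes>\<^bsub>C\<^esub> Z (- u) = c \<odot>\<^bsub>C\<^esub> (Z (- u) \<otimes>\<^bsub>C\<^esub> Z v)"
    using Z_swap[OF uv(2) nuv(1)] uv(3,4) by (auto simp: sgn_minus)
  obtain d where d: "d \<in> carrier K" "d \<noteq> \<zero>\<^bsub>K\<^esub>" "Z u \<otimes>\<^bsub>C\<^esub> Z (- v) = d \<odot>\<^bsub>C\<^esub> (Z (- v) \<otimes>\<^bsub>C\<^esub> Z u)"
    using Z_swap[OF uv(1) nuv(2)] uv(3,4) by (auto simp: sgn_minus)
  have Zc [simp]: "Z u \<in> carrier C" "Z v \<in> carrier C" "Z (- u) \<in> carrier C" "Z (- v) \<in> carrier C"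
    "\<eta> p \<in> carrier C"
    using uv nuv p by simp_all
  have au: "signed_auto T f u (loop v) \<in> carrier T" and av: "signed_auto T f v (loop u) \<in> carrier T"
    using uv by (simp_all add: signed_auto_closed)
  note lc = loop_closed[OF uv(1)] loop_closed[OF uv(2)]
  have eta_smult: "\<eta> (a \<odot>\<^bsub>T\<^esub> x) = a \<odot>\<^bsub>C\<^esub> \<eta> x" if "a \<in> carrier K" "x \<in> carrier T" for a x
    using lin_mapD(3)[OF eta_lin that] .
  have "\<eta> (signed_auto T f v (loop u) \<otimes>\<^bsub>T\<^esub> loop v) = (Z v \<otimes>\<^bsub>C\<^esub> \<eta> (loop u)) \<otimes>\<^bsub>C\<^esub> Z (- v)"
    using uv av lc by (simp add: eta_mult Z_coef Z_loop[OF uv(2), symmetric] C.m_assoc)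
  also have "\<dots> = (Z v \<otimes>\<^bsub>C\<^esub> Z u) \<otimes>\<^bsub>C\<^esub> (Z (- u) \<otimes>\<^bsub>C\<^esub> Z (- v))"
    using uv by (simp add: Z_loop[OF uv(1), symmetric] C.m_assoc)
  also have "\<dots> = \<eta> p \<otimes>\<^bsub>C\<^esub> (Z u \<otimes>\<^bsub>C\<^esub> ((Z v \<otimes>\<^bsub>C\<^esub> Z (- u)) \<otimes>\<^bsub>C\<^esub> Z (- v)))"
    unfolding p(2) by (simp add: C.m_assoc)
  also have "\<dots> = c \<odot>\<^bsub>C\<^esub> (\<eta> p \<otimes>\<^bsub>C\<^esub> ((Z u \<otimes>\<^bsub>C\<^esub> Z (- u)) \<otimes>\<^bsub>C\<^esub> (Z v \<otimes>\<^bsub>C\<^esub> Z (- v))))"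
    unfolding c(3) using c(1) by (simp add: C_smult C.m_assoc)
  also have "\<dots> = \<eta> ((c \<odot>\<^bsub>T\<^esub> (p \<otimes>\<^bsub>T\<^esub> loop u)) \<otimes>\<^bsub>T\<^esub> loop v)"
    using uv lc p(1) c(1) by (simp add: eta_smult T_smult eta_mult Z_loop C.m_assoc)
  finally have eq1: "signed_auto T f v (loop u) \<otimes>\<^bsub>T\<^esub> loop v = (c \<odot>\<^bsub>T\<^esub> (p \<otimes>\<^bsub>T\<^esub> loop u)) \<otimes>\<^bsub>T\<^esub> loop v"
    by (rule inj_onD[OF inj]) (simp_all add: av lc p(1) c(1))
  have e1: "signed_auto T f v (loop u) = c \<odot>\<^bsub>T\<^esub> (p \<otimes>\<^bsub>T\<^esub> loop u)"
    by (rule regular_elem_cancel[OF T.ring_axioms loop_regular[OF reg uv(2)] av _ eq1]) (simp add: lc p(1) c(1))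
  have "\<eta> ((d \<odot>\<^bsub>T\<^esub> loop v) \<otimes>\<^bsub>T\<^esub> loop u) = d \<odot>\<^bsub>C\<^esub> ((Z v \<otimes>\<^bsub>C\<^esub> Z (- v)) \<otimes>\<^bsub>C\<^esub> (Z u \<otimes>\<^bsub>C\<^esub> Z (- u)))"
    using uv lc d(1) by (simp add: eta_smult T_smult eta_mult Z_loop)
  also have "\<dots> = Z v \<otimes>\<^bsub>C\<^esub> ((d \<odot>\<^bsub>C\<^esub> (Z (- v) \<otimes>\<^bsub>C\<^esub> Z u)) \<otimes>\<^bsub>C\<^esub> Z (- u))"
    using d(1) by (simp add: C_smult C.m_assoc)
  also have "\<dots> = (Z v \<otimes>\<^bsub>C\<^esub> Z u) \<otimes>\<^bsub>C\<^esub> (Z (- v) \<otimes>\<^bsub>C\<^esub> Z (- u))"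
    unfolding d(3)[symmetric] by (simp add: C.m_assoc)
  also have "\<dots> = \<eta> p \<otimes>\<^bsub>C\<^esub> ((Z u \<otimes>\<^bsub>C\<^esub> (Z v \<otimes>\<^bsub>C\<^esub> Z (- v))) \<otimes>\<^bsub>C\<^esub> Z (- u))"
    unfolding p(2) by (simp add: C.m_assoc)
  also have "\<dots> = \<eta> p \<otimes>\<^bsub>C\<^esub> (\<eta> (signed_auto T f u (loop v)) \<otimes>\<^bsub>C\<^esub> (Z u \<otimes>\<^bsub>C\<^esub> Z (- u)))"
    using uv au lc by (simp add: Z_loop[of v] Z_coef C.m_assoc)
  also have "\<dots> = \<eta> ((p \<otimes>\<^bsub>T\<^esub> signed_auto T f u (loop v)) \<otimes>\<^bsub>T\<^esub> loop u)"
    using uv au lc p(1) by (simp add: eta_mult Z_loop C.m_assoc)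
  finally have eq2: "(d \<odot>\<^bsub>T\<^esub> loop v) \<otimes>\<^bsub>T\<^esub> loop u = (p \<otimes>\<^bsub>T\<^esub> signed_auto T f u (loop v)) \<otimes>\<^bsub>T\<^esub> loop u"
    by (rule inj_onD[OF inj]) (simp_all add: au lc p(1) d(1))
  have e2: "d \<odot>\<^bsub>T\<^esub> loop v = p \<otimes>\<^bsub>T\<^esub> signed_auto T f u (loop v)"
    by (rule regular_elem_cancel[OF T.ring_axioms loop_regular[OF reg uv(1)] _ _ eq2]) (simp_all add: lc p(1) d(1) au)
  show thesis by (rule that[OF c(1,2) d(1,2) e1 e2])
qed

end

section \<open>The two factors of a tensor product of algebras\<close>

text \<open>In a nonzero algebra over a field the unit spans a line, so some linear functional \<open>h\<close> takes the
  value 1 at it.\<close>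

lemma unit_functional:
  assumes B: "k_algebra K B" and one: "\<one>\<^bsub>B\<^esub> \<noteq> \<zero>\<^bsub>B\<^esub>"
  obtains h where "\<And>b. b \<in> carrier B \<Longrightarrow> h b \<in> carrier K"
    "\<And>b b'. b \<in> carrier B \<Longrightarrow> b' \<in> carrier B \<Longrightarrow> h (b \<oplus>\<^bsub>B\<^esub> b') = h b \<oplus>\<^bsub>K\<^esub> h b'"
    "\<And>c b. c \<in> carrier K \<Longrightarrow> b \<in> carrier B \<Longrightarrow> h (c \<odot>\<^bsub>B\<^esub> b) = c \<otimes>\<^bsub>K\<^esub> h b"
    "h \<one>\<^bsub>B\<^esub> = \<one>\<^bsub>K\<^esub>"
proof -
  interpret K: field K using k_algebraD(1)[OF B] .
  interpret B: ring B using k_algebraD(3)[OF B] .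
  interpret BM: module K B using k_algebraD(4)[OF B] .
  \<comment> \<open>The field as a module over itself.\<close>
  define L where "L = \<lparr>carrier = carrier K, monoid.mult = monoid.mult K, one = \<one>\<^bsub>K\<^esub>,
    ring.zero = \<zero>\<^bsub>K\<^esub>, ring.add = ring.add K, smult = monoid.mult K\<rparr>"
  have Ls: "carrier L = carrier K" "ring.add L = ring.add K" "smult L = monoid.mult K" "\<zero>\<^bsub>L\<^esub> = \<zero>\<^bsub>K\<^esub>"
    by (simp_all add: L_def)
  have "abelian_group L"
    using K.l_neg by (intro abelian_groupI) (auto simp: Ls K.a_ac)
  then have L: "module K L"
    by (intro moduleI) (auto simp: Ls K.l_distr K.r_distr K.m_assoc K.cring_axioms)
  have f: "(\<lambda>c. c \<odot>\<^bsub>B\<^esub> \<one>\<^bsub>B\<^esub>) \<in> lin_map K L B"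
    by (auto simp: lin_map_def Ls BM.smult_l_distr BM.smult_assoc1)
  have "inj_on (\<lambda>c. c \<odot>\<^bsub>B\<^esub> \<one>\<^bsub>B\<^esub>) (carrier L)"
  proof (rule inj_onI)
    fix c d assume cd: "c \<in> carrier L" "d \<in> carrier L" "c \<odot>\<^bsub>B\<^esub> \<one>\<^bsub>B\<^esub> = d \<odot>\<^bsub>B\<^esub> \<one>\<^bsub>B\<^esub>"
    then have cdK: "c \<in> carrier K" "d \<in> carrier K" by (simp_all add: Ls)
    let ?e = "c \<ominus>\<^bsub>K\<^esub> d"
    have e0: "?e \<odot>\<^bsub>B\<^esub> \<one>\<^bsub>B\<^esub> = \<zero>\<^bsub>B\<^esub>"
      using cdK cd(3) by (simp add: K.minus_eq BM.smult_l_distr BM.smult_l_minus B.r_neg)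
    have "?e = \<zero>\<^bsub>K\<^esub>"
    proof (rule ccontr)
      assume "?e \<noteq> \<zero>\<^bsub>K\<^esub>"
      then have U: "?e \<in> Units K" using cdK K.field_Units by blast
      have "\<one>\<^bsub>B\<^esub> = inv\<^bsub>K\<^esub> ?e \<odot>\<^bsub>B\<^esub> (?e \<odot>\<^bsub>B\<^esub> \<one>\<^bsub>B\<^esub>)"
        using U cdK by (simp add: BM.smult_assoc1[symmetric])
      then show False using e0 one U by simp
    qed
    then show "c = d" using K.eq_iff_minus_zero[OF cdK] by simp
  qed
  then obtain h where h: "h \<in> lin_map K B L" "\<And>c. c \<in> carrier L \<Longrightarrow> h (c \<odot>\<^bsub>B\<^esub> \<one>\<^bsub>B\<^esub>) = c"
    using linear_left_inverse[OF K.field_axioms L k_algebraD(4)[OF B] f] by blast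
  note hD = lin_mapD[OF h(1), unfolded Ls]
  have h1: "h \<one>\<^bsub>B\<^esub> = \<one>\<^bsub>K\<^esub>" using h(2)[of "\<one>\<^bsub>K\<^esub>"] by (simp add: Ls)
  show thesis by (rule that[of h]) (simp_all add: hD h1)
qed

context tensor_algebras
begin

text \<open>The map \<open>E = id \<otimes> h\<close> from \<open>A \<otimes> B\<close> to \<open>A\<close> commutes with right multiplication by \<open>a \<otimes> 1\<close> and is the
  identity on \<open>A \<otimes> 1\<close>. So \<open>p\<close> and \<open>E p \<otimes> 1\<close> have the same product with the regular element
  \<open>a \<otimes> 1\<close>.\<close>

lemma left_part_divide:
  assumes R: "k_algebra K R" and one: "\<one>\<^bsub>B\<^esub> \<noteq> \<zero>\<^bsub>B\<^esub>"
    and a: "regular_elem R (a \<otimes>\<otimes> \<one>\<^bsub>B\<^esub>)" "a \<in> carrier A" "a' \<in> carrier A"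
    and p: "p \<in> carrier R" "p \<otimes>\<^bsub>R\<^esub> (a \<otimes>\<otimes> \<one>\<^bsub>B\<^esub>) = a' \<otimes>\<otimes> \<one>\<^bsub>B\<^esub>"
  shows "p \<in> left_part K A B"
proof -
  interpret R: ring R using k_algebraD(3)[OF R] .
  obtain h where h: "\<And>b. b \<in> carrier B \<Longrightarrow> h b \<in> carrier K"
    "\<And>b b'. b \<in> carrier B \<Longrightarrow> b' \<in> carrier B \<Longrightarrow> h (b \<oplus>\<^bsub>B\<^esub> b') = h b \<oplus>\<^bsub>K\<^esub> h b'"
    "\<And>c b. c \<in> carrier K \<Longrightarrow> b \<in> carrier B \<Longrightarrow> h (c \<odot>\<^bsub>B\<^esub> b) = c \<otimes>\<^bsub>K\<^esub> h b"
    "h \<one>\<^bsub>B\<^esub> = \<one>\<^bsub>K\<^esub>"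
    using unit_functional[OF alg_right one] by blast
  have bil: "bilin K A B A (\<lambda>a b. h b \<odot>\<^bsub>A\<^esub> a)"
    unfolding bilin_def lin_map_def
    using h by (auto simp: A.smult_l_distr A.smult_r_distr A.smult_assoc1[symmetric] A.R.m_comm)
  define E where "E = tensor_lift K A (\<lambda>a b. h b \<odot>\<^bsub>A\<^esub> a)"
  note E_lin = lin_mapD[OF tensor_lift_linear[OF mod_left bil], folded E_def]
  note E_tens = tensor_lift_tens[OF mod_left bil, folded E_def]
  have pT: "p \<in> carrier T" using p by (simp add: tensor_alg_simps)
  have tc: "x \<otimes>\<otimes> y \<in> carrier R" if "x \<in> carrier A" "y \<in> carrier B" for x y
    using that by (simp add: tensor_alg_simps)
  have E_mult: "x \<otimes>\<^bsub>R\<^esub> (a \<otimes>\<otimes> \<one>\<^bsub>B\<^esub>) \<in> carrier T \<and> E (x \<otimes>\<^bsub>R\<^esub> (a \<otimes>\<otimes> \<one>\<^bsub>B\<^esub>)) = E x \<otimes>\<^bsub>A\<^esub> a"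
    if "x \<in> carrier T" for x
    using that
  proof (induction rule: tensor_induct)
    case (add x y)
    then have "(x \<oplus>\<^bsub>T\<^esub> y) \<otimes>\<^bsub>R\<^esub> (a \<otimes>\<otimes> \<one>\<^bsub>B\<^esub>) = x \<otimes>\<^bsub>R\<^esub> (a \<otimes>\<otimes> \<one>\<^bsub>B\<^esub>) \<oplus>\<^bsub>T\<^esub> y \<otimes>\<^bsub>R\<^esub> (a \<otimes>\<otimes> \<one>\<^bsub>B\<^esub>)"
      using R.l_distr[of x y "a \<otimes>\<otimes> \<one>\<^bsub>B\<^esub>"] a(2) by (simp add: tensor_alg_simps)
    then show ?case using add a(2) by (simp add: E_lin AR.l_distr)
  next
    case (tens x y)
    then show ?case
      using a(2) h(1) by (simp add: tensor_alg_mult E_tens k_algebraD(5)[OF alg_left])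
  qed
  have "E p \<otimes>\<^bsub>A\<^esub> a = a'"
    using E_mult[OF pT] p a by (simp add: E_tens h(4))
  then have eq: "(E p \<otimes>\<otimes> \<one>\<^bsub>B\<^esub>) \<otimes>\<^bsub>R\<^esub> (a \<otimes>\<otimes> \<one>\<^bsub>B\<^esub>) = p \<otimes>\<^bsub>R\<^esub> (a \<otimes>\<otimes> \<one>\<^bsub>B\<^esub>)"
    using E_lin(1)[OF pT] a p by (simp add: tensor_alg_mult)
  have "E p \<otimes>\<otimes> \<one>\<^bsub>B\<^esub> = p"
    by (rule regular_elem_cancel[OF R.ring_axioms a(1) _ p(1) eq]) (simp add: tc E_lin(1)[OF pT])
  then show ?thesis unfolding left_part_def using E_lin(1)[OF pT] by blast
qed

lemma right_part_divide:
  assumes R: "k_algebra K R" and one: "\<one>\<^bsub>A\<^esub> \<noteq> \<zero>\<^bsub>A\<^esub>"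
    and b: "regular_elem R (\<one>\<^bsub>A\<^esub> \<otimes>\<otimes> b)" "b \<in> carrier B" "b' \<in> carrier B"
    and p: "p \<in> carrier R" "p \<otimes>\<^bsub>R\<^esub> (\<one>\<^bsub>A\<^esub> \<otimes>\<otimes> b) = \<one>\<^bsub>A\<^esub> \<otimes>\<otimes> b'"
  shows "p \<in> right_part K A B"
proof -
  interpret R: ring R using k_algebraD(3)[OF R] .
  obtain h where h: "\<And>a. a \<in> carrier A \<Longrightarrow> h a \<in> carrier K"
    "\<And>a a'. a \<in> carrier A \<Longrightarrow> a' \<in> carrier A \<Longrightarrow> h (a \<oplus>\<^bsub>A\<^esub> a') = h a \<oplus>\<^bsub>K\<^esub> h a'"
    "\<And>c a. c \<in> carrier K \<Longrightarrow> a \<in> carrier A \<Longrightarrow> h (c \<odot>\<^bsub>A\<^esub> a) = c \<otimes>\<^bsub>K\<^esub> h a"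
    "h \<one>\<^bsub>A\<^esub> = \<one>\<^bsub>K\<^esub>"
    using unit_functional[OF alg_left one] by blast
  have bil: "bilin K A B B (\<lambda>a b. h a \<odot>\<^bsub>B\<^esub> b)"
    unfolding bilin_def lin_map_def
    using h by (auto simp: B.smult_l_distr B.smult_r_distr B.smult_assoc1[symmetric] A.R.m_comm)
  define E where "E = tensor_lift K B (\<lambda>a b. h a \<odot>\<^bsub>B\<^esub> b)"
  note E_lin = lin_mapD[OF tensor_lift_linear[OF mod_right bil], folded E_def]
  note E_tens = tensor_lift_tens[OF mod_right bil, folded E_def]
  have pT: "p \<in> carrier T" using p by (simp add: tensor_alg_simps)
  have tc: "x \<otimes>\<otimes> y \<in> carrier R" if "x \<in> carrier A" "y \<in> carrier B" for x y
    using that by (simp add: tensor_alg_simps)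
  have E_mult: "x \<otimes>\<^bsub>R\<^esub> (\<one>\<^bsub>A\<^esub> \<otimes>\<otimes> b) \<in> carrier T \<and> E (x \<otimes>\<^bsub>R\<^esub> (\<one>\<^bsub>A\<^esub> \<otimes>\<otimes> b)) = E x \<otimes>\<^bsub>B\<^esub> b"
    if "x \<in> carrier T" for x
    using that
  proof (induction rule: tensor_induct)
    case (add x y)
    then have "(x \<oplus>\<^bsub>T\<^esub> y) \<otimes>\<^bsub>R\<^esub> (\<one>\<^bsub>A\<^esub> \<otimes>\<otimes> b) = x \<otimes>\<^bsub>R\<^esub> (\<one>\<^bsub>A\<^esub> \<otimes>\<otimes> b) \<oplus>\<^bsub>T\<^esub> y \<otimes>\<^bsub>R\<^esub> (\<one>\<^bsub>A\<^esub> \<otimes>\<otimes> b)"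
      using R.l_distr[of x y "\<one>\<^bsub>A\<^esub> \<otimes>\<otimes> b"] b(2) by (simp add: tensor_alg_simps)
    then show ?case using add b(2) by (simp add: E_lin BR.l_distr)
  next
    case (tens x y)
    then show ?case
      using b(2) h(1) by (simp add: tensor_alg_mult E_tens k_algebraD(5)[OF alg_right])
  qed
  have "E p \<otimes>\<^bsub>B\<^esub> b = b'"
    using E_mult[OF pT] p b by (simp add: E_tens h(4))
  then have eq: "(\<one>\<^bsub>A\<^esub> \<otimes>\<otimes> E p) \<otimes>\<^bsub>R\<^esub> (\<one>\<^bsub>A\<^esub> \<otimes>\<otimes> b) = p \<otimes>\<^bsub>R\<^esub> (\<one>\<^bsub>A\<^esub> \<otimes>\<otimes> b)"
    using E_lin(1)[OF pT] b p by (simp add: tensor_alg_mult)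
  have "\<one>\<^bsub>A\<^esub> \<otimes>\<otimes> E p = p"
    by (rule regular_elem_cancel[OF R.ring_axioms b(1) _ p(1) eq]) (simp add: tc E_lin(1)[OF pT])
  then show ?thesis unfolding right_part_def using E_lin(1)[OF pT] by blast
qed

lemma left_part_Int_right_part:
  assumes one: "\<one>\<^bsub>B\<^esub> \<noteq> \<zero>\<^bsub>B\<^esub>" and p: "p \<in> left_part K A B" "p \<in> right_part K A B"
  obtains c where "c \<in> carrier K" "p = c \<odot>\<^bsub>R\<^esub> \<one>\<^bsub>R\<^esub>"
proof -
  obtain h where h: "\<And>b. b \<in> carrier B \<Longrightarrow> h b \<in> carrier K"
    "\<And>b b'. b \<in> carrier B \<Longrightarrow> b' \<in> carrier B \<Longrightarrow> h (b \<oplus>\<^bsub>B\<^esub> b') = h b \<oplus>\<^bsub>K\<^esub> h b'"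
    "\<And>c b. c \<in> carrier K \<Longrightarrow> b \<in> carrier B \<Longrightarrow> h (c \<odot>\<^bsub>B\<^esub> b) = c \<otimes>\<^bsub>K\<^esub> h b"
    "h \<one>\<^bsub>B\<^esub> = \<one>\<^bsub>K\<^esub>"
    using unit_functional[OF alg_right one] by blast
  have bil: "bilin K A B A (\<lambda>a b. h b \<odot>\<^bsub>A\<^esub> a)"
    unfolding bilin_def lin_map_def
    using h by (auto simp: A.smult_l_distr A.smult_r_distr A.smult_assoc1[symmetric] A.R.m_comm)
  note E_tens = tensor_lift_tens[OF mod_left bil]
  obtain a b where ab: "a \<in> carrier A" "p = a \<otimes>\<otimes> \<one>\<^bsub>B\<^esub>" "b \<in> carrier B" "p = \<one>\<^bsub>A\<^esub> \<otimes>\<otimes> b"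
    using p by (auto simp: left_part_def right_part_def)
  have "a = h b \<odot>\<^bsub>A\<^esub> \<one>\<^bsub>A\<^esub>"
    using E_tens[OF ab(1) BR.one_closed] E_tens[OF AR.one_closed ab(3)] ab(1,2,4) h(4) by simp
  then have "p = h b \<odot>\<^bsub>R\<^esub> \<one>\<^bsub>R\<^esub>"
    using ab h(1) by (simp add: tens_smult_left tensor_alg_simps)
  then show thesis using that h(1) ab(3) by blast
qed

end

section \<open>Twisted tensor products of twisted generalized Weyl algebras\<close>

text \<open>The situation of the theorem, with the abbreviations for the two algebras and their twisted tensor
  product written out.\<close>

locale tgwa_twisted_product =
  fixes K :: "'k ring" and R :: "('k, 'r) module" and S :: "('k, 's) module" and m n :: nat
    and \<sigma> :: "nat \<Rightarrow> 'r \<Rightarrow> 'r" and t :: "nat \<Rightarrow> 'r" and \<mu> :: "nat \<Rightarrow> nat \<Rightarrow> 'k"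
    and \<rho> :: "nat \<Rightarrow> 's \<Rightarrow> 's" and h :: "nat \<Rightarrow> 's" and \<nu> :: "nat \<Rightarrow> nat \<Rightarrow> 'k"
    and \<pi> :: "nat \<Rightarrow> ('r \<times> 's \<Rightarrow> 'k) set \<Rightarrow> ('r \<times> 's \<Rightarrow> 'k) set"
    and w :: "nat \<Rightarrow> ('r \<times> 's \<Rightarrow> 'k) set" and \<xi> :: "nat \<Rightarrow> nat \<Rightarrow> 'k" and \<tau>
  assumes datum_A: "tgw_datum K R m \<sigma> t" and mu: "unit_matrix K m \<mu>"
    and consistent_A: "consistent_datum K R m \<sigma> t \<mu>"
    and datum_B: "tgw_datum K S n \<rho> h" and nu: "unit_matrix K n \<nu>"
    and consistent_B: "consistent_datum K S n \<rho> h \<nu>"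
    and tau: "graded_twisting_map K (tgwa K R m \<sigma> t \<mu>) m (tgwa_comp K R m \<sigma> t \<mu>)
                (tgwa K S n \<rho> h \<nu>) n (tgwa_comp K S n \<rho> h \<nu>) \<tau>"
    and datum_C: "tgw_datum K (tensor_alg K R S) (m + n) \<pi> w" and xi: "unit_matrix K (m + n) \<xi>"
    and regular_C: "regular_datum (tensor_alg K R S) (m + n) w"
    and tgwa_C: "is_tgwa_over K (tensor_alg K R S) (m + n) \<pi> w \<xi>
          (twisted_tensor K (tgwa K R m \<sigma> t \<mu>) (tgwa K S n \<rho> h \<nu>) \<tau>)
          (tensor_map K (tgwa K R m \<sigma> t \<mu>) (tgwa K S n \<rho> h \<nu>)
             (tgwa_coef K R m \<sigma> t \<mu>) (tgwa_coef K S n \<rho> h \<nu>))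
          (joint_gens K (tgwa K R m \<sigma> t \<mu>) m (tgwa_gen K R m \<sigma> t \<mu>)
             (tgwa K S n \<rho> h \<nu>) (tgwa_gen K S n \<rho> h \<nu>))"
    and preserving_C: "factor_preserving K R m S n \<pi> (\<lambda>i. \<pi> (m + i))"
begin

sublocale A: tgw K R m \<sigma> t \<mu> by (rule tgw.intro) (rule datum_A, rule mu)
sublocale B: tgw K S n \<rho> h \<nu> by (rule tgw.intro) (rule datum_B, rule nu)

abbreviation "AA \<equiv> tgwa K R m \<sigma> t \<mu>"
abbreviation "cA \<equiv> tgwa_coef K R m \<sigma> t \<mu>"
abbreviation "gA \<equiv> tgwa_gen K R m \<sigma> t \<mu>"
abbreviation "BB \<equiv> tgwa K S n \<rho> h \<nu>"
abbreviation "cB \<equiv> tgwa_coef K S n \<rho> h \<nu>"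
abbreviation "gB \<equiv> tgwa_gen K S n \<rho> h \<nu>"
abbreviation "RS \<equiv> tensor_alg K R S"
abbreviation "CC \<equiv> twisted_tensor K AA BB \<tau>"
abbreviation "eta \<equiv> tensor_map K AA BB cA cB"
abbreviation "Z \<equiv> joint_gens K AA m gA BB gB"
abbreviation tenAB (infixl "\<otimes>\<otimes>" 75) where "a \<otimes>\<otimes> b \<equiv> tens K AA BB a b"
abbreviation tenRS (infixl "\<odot>\<odot>" 75) where "r \<odot>\<odot> s \<equiv> tens K R S r s"

abbreviation CC_mult (infixl "\<bullet>" 70) where "x \<bullet> y \<equiv> x \<otimes>\<^bsub>CC\<^esub> y"

sublocale rs: tensor_algebras K R S
  by (rule tensor_algebras.intro) (rule A.T_alg, rule B.T_alg)

sublocale tp: twisted_product K AA BB \<tau>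
  using tau by (intro twisted_product.intro tensor_algebras.intro twisted_product_axioms.intro
      A.AA_algebra B.AA_algebra) (simp add: graded_twisting_map_def)

sublocale J: tgw_rep K RS "m + n" \<pi> w \<xi> CC eta Z
  by (rule is_tgwa_over_rep[OF datum_C xi tp.twisted_module tgwa_C])

lemma eta_tens: "r \<in> carrier R \<Longrightarrow> s \<in> carrier S \<Longrightarrow> eta (r \<odot>\<odot> s) = cA r \<otimes>\<otimes> cB s"
  by (rule tensor_map_tens[OF rs.mod_left rs.mod_right tp.mod_left tp.mod_right A.rep.eta_lin B.rep.eta_lin])

lemma eta_inj: "inj_on eta (carrier RS)"
  unfolding rs.tensor_alg_simps(1)
  using tensor_map_inj[OF A.K_field rs.mod_left rs.mod_right tp.mod_left tp.mod_right A.rep.eta_lin _ B.rep.eta_lin]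
    consistent_A consistent_B by (simp add: consistent_datum_def)

lemma tensRS_closed [simp]: "r \<in> carrier R \<Longrightarrow> s \<in> carrier S \<Longrightarrow> r \<odot>\<odot> s \<in> carrier RS"
  by (simp add: rs.tensor_alg_simps)

lemma tensAB_closed [simp]: "a \<in> carrier AA \<Longrightarrow> b \<in> carrier BB \<Longrightarrow> a \<otimes>\<otimes> b \<in> carrier CC"
  by (simp add: tp.twisted_simps)

text \<open>The index, among the generators of the twisted tensor product, of the generator with index \<open>v\<close> of the
  second factor.\<close>

definition jt :: "int \<Rightarrow> int" where "jt v = sgn v * (\<bar>v\<bar> + int m)"

lemma jt_simps: "v \<in> pm n \<Longrightarrow> jt v \<in> pm (m + n)" "v \<in> pm n \<Longrightarrow> sgn (jt v) = sgn v"
  "v \<in> pm n \<Longrightarrow> \<bar>jt v\<bar> = \<bar>v\<bar> + int m" "jt (- v) = - jt v"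
  "v \<in> pm n \<Longrightarrow> nat \<bar>jt v\<bar> = m + nat \<bar>v\<bar>"
  by (auto simp: jt_def pm_def abs_mult sgn_mult sgn_minus sgn_if)

lemma pm_left: "u \<in> pm m \<Longrightarrow> u \<in> pm (m + n)"
  by (auto simp: pm_def)

lemma jt_neq: "u \<in> pm m \<Longrightarrow> v \<in> pm n \<Longrightarrow> jt v \<noteq> u" "u \<in> pm m \<Longrightarrow> v \<in> pm n \<Longrightarrow> jt v \<noteq> - u"
  using jt_simps(3)[of v] by (auto simp: pm_def)

lemma Z_left: "u \<in> pm m \<Longrightarrow> Z u = gA u \<otimes>\<otimes> \<one>\<^bsub>BB\<^esub>"
  by (simp add: joint_gens_def pm_def)

lemma Z_right: "v \<in> pm n \<Longrightarrow> Z (jt v) = \<one>\<^bsub>AA\<^esub> \<otimes>\<otimes> gB v"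
  using jt_simps(2,3)[of v] by (auto simp: joint_gens_def pm_def sgn_mult_abs)

lemma left_mult: "a \<in> carrier AA \<Longrightarrow> a' \<in> carrier AA \<Longrightarrow>
    (a \<otimes>\<otimes> \<one>\<^bsub>BB\<^esub>) \<bullet> (a' \<otimes>\<otimes> \<one>\<^bsub>BB\<^esub>) = (a \<otimes>\<^bsub>AA\<^esub> a') \<otimes>\<otimes> \<one>\<^bsub>BB\<^esub>"
  by (simp add: tp.twisted_mult_left)

lemma right_mult: "b \<in> carrier BB \<Longrightarrow> b' \<in> carrier BB \<Longrightarrow>
    (\<one>\<^bsub>AA\<^esub> \<otimes>\<otimes> b) \<bullet> (\<one>\<^bsub>AA\<^esub> \<otimes>\<otimes> b') = \<one>\<^bsub>AA\<^esub> \<otimes>\<otimes> (b \<otimes>\<^bsub>BB\<^esub> b')"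
  by (simp add: tp.twisted_mult_right)

lemma eta_left: "r \<in> carrier R \<Longrightarrow> eta (r \<odot>\<odot> \<one>\<^bsub>S\<^esub>) = cA r \<otimes>\<otimes> \<one>\<^bsub>BB\<^esub>"
  by (simp add: eta_tens B.rep.eta_one)

lemma eta_right: "s \<in> carrier S \<Longrightarrow> eta (\<one>\<^bsub>R\<^esub> \<odot>\<odot> s) = \<one>\<^bsub>AA\<^esub> \<otimes>\<otimes> cB s"
  by (simp add: eta_tens A.rep.eta_one)

lemma loop_left: assumes u: "u \<in> pm m" shows "J.loop u = A.rep.loop u \<odot>\<odot> \<one>\<^bsub>S\<^esub>"
proof -
  have "eta (J.loop u) = Z u \<bullet> Z (- u)" using J.Z_loop[OF pm_left[OF u]] ..
  also have "\<dots> = eta (A.rep.loop u \<odot>\<odot> \<one>\<^bsub>S\<^esub>)"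
    using u A.pm_uminus[OF u] by (simp add: Z_left left_mult A.rep.Z_loop eta_left)
  finally show ?thesis
    by (rule inj_onD[OF eta_inj]) (simp_all add: u pm_left)
qed

lemma loop_right: assumes v: "v \<in> pm n" shows "J.loop (jt v) = \<one>\<^bsub>R\<^esub> \<odot>\<odot> B.rep.loop v"
proof -
  have "eta (J.loop (jt v)) = Z (jt v) \<bullet> Z (- jt v)" using J.Z_loop[OF jt_simps(1)[OF v]] ..
  also have "\<dots> = eta (\<one>\<^bsub>R\<^esub> \<odot>\<odot> B.rep.loop v)"
    using v B.pm_uminus[OF v] by (simp add: jt_simps(4)[symmetric] Z_right right_mult B.rep.Z_loop eta_right)
  finally show ?thesis
    by (rule inj_onD[OF eta_inj]) (simp_all add: v jt_simps)
qed

lemma signed_auto_pos: "0 < u \<Longrightarrow> signed_auto T g u = g (nat u)"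
  by (simp add: signed_auto_def auto_zpow_one)

lemma pi_closed: "i \<in> {1..m + n} \<Longrightarrow> x \<in> carrier RS \<Longrightarrow> \<pi> i x \<in> carrier RS"
  by (rule bij_apply[OF J.bij])

text \<open>Moving \<open>r\<close> past \<open>X\<^sub>j\<close> can be done in \<open>A\<close>, with \<open>\<sigma> j\<close>, or in the twisted tensor product, with \<open>\<pi> j\<close>;
  cancelling the generator compares the two.\<close>

lemma pi_left:
  assumes j: "j \<in> {1..m}" and r: "r \<in> carrier R"
  shows "\<pi> j (r \<odot>\<odot> \<one>\<^bsub>S\<^esub>) = \<sigma> j r \<odot>\<odot> \<one>\<^bsub>S\<^esub>"
proof -
  let ?u = "int j"
  have u: "?u \<in> pm m" "0 < ?u" using j by auto
  have sr: "\<sigma> j r \<in> carrier R" by (rule bij_apply[OF A.bij[OF j] r])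
  have "eta (\<pi> j (r \<odot>\<odot> \<one>\<^bsub>S\<^esub>)) \<bullet> Z ?u = Z ?u \<bullet> eta (r \<odot>\<odot> \<one>\<^bsub>S\<^esub>)"
    using J.Z_coef[OF pm_left[OF u(1)], of "r \<odot>\<odot> \<one>\<^bsub>S\<^esub>"] r signed_auto_pos[OF u(2), of RS \<pi>] by simp
  also have "\<dots> = eta (\<sigma> j r \<odot>\<odot> \<one>\<^bsub>S\<^esub>) \<bullet> Z ?u"
    using u r sr A.rep.Z_coef[OF u(1) r] signed_auto_pos[OF u(2), of R \<sigma>]
    by (simp add: Z_left eta_left left_mult)
  finally show ?thesis
    using j r sr by (intro J.eta_Z_cancel[OF pm_left[OF u(1)] regular_C eta_inj]) (auto intro: pi_closed)
qed

lemma pi_right: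
  assumes i: "i \<in> {1..n}" and s: "s \<in> carrier S"
  shows "\<pi> (m + i) (\<one>\<^bsub>R\<^esub> \<odot>\<odot> s) = \<one>\<^bsub>R\<^esub> \<odot>\<odot> \<rho> i s"
proof -
  let ?v = "int i"
  have v: "?v \<in> pm n" "0 < ?v" using i by auto
  have jv: "0 < jt ?v" "nat (jt ?v) = m + i" using v by (simp_all add: jt_def sgn_if nat_add_distrib)
  have rs: "\<rho> i s \<in> carrier S" by (rule bij_apply[OF B.bij[OF i] s])
  have "eta (\<pi> (m + i) (\<one>\<^bsub>R\<^esub> \<odot>\<odot> s)) \<bullet> Z (jt ?v) = Z (jt ?v) \<bullet> eta (\<one>\<^bsub>R\<^esub> \<odot>\<odot> s)"
    using J.Z_coef[OF jt_simps(1)[OF v(1)], of "\<one>\<^bsub>R\<^esub> \<odot>\<odot> s"] s signed_auto_pos[OF jv(1), of RS \<pi>] jv(2) by simp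
  also have "\<dots> = eta (\<one>\<^bsub>R\<^esub> \<odot>\<odot> \<rho> i s) \<bullet> Z (jt ?v)"
    using v s rs B.rep.Z_coef[OF v(1) s] signed_auto_pos[OF v(2), of S \<rho>]
    by (simp add: Z_right eta_right right_mult)
  finally show ?thesis
    using i s rs by (intro J.eta_Z_cancel[OF jt_simps(1)[OF v(1)] regular_C eta_inj]) (auto intro: pi_closed)
qed

lemma pi_extensions: "commuting_extensions K R m \<sigma> S n \<rho> \<pi> (\<lambda>i. \<pi> (m + i))"
proof -
  have "alg_auto K RS (\<pi> i)" if "i \<in> {1..m + n}" for i using J.auto[OF that] .
  moreover have "commute_on (carrier RS) (\<pi> i) (\<pi> j)" if "i \<in> {1..m + n}" "j \<in> {1..m + n}" for i j
    using J.comm[OF that] .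
  ultimately show ?thesis
    unfolding commuting_extensions_def Let_def by (auto simp: pi_left pi_right)
qed

subsection \<open>Commutation of the generators of the two factors\<close>

lemma signed_unit_ZZ: "u \<in> pm k \<Longrightarrow> signed_unit u \<in> ZZ k"
  by (auto simp: ZZ_def signed_unit_def pm_def)

text \<open>The twisting map is graded and the product of two generators is its value at their tensor, so this
  product lies in the tensor product of two components that are generated by one element each.\<close>

lemma generator_exchange:
  assumes u: "u \<in> pm m" and v: "v \<in> pm n"
  obtains p where "p \<in> carrier RS" "Z (jt v) \<bullet> Z u = eta p \<bullet> (Z u \<bullet> Z (jt v))"
proof -
  let ?H = "(\<lambda>p. eta p \<bullet> (Z u \<bullet> Z (jt v))) ` carrier RS"
  have Zc: "Z u \<in> carrier CC" "Z (jt v) \<in> carrier CC" using u v by (simp_all add: pm_left jt_simps)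
  then have ZZc: "Z u \<bullet> Z (jt v) \<in> carrier CC" by simp
  have lin: "(\<lambda>p. eta p \<bullet> (Z u \<bullet> Z (jt v))) \<in> lin_map K RS CC"
    by (rule lin_map_comp[OF J.eta_lin alg_mult_linear(2)[OF J.C_algebra ZZc]])
  have H: "submodule ?H K (tensor_mod K AA BB)"
    using lin_map_image[OF lin[unfolded tp.twisted_lin]] k_algebraD(4)[OF J.T_algebra] tp.T_module by blast
  have "tensor_sub K AA BB (tgwa_comp K R m \<sigma> t \<mu> (signed_unit u)) (tgwa_comp K S n \<rho> h \<nu> (signed_unit v)) \<subseteq> ?H"
    unfolding tensor_sub_def
  proof (rule kspan_least[OF H], clarify)
    fix a b assume a: "a \<in> tgwa_comp K R m \<sigma> t \<mu> (signed_unit u)" and b: "b \<in> tgwa_comp K S n \<rho> h \<nu> (signed_unit v)"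
    obtain r where r: "r \<in> carrier R" "a = cA r \<otimes>\<^bsub>AA\<^esub> gA u" using A.tgwa_unit_component[OF u a] .
    obtain s where s: "s \<in> carrier S" "b = cB s \<otimes>\<^bsub>BB\<^esub> gB v" using B.tgwa_unit_component[OF v b] .
    let ?x = "signed_auto RS \<pi> u (\<one>\<^bsub>R\<^esub> \<odot>\<odot> s)"
    have x: "?x \<in> carrier RS" using s u by (intro J.signed_auto_closed) (auto simp: pm_left)
    have "a \<otimes>\<otimes> b = (a \<otimes>\<otimes> \<one>\<^bsub>BB\<^esub>) \<bullet> (\<one>\<^bsub>AA\<^esub> \<otimes>\<otimes> b)"
      using r s u v by (simp add: tp.twisted_mult_right)
    also have "\<dots> = (eta (r \<odot>\<odot> \<one>\<^bsub>S\<^esub>) \<bullet> Z u) \<bullet> (eta (\<one>\<^bsub>R\<^esub> \<odot>\<odot> s) \<bullet> Z (jt v))"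
      using r s u v by (simp add: eta_left eta_right Z_left Z_right left_mult right_mult)
    also have "\<dots> = eta (r \<odot>\<odot> \<one>\<^bsub>S\<^esub>) \<bullet> ((Z u \<bullet> eta (\<one>\<^bsub>R\<^esub> \<odot>\<odot> s)) \<bullet> Z (jt v))"
      using r s Zc by (simp add: J.C.m_assoc)
    also have "\<dots> = eta ((r \<odot>\<odot> \<one>\<^bsub>S\<^esub>) \<otimes>\<^bsub>RS\<^esub> ?x) \<bullet> (Z u \<bullet> Z (jt v))"
      using r s x Zc pm_left[OF u] by (simp add: J.Z_coef J.C.m_assoc J.eta_mult)
    finally show "a \<otimes>\<otimes> b \<in> ?H" using r x by (auto intro!: imageI)
  qed
  moreover have "Z (jt v) \<bullet> Z u = \<tau> (tens K BB AA (gB v) (gA u))"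
    using u v by (simp add: Z_left Z_right tp.twisted_mult_tau)
  moreover have "tens K BB AA (gB v) (gA u) \<in> tensor_sub K BB AA (tgwa_comp K S n \<rho> h \<nu> (signed_unit v)) (tgwa_comp K R m \<sigma> t \<mu> (signed_unit u))"
    unfolding tensor_sub_def using A.gen_in_comp[OF u] B.gen_in_comp[OF v]
    by (intro subsetD[OF kspan_base]) blast
  ultimately have "Z (jt v) \<bullet> Z u \<in> ?H"
    using tau signed_unit_ZZ[OF u] signed_unit_ZZ[OF v] unfolding graded_twisting_map_def by fastforce
  then show thesis using that by blast
qed

lemma factors_nontrivial:
  assumes "\<one>\<^bsub>RS\<^esub> \<noteq> \<zero>\<^bsub>RS\<^esub>" shows "\<one>\<^bsub>R\<^esub> \<noteq> \<zero>\<^bsub>R\<^esub>" "\<one>\<^bsub>S\<^esub> \<noteq> \<zero>\<^bsub>S\<^esub>"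
  using assms rs.tens_zero(1)[of "\<one>\<^bsub>S\<^esub>"] rs.tens_zero(2)[of "\<one>\<^bsub>R\<^esub>"] by (auto simp: rs.tensor_alg_simps)

lemma regular_nonzero:
  assumes "\<one>\<^bsub>RS\<^esub> \<noteq> \<zero>\<^bsub>RS\<^esub>" "regular_elem RS x" shows "x \<noteq> \<zero>\<^bsub>RS\<^esub>"
  using regular_elemD(2)[OF assms(2), of "\<one>\<^bsub>RS\<^esub>"] assms(1) by auto

text \<open>The second equation is recorded for the case of two negative signs. The hypothesis excludes the zero
  algebra, where no functional with value 1 at the unit exists.\<close>

lemma positive_exchange:
  assumes nt: "\<one>\<^bsub>RS\<^esub> \<noteq> \<zero>\<^bsub>RS\<^esub>" and u: "u \<in> pm m" "0 < u" and v: "v \<in> pm n" "0 < v"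
  obtains k d where "k \<in> carrier K" "k \<noteq> \<zero>\<^bsub>K\<^esub>" "d \<in> carrier K" "d \<noteq> \<zero>\<^bsub>K\<^esub>"
    "Z (jt v) \<bullet> Z u = k \<odot>\<^bsub>CC\<^esub> (Z u \<bullet> Z (jt v))"
    "d \<odot>\<^bsub>RS\<^esub> J.loop (jt v) = k \<odot>\<^bsub>RS\<^esub> \<pi> (nat u) (J.loop (jt v))"
proof -
  obtain p where p: "p \<in> carrier RS" "Z (jt v) \<bullet> Z u = eta p \<bullet> (Z u \<bullet> Z (jt v))"
    using generator_exchange[OF u(1) v(1)] .
  have sgn: "sgn (jt v) = sgn u" using u v by (simp add: jt_simps)
  have jv: "0 < jt v" "nat (jt v) = m + nat v" using v by (simp_all add: jt_def sgn_if nat_add_distrib)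
  note juv = pm_left[OF u(1)] jt_simps(1)[OF v(1)]
  have j: "nat u \<in> {1..m}" "nat v \<in> {1..n}" using u v A.rep.pm_nat(1) B.rep.pm_nat(1) by blast+
  let ?a = "A.rep.loop u" and ?b = "B.rep.loop v"
  have ab: "?a \<in> carrier R" "?b \<in> carrier S" using u v by simp_all
  note loops = loop_left[OF u(1)] loop_right[OF v(1)]
  obtain c d where cd: "c \<in> carrier K" "c \<noteq> \<zero>\<^bsub>K\<^esub>" "d \<in> carrier K" "d \<noteq> \<zero>\<^bsub>K\<^esub>"
    "\<pi> (m + nat v) (J.loop u) = c \<odot>\<^bsub>RS\<^esub> (p \<otimes>\<^bsub>RS\<^esub> J.loop u)"
    "d \<odot>\<^bsub>RS\<^esub> J.loop (jt v) = p \<otimes>\<^bsub>RS\<^esub> \<pi> (nat u) (J.loop (jt v))"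
    using J.exchange[OF juv sgn jt_neq(1)[OF u(1) v(1)] regular_C eta_inj p]
      signed_auto_pos[OF u(2), of RS \<pi>] signed_auto_pos[OF jv(1), of RS \<pi>] jv(2) by metis
  have "J.loop u \<in> left_part K R S"
    unfolding loops left_part_def using ab by blast
  then have "\<pi> (m + nat v) (J.loop u) \<in> left_part K R S"
    using preserving_C j(2) unfolding factor_preserving_def by blast
  then obtain a1 where a1: "a1 \<in> carrier R" "\<pi> (m + nat v) (J.loop u) = a1 \<odot>\<odot> \<one>\<^bsub>S\<^esub>"
    unfolding left_part_def by blast
  have "J.loop (jt v) \<in> right_part K R S"
    unfolding loops right_part_def using ab by blast
  then have "\<pi> (nat u) (J.loop (jt v)) \<in> right_part K R S"
    using preserving_C j(1) unfolding factor_preserving_def by blast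
  then obtain b1 where b1: "b1 \<in> carrier S" "\<pi> (nat u) (J.loop (jt v)) = \<one>\<^bsub>R\<^esub> \<odot>\<odot> b1"
    unfolding right_part_def by blast
  have pl: "p \<otimes>\<^bsub>RS\<^esub> J.loop u \<in> carrier RS" using p juv by simp
  note inv_c = J.TM.smult_solve[OF A.K_field cd(1,2) pl cd(5)[symmetric]]
  have left: "p \<in> left_part K R S"
  proof (rule rs.left_part_divide[OF J.T_algebra factors_nontrivial(2)[OF nt] _ ab(1) _ p(1)])
    show "regular_elem RS (?a \<odot>\<odot> \<one>\<^bsub>S\<^esub>)" using J.loop_regular[OF regular_C juv(1)] loops by simp
    show "(inv\<^bsub>K\<^esub> c) \<odot>\<^bsub>R\<^esub> a1 \<in> carrier R" using a1 inv_c by simp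
    show "p \<otimes>\<^bsub>RS\<^esub> (?a \<odot>\<odot> \<one>\<^bsub>S\<^esub>) = ((inv\<^bsub>K\<^esub> c) \<odot>\<^bsub>R\<^esub> a1) \<odot>\<odot> \<one>\<^bsub>S\<^esub>"
      using inv_c a1 loops by (simp add: rs.tens_smult_left rs.tensor_alg_simps)
  qed
  have right: "p \<in> right_part K R S"
  proof (rule rs.right_part_divide[OF J.T_algebra factors_nontrivial(1)[OF nt] _ b1(1) _ p(1)])
    have i: "nat u \<in> {1..m + n}" using j by simp
    show "regular_elem RS (\<one>\<^bsub>R\<^esub> \<odot>\<odot> b1)"
      using regular_elem_auto[OF J.T.ring_axioms alg_autoD(1,2)[OF J.auto[OF i]] J.loop_regular[OF regular_C juv(2)]] b1
      by simp
    show "d \<odot>\<^bsub>S\<^esub> ?b \<in> carrier S" using ab cd by simp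
    show "p \<otimes>\<^bsub>RS\<^esub> (\<one>\<^bsub>R\<^esub> \<odot>\<odot> b1) = \<one>\<^bsub>R\<^esub> \<odot>\<odot> (d \<odot>\<^bsub>S\<^esub> ?b)"
      using cd(3) cd(6)[symmetric] b1 ab loops by (simp add: rs.tens_smult_right rs.tensor_alg_simps)
  qed
  obtain k where k: "k \<in> carrier K" "p = k \<odot>\<^bsub>RS\<^esub> \<one>\<^bsub>RS\<^esub>"
    using rs.left_part_Int_right_part[OF factors_nontrivial(2)[OF nt] left right] .
  have lv: "J.loop (jt v) \<in> carrier RS" "\<pi> (nat u) (J.loop (jt v)) \<in> carrier RS"
    using juv b1 by simp_all
  have eq: "d \<odot>\<^bsub>RS\<^esub> J.loop (jt v) = k \<odot>\<^bsub>RS\<^esub> \<pi> (nat u) (J.loop (jt v))"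
    using cd(6) k lv k_algebraD(5)[OF J.T_algebra, of k "\<one>\<^bsub>RS\<^esub>"] by simp
  have "k \<noteq> \<zero>\<^bsub>K\<^esub>"
  proof
    assume "k = \<zero>\<^bsub>K\<^esub>"
    then have "d \<odot>\<^bsub>RS\<^esub> J.loop (jt v) = \<zero>\<^bsub>RS\<^esub>" using eq lv by simp
    from J.TM.smult_solve[OF A.K_field cd(3,4) lv(1) this] have "J.loop (jt v) = \<zero>\<^bsub>RS\<^esub>" by simp
    then show False using regular_nonzero[OF nt J.loop_regular[OF regular_C juv(2)]] by simp
  qed
  moreover have "Z (jt v) \<bullet> Z u = k \<odot>\<^bsub>CC\<^esub> (Z u \<bullet> Z (jt v))"
    using p(2) k juv by (simp add: J.eta_scalar)
  ultimately show thesis using that k(1) cd(3,4) eq by blast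
qed

lemma K_one: "\<one>\<^bsub>K\<^esub> \<in> carrier K"
  by simp

lemma K_integral: "a \<otimes>\<^bsub>K\<^esub> b = \<zero>\<^bsub>K\<^esub> \<Longrightarrow> a \<in> carrier K \<Longrightarrow> b \<in> carrier K \<Longrightarrow> a = \<zero>\<^bsub>K\<^esub> \<or> b = \<zero>\<^bsub>K\<^esub>"
  by (rule domain.integral[OF field.axioms(1)[OF A.K_field]])

lemma scalar_exchange:
  assumes u: "u \<in> pm m" and v: "v \<in> pm n"
  shows "\<exists>c \<in> carrier K. c \<noteq> \<zero>\<^bsub>K\<^esub> \<and> Z (jt v) \<bullet> Z u = c \<odot>\<^bsub>CC\<^esub> (Z u \<bullet> Z (jt v))"
proof -
  note juv = pm_left[OF u] jt_simps(1)[OF v]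
  consider "\<one>\<^bsub>RS\<^esub> = \<zero>\<^bsub>RS\<^esub>" | "sgn v = - sgn u" | "\<one>\<^bsub>RS\<^esub> \<noteq> \<zero>\<^bsub>RS\<^esub>" "0 < u" "0 < v"
    | "\<one>\<^bsub>RS\<^esub> \<noteq> \<zero>\<^bsub>RS\<^esub>" "u < 0" "v < 0"
    using u v by (cases "0 < u"; cases "0 < v") (auto simp: pm_def)
  then show ?thesis
  proof cases
    \<comment> \<open>In the zero algebra every scalar will do.\<close>
    case 1
    have one: "\<one>\<^bsub>CC\<^esub> = \<zero>\<^bsub>CC\<^esub>"
      using J.eta_one lin_map_zero[OF J.eta_lin k_algebraD(4)[OF J.T_algebra] k_algebraD(4)[OF J.C_algebra]] 1 by simp
    have "x = \<zero>\<^bsub>CC\<^esub>" if "x \<in> carrier CC" for x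
      using J.C.l_one[OF that] that unfolding one by simp
    then have "Z (jt v) \<bullet> Z u = \<one>\<^bsub>K\<^esub> \<odot>\<^bsub>CC\<^esub> (Z u \<bullet> Z (jt v))"
      using J.C.m_closed[OF J.Z_closed[OF juv(2)] J.Z_closed[OF juv(1)]]
        J.CM.smult_closed[OF K_one J.C.m_closed[OF J.Z_closed[OF juv(1)] J.Z_closed[OF juv(2)]]] by metis
    then show ?thesis by (intro bexI[of _ "\<one>\<^bsub>K\<^esub>"]) auto
  next
    case 2
    have s: "sgn u = - sgn (jt v)" using 2 v by (simp add: jt_simps)
    have n: "u \<noteq> - jt v" using jt_neq(2)[OF u v] by auto
    show ?thesis using J.Z_swap[OF juv(2,1) s n] by metis
  next
    case 3
    then show ?thesis using positive_exchange[OF 3(1) u 3(2) v 3(3)] by metis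
  next
    case 4
    \<comment> \<open>The positive case for \<open>- u\<close> and \<open>- v\<close> yields that \<open>?\<phi>\<close> multiplies \<open>?l\<close> by a scalar \<open>?e\<close>. Then
      \<open>exchange\<close> reads \<open>d' ?l = ?e p ?l\<close>, and \<open>?l\<close> is regular.\<close>
    have nu: "- u \<in> pm m" "0 < - u" and nv: "- v \<in> pm n" "0 < - v"
      using u v 4 A.pm_uminus B.pm_uminus by auto
    note jn = jt_simps(1)[OF nv(1)]
    obtain k d where kd: "k \<in> carrier K" "k \<noteq> \<zero>\<^bsub>K\<^esub>" "d \<in> carrier K" "d \<noteq> \<zero>\<^bsub>K\<^esub>"
      "d \<odot>\<^bsub>RS\<^esub> J.loop (jt (- v)) = k \<odot>\<^bsub>RS\<^esub> \<pi> (nat (- u)) (J.loop (jt (- v)))"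
      using positive_exchange[OF 4(1) nu nv] by metis
    obtain p where p: "p \<in> carrier RS" "Z (jt v) \<bullet> Z u = eta p \<bullet> (Z u \<bullet> Z (jt v))"
      using generator_exchange[OF u v] .
    have sgn: "sgn (jt v) = sgn u" using 4 v by (simp add: jt_simps)
    let ?\<phi> = "signed_auto RS \<pi> u" and ?l = "J.loop (jt v)"
    have l: "?l \<in> carrier RS" using juv by simp
    have \<phi>l: "?\<phi> ?l \<in> carrier RS" by (rule J.signed_auto_closed[OF juv(1) l])
    obtain d' where d': "d' \<in> carrier K" "d' \<noteq> \<zero>\<^bsub>K\<^esub>" "d' \<odot>\<^bsub>RS\<^esub> ?l = p \<otimes>\<^bsub>RS\<^esub> ?\<phi> ?l"
      using J.exchange[OF juv sgn jt_neq(1)[OF u v] regular_C eta_inj p] by metis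
    have i: "nat (- u) \<in> {1..m + n}" using A.rep.pm_nat(2)[OF u 4(2)] by simp
    have jv: "0 < jt (- v)" using nv by (simp add: jt_def sgn_if)
    have i': "nat (jt (- v)) \<in> {1..m + n}" by (rule J.pm_nat(1)[OF jn jv])
    let ?f = "\<pi> (nat (- u))" and ?g = "\<pi> (nat (jt (- v)))"
    have ln: "J.loop (jt (- v)) = ?g ?l"
      using J.loop_uminus[OF jn jv] by (simp add: jt_simps(4))
    have fl: "?f ?l \<in> carrier RS" "?g ?l \<in> carrier RS" using l i i' pi_closed by auto
    note f_lin = lin_mapD(3)[OF alg_autoD(3)[OF J.auto[OF i]]] and g_lin = lin_mapD(3)[OF alg_autoD(3)[OF J.auto[OF i']]]
    have "?g (d \<odot>\<^bsub>RS\<^esub> ?l) = d \<odot>\<^bsub>RS\<^esub> ?g ?l" by (rule g_lin[OF kd(3) l])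
    also have "\<dots> = k \<odot>\<^bsub>RS\<^esub> ?f (?g ?l)" using kd(5) ln by simp
    also have "?f (?g ?l) = ?g (?f ?l)" using J.comm[OF i i'] l by (simp add: commute_on_def)
    also have "k \<odot>\<^bsub>RS\<^esub> ?g (?f ?l) = ?g (k \<odot>\<^bsub>RS\<^esub> ?f ?l)" by (rule g_lin[OF kd(1) fl(1), symmetric])
    finally have dk: "d \<odot>\<^bsub>RS\<^esub> ?l = k \<odot>\<^bsub>RS\<^esub> ?f ?l"
      by (rule inj_onD[OF bij_betw_imp_inj_on[OF J.bij[OF i']]]) (simp_all add: kd l fl)
    have f\<phi>: "?f (?\<phi> ?l) = ?l"
      using J.signed_auto_uminus[OF pm_left[OF nu(1)] l] signed_auto_pos[OF nu(2), of RS \<pi>] by simp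
    have \<phi>f: "?\<phi> (?f ?l) = ?l"
      using J.signed_auto_uminus[OF juv(1) l] signed_auto_pos[OF nu(2), of RS \<pi>] by simp
    have "?f (d \<odot>\<^bsub>RS\<^esub> ?\<phi> ?l) = ?f (k \<odot>\<^bsub>RS\<^esub> ?l)"
      using f_lin[OF kd(3) \<phi>l] f_lin[OF kd(1) l] dk f\<phi> by simp
    then have "d \<odot>\<^bsub>RS\<^esub> ?\<phi> ?l = k \<odot>\<^bsub>RS\<^esub> ?l"
      by (rule inj_onD[OF bij_betw_imp_inj_on[OF J.bij[OF i]]]) (simp_all add: kd l \<phi>l)
    note sol = J.TM.smult_solve[OF A.K_field kd(3,4) \<phi>l this]
    let ?e = "inv\<^bsub>K\<^esub> d \<otimes>\<^bsub>K\<^esub> k"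
    have e: "?e \<in> carrier K" "?e \<noteq> \<zero>\<^bsub>K\<^esub>" using sol(2,3) kd K_integral by auto
    have \<phi>e: "?\<phi> ?l = ?e \<odot>\<^bsub>RS\<^esub> ?l" using sol kd l by (simp add: J.TM.smult_assoc1)
    have "(?e \<odot>\<^bsub>RS\<^esub> p) \<otimes>\<^bsub>RS\<^esub> ?l = (d' \<odot>\<^bsub>RS\<^esub> \<one>\<^bsub>RS\<^esub>) \<otimes>\<^bsub>RS\<^esub> ?l"
      using d'(3) \<phi>e e d' p l by (simp add: k_algebraD(5,6)[OF J.T_algebra])
    then have "?e \<odot>\<^bsub>RS\<^esub> p = d' \<odot>\<^bsub>RS\<^esub> \<one>\<^bsub>RS\<^esub>"
      by (rule regular_elem_cancel[OF J.T.ring_axioms J.loop_regular[OF regular_C juv(2)], rotated 2])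
        (simp_all add: e p d')
    note sol' = J.TM.smult_solve[OF A.K_field e p(1) this]
    let ?c = "inv\<^bsub>K\<^esub> ?e \<otimes>\<^bsub>K\<^esub> d'"
    have c: "?c \<in> carrier K" "?c \<noteq> \<zero>\<^bsub>K\<^esub>" using sol'(2,3) d' K_integral by auto
    have "p = ?c \<odot>\<^bsub>RS\<^esub> \<one>\<^bsub>RS\<^esub>" using sol' d' by (simp add: J.TM.smult_assoc1)
    then have "Z (jt v) \<bullet> Z u = ?c \<odot>\<^bsub>CC\<^esub> (Z u \<bullet> Z (jt v))"
      using p(2) c juv by (simp add: J.eta_scalar)
    then show ?thesis using c by blast
  qed
qed


lemma left_rep: "tgw_rep K RS m \<pi> w \<xi> CC eta Z"
proof
  show "tgw_datum K RS m \<pi> w" using datum_C by (simp add: tgw_datum_def)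
  show "unit_matrix K m \<xi>" using xi by (simp add: unit_matrix_def)
qed (auto simp: J.C_algebra J.eta_hom J.eta_lin pm_left J.Z_coef J.Z_minus_plus J.Z_plus_minus J.Z_cross)

lemma jt_int: "i \<in> {1..n} \<Longrightarrow> jt (int i) = int (m + i)" "i \<in> {1..n} \<Longrightarrow> jt (- int i) = - int (m + i)"
  by (simp_all add: jt_def sgn_if)

lemma right_rep:
  "tgw_rep K RS n (\<lambda>i. \<pi> (m + i)) (\<lambda>i. w (m + i)) (\<lambda>i j. \<xi> (m + i) (m + j)) CC eta (\<lambda>v. Z (jt v))"
proof
  show "tgw_datum K RS n (\<lambda>i. \<pi> (m + i)) (\<lambda>i. w (m + i))" using datum_C by (simp add: tgw_datum_def)
  show "unit_matrix K n (\<lambda>i j. \<xi> (m + i) (m + j))" using xi by (simp add: unit_matrix_def)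
  fix v r assume v: "v \<in> pm n" and r: "r \<in> carrier RS"
  have "signed_auto RS \<pi> (jt v) = signed_auto RS (\<lambda>i. \<pi> (m + i)) v"
    by (simp only: signed_auto_def jt_simps(2,5)[OF v])
  then show "Z (jt v) \<bullet> eta r = eta (signed_auto RS (\<lambda>i. \<pi> (m + i)) v r) \<bullet> Z (jt v)"
    using J.Z_coef[OF jt_simps(1)[OF v] r] by simp
next
  fix i assume i: "i \<in> {1..n}"
  have mi: "m + i \<in> {1..m + n}" using i by simp
  show "Z (jt (- int i)) \<bullet> Z (jt (int i)) = eta (w (m + i))"
    using J.Z_minus_plus[OF mi] i by (simp only: jt_int)
  show "Z (jt (int i)) \<bullet> Z (jt (- int i)) = eta (\<pi> (m + i) (w (m + i)))"
    using J.Z_plus_minus[OF mi] i by (simp only: jt_int)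
  fix j assume j: "j \<in> {1..n}" "i \<noteq> j"
  have mj: "m + j \<in> {1..m + n}" "m + i \<noteq> m + j" using j by simp_all
  show "Z (jt (int i)) \<bullet> Z (jt (- int j)) = \<xi> (m + i) (m + j) \<odot>\<^bsub>CC\<^esub> (Z (jt (- int j)) \<bullet> Z (jt (int i)))"
    using J.Z_cross[OF mi mj] i j(1) by (simp only: jt_int)
qed (auto simp: J.C_algebra J.eta_hom J.eta_lin jt_simps)

abbreviation "xs us \<equiv> list_prod CC (map Z us)"
abbreviation "ys vs \<equiv> list_prod CC (map (\<lambda>v. Z (jt v)) vs)"

lemma xs_closed [simp]: "set us \<subseteq> pm m \<Longrightarrow> xs us \<in> carrier CC"
  by (rule tgw_rep.Zs_closed[OF left_rep])

lemma ys_closed [simp]: "set vs \<subseteq> pm n \<Longrightarrow> ys vs \<in> carrier CC"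
  by (rule tgw_rep.Zs_closed[OF right_rep])

lemma left_word: "set us \<subseteq> pm m \<Longrightarrow>
    list_prod AA (map gA us) \<in> carrier AA \<and> list_prod AA (map gA us) \<otimes>\<otimes> \<one>\<^bsub>BB\<^esub> = xs us"
  by (induction us) (auto simp: list_prod_Nil list_prod_Cons tp.twisted_simps(5) Z_left left_mult[symmetric])

lemma right_word: "set vs \<subseteq> pm n \<Longrightarrow>
    list_prod BB (map gB vs) \<in> carrier BB \<and> \<one>\<^bsub>AA\<^esub> \<otimes>\<otimes> list_prod BB (map gB vs) = ys vs"
  by (induction vs) (auto simp: list_prod_Nil list_prod_Cons tp.twisted_simps(5) Z_right right_mult[symmetric])

definition scalars where "scalars = (\<lambda>k. k \<odot>\<^bsub>RS\<^esub> \<one>\<^bsub>RS\<^esub>) ` carrier K"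

lemma scalars_closed: "x \<in> scalars \<Longrightarrow> x \<in> carrier RS"
  by (auto simp: scalars_def)

lemma RS_smult: "c \<in> carrier K \<Longrightarrow> x \<in> carrier RS \<Longrightarrow> (c \<odot>\<^bsub>RS\<^esub> \<one>\<^bsub>RS\<^esub>) \<otimes>\<^bsub>RS\<^esub> x = c \<odot>\<^bsub>RS\<^esub> x"
  "c \<in> carrier K \<Longrightarrow> x \<in> carrier RS \<Longrightarrow> x \<otimes>\<^bsub>RS\<^esub> (c \<odot>\<^bsub>RS\<^esub> \<one>\<^bsub>RS\<^esub>) = c \<odot>\<^bsub>RS\<^esub> x"
  by (simp_all add: k_algebraD(5,6)[OF J.T_algebra])

lemma scalars_list_prod: "set zs \<subseteq> scalars \<Longrightarrow> list_prod RS zs \<in> scalars"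
proof (induction zs)
  case Nil
  have "\<one>\<^bsub>RS\<^esub> = \<one>\<^bsub>K\<^esub> \<odot>\<^bsub>RS\<^esub> \<one>\<^bsub>RS\<^esub>" by simp
  then show ?case unfolding list_prod_Nil scalars_def using K_one by (rule image_eqI)
next
  case (Cons z zs)
  then obtain k l where k: "k \<in> carrier K" "z = k \<odot>\<^bsub>RS\<^esub> \<one>\<^bsub>RS\<^esub>"
    and l: "l \<in> carrier K" "list_prod RS zs = l \<odot>\<^bsub>RS\<^esub> \<one>\<^bsub>RS\<^esub>" by (auto simp: scalars_def)
  have "list_prod RS (z # zs) = (k \<otimes>\<^bsub>K\<^esub> l) \<odot>\<^bsub>RS\<^esub> \<one>\<^bsub>RS\<^esub>"
    unfolding list_prod_Cons k(2) l(2)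
    using RS_smult(1)[OF k(1), of "l \<odot>\<^bsub>RS\<^esub> \<one>\<^bsub>RS\<^esub>"] k(1) l(1) by (simp add: J.TM.smult_assoc1)
  then show ?case using k l unfolding scalars_def by (auto intro!: imageI)
qed

lemma scalars_central: "x \<in> scalars \<Longrightarrow> y \<in> carrier CC \<Longrightarrow> y \<bullet> eta x = eta x \<bullet> y"
  using lin_mapD(3)[OF J.eta_lin, of _ "\<one>\<^bsub>RS\<^esub>"] unfolding scalars_def
  by (auto simp: J.eta_one k_algebraD(5,6)[OF J.C_algebra])

text \<open>Interchanging two words interchanges each letter of one with each letter of the other; the factors are
  scalars, so they can be collected in front in any order.\<close>

lemma word_exchange:
  assumes q: "\<And>u v. u \<in> pm m \<Longrightarrow> v \<in> pm n \<Longrightarrow> q v u \<in> scalars \<and> Z (jt v) \<bullet> Z u = eta (q v u) \<bullet> (Z u \<bullet> Z (jt v))"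
    and us: "set us \<subseteq> pm m" and vs: "set vs \<subseteq> pm n"
  shows "ys vs \<bullet> xs us = eta (q_prod RS q vs us) \<bullet> (xs us \<bullet> ys vs) \<and> q_prod RS q vs us \<in> scalars"
  using vs
proof (induction vs)
  case Nil
  have "list_prod RS [] \<in> scalars" by (rule scalars_list_prod) simp
  then show ?case using us by (simp add: q_prod_def list_prod_Nil J.eta_one)
next
  case (Cons v vs)
  then have v: "v \<in> pm n" "set vs \<subseteq> pm n" by auto
  have Zv: "Z (jt v) \<in> carrier CC" using v by (simp add: jt_simps)
  define l where "l = (\<lambda>us. list_prod RS (map (q v) us))"
  have l: "Z (jt v) \<bullet> xs us = eta (l us) \<bullet> (xs us \<bullet> Z (jt v)) \<and> l us \<in> scalars" if "set us \<subseteq> pm m" for us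
    using that
  proof (induction us)
    case Nil
    have "list_prod RS [] \<in> scalars" by (rule scalars_list_prod) simp
    then show ?case using Zv by (simp add: l_def list_prod_Nil J.eta_one)
  next
    case (Cons u us)
    then have u: "u \<in> pm m" "set us \<subseteq> pm m" and IH: "Z (jt v) \<bullet> xs us = eta (l us) \<bullet> (xs us \<bullet> Z (jt v))" "l us \<in> scalars"
      by auto
    have Zu: "Z u \<in> carrier CC" using u by (simp add: pm_left)
    have quv: "q v u \<in> scalars" "Z (jt v) \<bullet> Z u = eta (q v u) \<bullet> (Z u \<bullet> Z (jt v))"
      using q[OF u(1) v(1)] by auto
    note c = scalars_closed[OF quv(1)] scalars_closed[OF IH(2)]
    have "Z (jt v) \<bullet> xs (u # us) = (Z (jt v) \<bullet> Z u) \<bullet> xs us"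
      using u Zu Zv by (simp add: list_prod_Cons J.C.m_assoc)
    also have "\<dots> = eta (q v u) \<bullet> (Z u \<bullet> (Z (jt v) \<bullet> xs us))"
      unfolding quv(2) using u Zu Zv c by (simp add: J.C.m_assoc)
    also have "\<dots> = eta (q v u) \<bullet> ((Z u \<bullet> eta (l us)) \<bullet> (xs us \<bullet> Z (jt v)))"
      unfolding IH(1) using u Zu Zv c by (simp add: J.C.m_assoc)
    also have "\<dots> = eta (l (u # us)) \<bullet> (xs (u # us) \<bullet> Z (jt v))"
      unfolding scalars_central[OF IH(2) Zu] using u Zu Zv c
      by (simp add: l_def list_prod_Cons J.eta_mult J.C.m_assoc)
    finally have "Z (jt v) \<bullet> xs (u # us) = eta (l (u # us)) \<bullet> (xs (u # us) \<bullet> Z (jt v))" .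
    moreover have "l (u # us) \<in> scalars"
      unfolding l_def using q[OF _ v(1)] Cons.prems by (intro scalars_list_prod) auto
    ultimately show ?case by simp
  qed
  have IH: "ys vs \<bullet> xs us = eta (q_prod RS q vs us) \<bullet> (xs us \<bullet> ys vs)" "q_prod RS q vs us \<in> scalars"
    using Cons v by auto
  have qs: "set (map (q v) us) \<subseteq> scalars" "set (concat (map (\<lambda>v. map (q v) us) vs)) \<subseteq> scalars"
    using q us v by auto
  have lus: "l us \<in> scalars" unfolding l_def by (rule scalars_list_prod[OF qs(1)])
  have ql: "q_prod RS q (v # vs) us = l us \<otimes>\<^bsub>RS\<^esub> q_prod RS q vs us"
    using J.T.list_prod_append[of "map (q v) us" "concat (map (\<lambda>v. map (q v) us) vs)"] qs scalars_closed
    by (auto simp: q_prod_def l_def)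
  note c = scalars_closed[OF lus] scalars_closed[OF IH(2)]
  have "ys (v # vs) \<bullet> xs us = Z (jt v) \<bullet> (ys vs \<bullet> xs us)"
    using v us Zv by (simp add: list_prod_Cons J.C.m_assoc)
  also have "\<dots> = (Z (jt v) \<bullet> eta (q_prod RS q vs us)) \<bullet> (xs us \<bullet> ys vs)"
    unfolding IH(1) using v us Zv c by (simp add: J.C.m_assoc)
  also have "\<dots> = eta (q_prod RS q vs us) \<bullet> ((Z (jt v) \<bullet> xs us) \<bullet> ys vs)"
    unfolding scalars_central[OF IH(2) Zv] using v us Zv c by (simp add: J.C.m_assoc)
  also have "\<dots> = (eta (q_prod RS q vs us) \<bullet> eta (l us)) \<bullet> (xs us \<bullet> ys (v # vs))"
    unfolding conjunct1[OF l[OF us]] using v us Zv c by (simp add: list_prod_Cons J.C.m_assoc)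
  also have "eta (q_prod RS q vs us) \<bullet> eta (l us) = eta (q_prod RS q (v # vs) us)"
    unfolding ql using scalars_central[OF lus J.eta_closed[OF c(2)]] c by (simp add: J.eta_mult)
  finally have "ys (v # vs) \<bullet> xs us = eta (q_prod RS q (v # vs) us) \<bullet> (xs us \<bullet> ys (v # vs))" .
  moreover have "q_prod RS q (v # vs) us \<in> scalars"
    unfolding q_prod_def using q us Cons.prems by (intro scalars_list_prod) auto
  ultimately show ?case by simp
qed

text \<open>The elements of \<open>R \<otimes> S\<close> that commute with \<open>1 \<otimes> S\<close> are stable under the \<open>\<pi> (m + i)\<close> and their
  inverses, because these permute \<open>1 \<otimes> S\<close>; and \<open>r \<otimes> 1\<close> is one of them. For
  negative exponents this works without deciding whether the inverses preserve \<open>R \<otimes> 1\<close>.\<close>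

lemma multi_pow_commutes:
  assumes r: "r \<in> carrier R" and s: "s \<in> carrier S"
  shows "multi_pow RS n (\<lambda>i. \<pi> (m + i)) \<alpha> (r \<odot>\<odot> \<one>\<^bsub>S\<^esub>) \<otimes>\<^bsub>RS\<^esub> (\<one>\<^bsub>R\<^esub> \<odot>\<odot> s)
    = (\<one>\<^bsub>R\<^esub> \<odot>\<odot> s) \<otimes>\<^bsub>RS\<^esub> multi_pow RS n (\<lambda>i. \<pi> (m + i)) \<alpha> (r \<odot>\<odot> \<one>\<^bsub>S\<^esub>)"
proof -
  interpret Q: tgw_rep K RS n "\<lambda>i. \<pi> (m + i)" "\<lambda>i. w (m + i)" "\<lambda>i j. \<xi> (m + i) (m + j)" CC eta "\<lambda>v. Z (jt v)"
    by (rule right_rep)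
  let ?U = "{x \<in> carrier RS. \<forall>s\<in>carrier S. x \<otimes>\<^bsub>RS\<^esub> (\<one>\<^bsub>R\<^esub> \<odot>\<odot> s) = (\<one>\<^bsub>R\<^esub> \<odot>\<odot> s) \<otimes>\<^bsub>RS\<^esub> x}"
  have "multi_pow RS n (\<lambda>i. \<pi> (m + i)) \<alpha> (r \<odot>\<odot> \<one>\<^bsub>S\<^esub>) \<in> ?U"
  proof (rule Q.multi_pow_invariant)
    fix i x assume i: "i \<in> {1..n}" and x: "x \<in> ?U"
    let ?f = "\<pi> (m + i)" and ?g = "inv_into (carrier RS) (\<pi> (m + i))"
    have mi: "m + i \<in> {1..m + n}" using i by simp
    note bij = J.bij[OF mi] and hom = alg_autoD(1)[OF J.auto[OF mi]]
    have xc: "x \<in> carrier RS" and xs: "\<And>s. s \<in> carrier S \<Longrightarrow> x \<otimes>\<^bsub>RS\<^esub> (\<one>\<^bsub>R\<^esub> \<odot>\<odot> s) = (\<one>\<^bsub>R\<^esub> \<odot>\<odot> s) \<otimes>\<^bsub>RS\<^esub> x"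
      using x by auto
    have "?f x \<otimes>\<^bsub>RS\<^esub> (\<one>\<^bsub>R\<^esub> \<odot>\<odot> s) = (\<one>\<^bsub>R\<^esub> \<odot>\<odot> s) \<otimes>\<^bsub>RS\<^esub> ?f x" if s: "s \<in> carrier S" for s
    proof -
      let ?s = "inv_into (carrier S) (\<rho> i) s"
      have s': "?s \<in> carrier S" "\<rho> i ?s = s"
        using inv_into_apply[OF B.bij[OF i] s] inv_into_cancel(1)[OF B.bij[OF i] s] by auto
      have "?f (x \<otimes>\<^bsub>RS\<^esub> (\<one>\<^bsub>R\<^esub> \<odot>\<odot> ?s)) = ?f ((\<one>\<^bsub>R\<^esub> \<odot>\<odot> ?s) \<otimes>\<^bsub>RS\<^esub> x)" using xs s' by simp
      then show ?thesis
        using s' xc by (simp add: ring_hom_mult[OF hom] pi_right[OF i])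
    qed
    then show "?f x \<in> ?U" using pi_closed[OF mi xc] by simp
    note gx = inv_into_apply[OF bij xc] inv_into_cancel(1)[OF bij xc]
    have "?g x \<otimes>\<^bsub>RS\<^esub> (\<one>\<^bsub>R\<^esub> \<odot>\<odot> s) = (\<one>\<^bsub>R\<^esub> \<odot>\<odot> s) \<otimes>\<^bsub>RS\<^esub> ?g x" if s: "s \<in> carrier S" for s
    proof (rule inj_onD[OF bij_betw_imp_inj_on[OF bij]])
      have "\<rho> i s \<in> carrier S" by (rule bij_apply[OF B.bij[OF i] s])
      then show "?f (?g x \<otimes>\<^bsub>RS\<^esub> (\<one>\<^bsub>R\<^esub> \<odot>\<odot> s)) = ?f ((\<one>\<^bsub>R\<^esub> \<odot>\<odot> s) \<otimes>\<^bsub>RS\<^esub> ?g x)"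
        using s gx xs by (simp add: ring_hom_mult[OF hom] pi_right[OF i])
    qed (simp_all add: gx s)
    then show "?g x \<in> ?U" using gx by simp
  qed (use r in \<open>simp_all add: rs.tensor_alg_mult\<close>)
  then show ?thesis using s by simp
qed

text \<open>In the product \<open>(s Y) (r X)\<close> first \<open>r\<close> moves to the left through the word \<open>Y\<close>, then the two words are
  interchanged, then \<open>s\<close>, which commutes with the image of \<open>r\<close>, moves to the right through the word
  \<open>X\<close>.\<close>

lemma tau_formula:
  assumes q: "\<And>u v. u \<in> pm m \<Longrightarrow> v \<in> pm n \<Longrightarrow> q v u \<in> scalars \<and> Z (jt v) \<bullet> Z u = eta (q v u) \<bullet> (Z u \<bullet> Z (jt v))"
    and r: "r \<in> carrier R" and s: "s \<in> carrier S" and us: "us \<in> lists (pm m)" and vs: "vs \<in> lists (pm n)"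
  shows "\<tau> (tens K BB AA (cB s \<otimes>\<^bsub>BB\<^esub> list_prod BB (map gB vs)) (cA r \<otimes>\<^bsub>AA\<^esub> list_prod AA (map gA us))) =
    eta (q_prod RS q vs us)
      \<bullet> eta (multi_pow RS n (\<lambda>i. \<pi> (m + i)) (seq_deg vs) (r \<odot>\<odot> \<one>\<^bsub>S\<^esub>))
      \<bullet> (list_prod AA (map gA us) \<otimes>\<otimes> \<one>\<^bsub>BB\<^esub>)
      \<bullet> eta (multi_pow RS m \<pi> (\<lambda>j. - seq_deg us j) (\<one>\<^bsub>R\<^esub> \<odot>\<odot> s))
      \<bullet> (\<one>\<^bsub>AA\<^esub> \<otimes>\<otimes> list_prod BB (map gB vs))"
proof -
  have U: "set us \<subseteq> pm m" and V: "set vs \<subseteq> pm n" using us vs by auto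
  note lw = left_word[OF U] and rw = right_word[OF V]
  note ex = word_exchange[OF q U V]
  let ?Q = "q_prod RS q vs us" and ?y = "multi_pow RS n (\<lambda>i. \<pi> (m + i)) (seq_deg vs) (r \<odot>\<odot> \<one>\<^bsub>S\<^esub>)"
    and ?z = "multi_pow RS m \<pi> (\<lambda>j. - seq_deg us j) (\<one>\<^bsub>R\<^esub> \<odot>\<odot> s)" and ?s = "\<one>\<^bsub>R\<^esub> \<odot>\<odot> s"
  have Q: "?Q \<in> scalars" and ex1: "ys vs \<bullet> xs us = eta ?Q \<bullet> (xs us \<bullet> ys vs)"
    using ex by blast+
  note Qc = scalars_closed[OF Q]
  have sc: "?s \<in> carrier RS" "r \<odot>\<odot> \<one>\<^bsub>S\<^esub> \<in> carrier RS" using r s by simp_all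
  have cy: "commuting_bijections RS n (\<lambda>i. \<pi> (m + i))"
    by (rule commuting_bijections.intro; intro J.bij J.comm; simp)
  have cz: "commuting_bijections RS m \<pi>"
    by (rule commuting_bijections.intro; intro J.bij J.comm; simp)
  have y: "?y \<in> carrier RS" and z: "?z \<in> carrier RS"
    by (rule commuting_bijections.multi_pow_closed[OF cy le_refl sc(2)],
        rule commuting_bijections.multi_pow_closed[OF cz le_refl sc(1)])
  have ys_coef: "ys vs \<bullet> eta (r \<odot>\<odot> \<one>\<^bsub>S\<^esub>) = eta ?y \<bullet> ys vs"
    by (rule tgw_rep.Zs_coef[OF right_rep V sc(2)])
  have xs_coef: "xs us \<bullet> eta ?z = eta ?s \<bullet> xs us"
    by (rule tgw_rep.Zs_coef_inverse[OF left_rep U sc(1)])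
  have ysc: "eta ?s \<bullet> eta ?y = eta ?y \<bullet> eta ?s"
    using multi_pow_commutes[OF r s, of "seq_deg vs"] sc(1) y by (simp add: J.eta_mult[symmetric])
  have "\<tau> (tens K BB AA (cB s \<otimes>\<^bsub>BB\<^esub> list_prod BB (map gB vs)) (cA r \<otimes>\<^bsub>AA\<^esub> list_prod AA (map gA us)))
      = (\<one>\<^bsub>AA\<^esub> \<otimes>\<otimes> (cB s \<otimes>\<^bsub>BB\<^esub> list_prod BB (map gB vs))) \<bullet> ((cA r \<otimes>\<^bsub>AA\<^esub> list_prod AA (map gA us)) \<otimes>\<otimes> \<one>\<^bsub>BB\<^esub>)"
    using lw rw r s by (simp add: tp.twisted_mult_tau)
  also have "\<dots> = (eta ?s \<bullet> ys vs) \<bullet> (eta (r \<odot>\<odot> \<one>\<^bsub>S\<^esub>) \<bullet> xs us)"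
    using lw rw r s by (simp add: left_mult[symmetric] right_mult[symmetric] eta_left eta_right)
  also have "\<dots> = eta ?s \<bullet> ((ys vs \<bullet> eta (r \<odot>\<odot> \<one>\<^bsub>S\<^esub>)) \<bullet> xs us)"
    using U V sc by (simp add: J.C.m_assoc)
  also have "\<dots> = (eta ?s \<bullet> eta ?y) \<bullet> (ys vs \<bullet> xs us)"
    unfolding ys_coef using U V sc y by (simp add: J.C.m_assoc)
  also have "\<dots> = ((eta ?y \<bullet> eta ?s) \<bullet> eta ?Q) \<bullet> (xs us \<bullet> ys vs)"
    using U V sc y Qc by (simp add: ysc ex1 J.C.m_assoc)
  also have "(eta ?y \<bullet> eta ?s) \<bullet> eta ?Q = eta ?Q \<bullet> (eta ?y \<bullet> eta ?s)"
    using y sc by (intro scalars_central[OF Q]) simp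
  also have "(eta ?Q \<bullet> (eta ?y \<bullet> eta ?s)) \<bullet> (xs us \<bullet> ys vs)
      = eta ?Q \<bullet> eta ?y \<bullet> (eta ?s \<bullet> xs us) \<bullet> ys vs"
    using U V sc y Qc by (simp add: J.C.m_assoc)
  also have "\<dots> = eta ?Q \<bullet> eta ?y \<bullet> xs us \<bullet> eta ?z \<bullet> ys vs"
    unfolding xs_coef[symmetric] using U V z y Qc by (simp add: J.C.m_assoc)
  finally show ?thesis using lw rw by simp
qed

lemma scalar_properties:
  assumes c: "c \<in> carrier K" "c \<noteq> \<zero>\<^bsub>K\<^esub>"
  shows "c \<odot>\<^bsub>RS\<^esub> \<one>\<^bsub>RS\<^esub> \<in> center RS" "c \<odot>\<^bsub>RS\<^esub> \<one>\<^bsub>RS\<^esub> \<in> Units RS"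
    "i \<in> {1..m + n} \<Longrightarrow> \<pi> i (c \<odot>\<^bsub>RS\<^esub> \<one>\<^bsub>RS\<^esub>) = c \<odot>\<^bsub>RS\<^esub> \<one>\<^bsub>RS\<^esub>"
proof -
  show "c \<odot>\<^bsub>RS\<^esub> \<one>\<^bsub>RS\<^esub> \<in> center RS" using c by (auto simp: center_def RS_smult)
  have U: "c \<in> Units K" using c A.K_field field.field_Units by blast
  have d: "inv\<^bsub>K\<^esub> c \<in> carrier K" "inv\<^bsub>K\<^esub> c \<otimes>\<^bsub>K\<^esub> c = \<one>\<^bsub>K\<^esub>" "c \<otimes>\<^bsub>K\<^esub> inv\<^bsub>K\<^esub> c = \<one>\<^bsub>K\<^esub>" using U by auto
  then show "c \<odot>\<^bsub>RS\<^esub> \<one>\<^bsub>RS\<^esub> \<in> Units RS"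
    unfolding Units_def using c
    by (auto simp: RS_smult J.TM.smult_assoc1[symmetric] intro!: bexI[of _ "inv\<^bsub>K\<^esub> c \<odot>\<^bsub>RS\<^esub> \<one>\<^bsub>RS\<^esub>"])
  show "\<pi> i (c \<odot>\<^bsub>RS\<^esub> \<one>\<^bsub>RS\<^esub>) = c \<odot>\<^bsub>RS\<^esub> \<one>\<^bsub>RS\<^esub>" if "i \<in> {1..m + n}"
    using lin_mapD(3)[OF alg_autoD(3)[OF J.auto[OF that]] c(1), of "\<one>\<^bsub>RS\<^esub>"] ring_hom_one[OF alg_autoD(1)[OF J.auto[OF that]]]
    by simp
qed

end

theorem theorem3p19:
  fixes K :: "'k ring" and R :: "('k, 'r) module" and S :: "('k, 's) module" and m n :: nat
    and \<sigma> :: "nat \<Rightarrow> 'r \<Rightarrow> 'r" and t :: "nat \<Rightarrow> 'r" and \<mu> :: "nat \<Rightarrow> nat \<Rightarrow> 'k"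
    and \<rho> :: "nat \<Rightarrow> 's \<Rightarrow> 's" and h :: "nat \<Rightarrow> 's" and \<nu> :: "nat \<Rightarrow> nat \<Rightarrow> 'k"
    and \<pi> :: "nat \<Rightarrow> ('r \<times> 's \<Rightarrow> 'k) set \<Rightarrow> ('r \<times> 's \<Rightarrow> 'k) set"
    and w :: "nat \<Rightarrow> ('r \<times> 's \<Rightarrow> 'k) set" and \<xi> :: "nat \<Rightarrow> nat \<Rightarrow> 'k"
  assumes field: "field K"
    \<comment> \<open>\<open>A\<close>, with structure map \<open>\<eta>\<^sub>A : R \<rightarrow> A\<close> and generators \<open>X\<^sub>A\<close>\<close>
    and datum_A: "tgw_datum K R m \<sigma> t" and mu: "unit_matrix K m \<mu>"
    and regular_A: "regular_datum R m t" and consistent_A: "consistent_datum K R m \<sigma> t \<mu>"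
    and A: "A = tgwa K R m \<sigma> t \<mu>" "\<eta>\<^sub>A = tgwa_coef K R m \<sigma> t \<mu>" "X\<^sub>A = tgwa_gen K R m \<sigma> t \<mu>"
    \<comment> \<open>\<open>B\<close>, with structure map \<open>\<eta>\<^sub>B : S \<rightarrow> B\<close> and generators \<open>Y\<^sub>B\<close>\<close>
    and datum_B: "tgw_datum K S n \<rho> h" and nu: "unit_matrix K n \<nu>"
    and regular_B: "regular_datum S n h" and consistent_B: "consistent_datum K S n \<rho> h \<nu>"
    and B: "B = tgwa K S n \<rho> h \<nu>" "\<eta>\<^sub>B = tgwa_coef K S n \<rho> h \<nu>" "Y\<^sub>B = tgwa_gen K S n \<rho> h \<nu>"
    \<comment> \<open>\<open>R \<otimes> S\<close> and the extendability hypothesis\<close>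
    and RS: "RS = tensor_alg K R S"
    and extendable: "\<exists>\<sigma>' \<rho>'. commuting_extensions K R m \<sigma> S n \<rho> \<sigma>' \<rho>' \<and>
                             factor_preserving K R m S n \<sigma>' \<rho>'"
    \<comment> \<open>\<open>\<tau>\<close> and the twisted tensor product \<open>C = A \<otimes>\<^sub>\<tau> B\<close>\<close>
    and tau: "graded_twisting_map K A m (tgwa_comp K R m \<sigma> t \<mu>) B n (tgwa_comp K S n \<rho> h \<nu>) \<tau>"
    and C: "C = twisted_tensor K A B \<tau>"
    and assoc: "\<forall>x \<in> carrier C. \<forall>y \<in> carrier C. \<forall>z \<in> carrier C.
                  (x \<otimes>\<^bsub>C\<^esub> y) \<otimes>\<^bsub>C\<^esub> z = x \<otimes>\<^bsub>C\<^esub> (y \<otimes>\<^bsub>C\<^esub> z)"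
    \<comment> \<open>\<open>C\<close> is a regular TGWA over \<open>R \<otimes> S\<close> of rank \<open>m + n\<close>, whose automorphisms
        \<open>\<pi>\<^sub>1, \<dots>, \<pi>\<^sub>m, \<pi>\<^sub>m\<^sub>+\<^sub>1, \<dots>, \<pi>\<^sub>m\<^sub>+\<^sub>n\<close> have the invariance property\<close>
    and \<eta>: "\<eta> = tensor_map K A B \<eta>\<^sub>A \<eta>\<^sub>B"
    and datum_C: "tgw_datum K RS (m + n) \<pi> w" and xi: "unit_matrix K (m + n) \<xi>"
    and regular_C: "regular_datum RS (m + n) w"
    and tgwa_C: "is_tgwa_over K RS (m + n) \<pi> w \<xi> C \<eta> (joint_gens K A m X\<^sub>A B Y\<^sub>B)"
    and preserving_C: "factor_preserving K R m S n \<pi> (\<lambda>i. \<pi> (m + i))"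
  shows "\<exists>\<sigma>' \<rho>'. commuting_extensions K R m \<sigma> S n \<rho> \<sigma>' \<rho>' \<and>
    (\<exists>q :: int \<Rightarrow> int \<Rightarrow> ('r \<times> 's \<Rightarrow> 'k) set.
      (\<forall>v \<in> pm n. \<forall>u \<in> pm m. q v u \<in> center RS \<and> q v u \<in> Units RS \<and>
         (\<forall>j \<in> {1..m}. \<sigma>' j (q v u) = q v u) \<and> (\<forall>i \<in> {1..n}. \<rho>' i (q v u) = q v u)) \<and>
      (\<forall>r \<in> carrier R. \<forall>s \<in> carrier S. \<forall>us \<in> lists (pm m). \<forall>vs \<in> lists (pm n).
         \<tau> (tens K B A (\<eta>\<^sub>B s \<otimes>\<^bsub>B\<^esub> list_prod B (map Y\<^sub>B vs)) (\<eta>\<^sub>A r \<otimes>\<^bsub>A\<^esub> list_prod A (map X\<^sub>A us))) =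
         \<eta> (q_prod RS q vs us)
           \<otimes>\<^bsub>C\<^esub> \<eta> (multi_pow RS n \<rho>' (seq_deg vs) (tens K R S r \<one>\<^bsub>S\<^esub>))
           \<otimes>\<^bsub>C\<^esub> tens K A B (list_prod A (map X\<^sub>A us)) \<one>\<^bsub>B\<^esub>
           \<otimes>\<^bsub>C\<^esub> \<eta> (multi_pow RS m \<sigma>' (\<lambda>j. - seq_deg us j) (tens K R S \<one>\<^bsub>R\<^esub> s))
           \<otimes>\<^bsub>C\<^esub> tens K A B \<one>\<^bsub>A\<^esub> (list_prod B (map Y\<^sub>B vs))))"
proof -
  interpret P: tgwa_twisted_product K R S m n \<sigma> t \<mu> \<rho> h \<nu> \<pi> w \<xi> \<tau>
    using datum_A mu consistent_A datum_B nu consistent_B tau datum_C xi regular_C tgwa_C preserving_C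
    unfolding A B RS C \<eta> by (rule tgwa_twisted_product.intro)
  let ?good = "\<lambda>v u k. k \<in> carrier K \<and> k \<noteq> \<zero>\<^bsub>K\<^esub> \<and>
      P.Z (P.jt v) \<otimes>\<^bsub>P.CC\<^esub> P.Z u = k \<odot>\<^bsub>P.CC\<^esub> (P.Z u \<otimes>\<^bsub>P.CC\<^esub> P.Z (P.jt v))"
  define c where "c = (\<lambda>v u. SOME k. ?good v u k)"
  have c: "?good v u (c v u)" if "v \<in> pm n" "u \<in> pm m" for v u
    unfolding c_def by (rule someI_ex[of "?good v u"]) (use P.scalar_exchange[OF that(2,1)] in blast)
  define q where "q = (\<lambda>v u. c v u \<odot>\<^bsub>P.RS\<^esub> \<one>\<^bsub>P.RS\<^esub>)"
  have q: "q v u \<in> P.scalars \<and> P.Z (P.jt v) \<otimes>\<^bsub>P.CC\<^esub> P.Z u = P.eta (q v u) \<otimes>\<^bsub>P.CC\<^esub> (P.Z u \<otimes>\<^bsub>P.CC\<^esub> P.Z (P.jt v))"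
    if "u \<in> pm m" "v \<in> pm n" for u v
    using c[OF that(2,1)] that by (simp add: q_def P.scalars_def P.J.eta_scalar P.pm_left P.jt_simps)
  have props: "q v u \<in> center RS" "q v u \<in> Units RS" "i \<in> {1..m + n} \<Longrightarrow> \<pi> i (q v u) = q v u"
    if "v \<in> pm n" "u \<in> pm m" for v u i
    using P.scalar_properties c[OF that] unfolding q_def RS by auto
  show ?thesis
  proof (intro exI conjI ballI)
    show "commuting_extensions K R m \<sigma> S n \<rho> \<pi> (\<lambda>i. \<pi> (m + i))" by (rule P.pi_extensions)
    fix v u assume vu: "v \<in> pm n" "u \<in> pm m"
    show "q v u \<in> center RS" "q v u \<in> Units RS" by (rule props(1)[OF vu], rule props(2)[OF vu])
    show "\<pi> j (q v u) = q v u" if "j \<in> {1..m}" for j by (rule props(3)[OF vu]) (use that in simp)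
    show "\<pi> (m + i) (q v u) = q v u" if "i \<in> {1..n}" for i by (rule props(3)[OF vu]) (use that in simp)
  next
    fix r s us vs
    assume rs: "r \<in> carrier R" "s \<in> carrier S" and words: "us \<in> lists (pm m)" "vs \<in> lists (pm n)"
    show "\<tau> (tens K B A (\<eta>\<^sub>B s \<otimes>\<^bsub>B\<^esub> list_prod B (map Y\<^sub>B vs)) (\<eta>\<^sub>A r \<otimes>\<^bsub>A\<^esub> list_prod A (map X\<^sub>A us))) =
         \<eta> (q_prod RS q vs us)
           \<otimes>\<^bsub>C\<^esub> \<eta> (multi_pow RS n (\<lambda>i. \<pi> (m + i)) (seq_deg vs) (tens K R S r \<one>\<^bsub>S\<^esub>))
           \<otimes>\<^bsub>C\<^esub> tens K A B (list_prod A (map X\<^sub>A us)) \<one>\<^bsub>B\<^esub>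
           \<otimes>\<^bsub>C\<^esub> \<eta> (multi_pow RS m \<pi> (\<lambda>j. - seq_deg us j) (tens K R S \<one>\<^bsub>R\<^esub> s))
           \<otimes>\<^bsub>C\<^esub> tens K A B \<one>\<^bsub>A\<^esub> (list_prod B (map Y\<^sub>B vs))"
      unfolding A B RS C \<eta> by (rule P.tau_formula[OF _ rs words]) (rule q)
  qed
qed

end
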